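(* Let $\mathcal{T}$ be a triangulated category, let $X\xrightarrow{u}Y\xrightarrow{v}Z\xrightarrow{w}\Sigma X$ and $X'\xrightarrow{u'}Y'\xrightarrow{v'}Z'\xrightarrow{w'}\Sigma X'$ be exact triangles, and let $h\colon Z\to Z'$ be such that $(0,0,h)$ is a map of triangles from the first to the second. The following are equivalent: (1) The map $(0,0,h)$ is good. (2) The map $(0,0,h)$ is Verdier good. (3) The map $(0,0,h)$ is middling good. (4) The Toda bracket $\langle w',h,v\rangle\subseteq\mathcal{T}(\Sigma Y,\Sigma X')$ contains zero. (5) The map $h$ is a lightning flash, i.e. $h=v'\theta w$ for some $\theta\colon\Sigma X\to Y'$. Moreover, the analogous statements hold for maps of triangles of the form $(f,0,0)$ (with Toda bracket $\langle u',f,\Sigma^{-1}w\rangle\subseteq\mathcal{T}(Z,Y')$ in (4), and with (5) reading $f=(\Sigma^{-1}w')\theta u$ for some $\theta\colon Y\to\Sigma^{-1}Z'$) and of the form $(0,g,0)$ (with Toda bracket $\langle v',g,u\rangle\subseteq\mathcal{T}(\Sigma X,Z')$ in (4), and with (5) reading $g=u'\theta v$ for some $\theta\colon Z\to X'$). Consequently, Verdier goodness is rotation invariant for maps of triangles with at most one non-zero component: such a map $(f,g,h)$ is Verdier good if and only if the rotated map $(g,h,\Sigma f)$, from $Y\xrightarrow{v}Z\xrightarrow{w}\Sigma X\xrightarrow{-\Sigma u}\Sigma Y$ to $Y'\xrightarrow{v'}Z'\xrightarrow{w'}\Sigma X'\xrightarrow{-\Sigma u'}\Sigma Y'$, is Verdier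 good.
   Context: $\mathcal{T}$ is a triangulated category with self-equivalence $\Sigma$; the natural isomorphisms $\Sigma\Sigma^{-1}\cong 1\cong\Sigma^{-1}\Sigma$ are suppressed. "Exact triangle" or "triangle" means distinguished triangle. A map of triangles $(f,g,h)$ from $X\xrightarrow{u}Y\xrightarrow{v}Z\xrightarrow{w}\Sigma X$ to $X'\xrightarrow{u'}Y'\xrightarrow{v'}Z'\xrightarrow{w'}\Sigma X'$ consists of $f\colon X\to X'$, $g\colon Y\to Y'$, $h\colon Z\to Z'$ with $gu=u'f$, $hv=v'g$, $(\Sigma f)w=w'h$. Good: the mapping cone of $(f,g,h)$ is the sequence $X'\oplus Y\to Y'\oplus Z\to Z'\oplus\Sigma X\to\Sigma X'\oplus\Sigma Y$ with successive maps $\begin{bmatrix}u'&g\\0&-v\end{bmatrix},\begin{bmatrix}v'&h\\0&-w\end{bmatrix},\begin{bmatrix}w'&\Sigma f\\0&-\Sigma u\end{bmatrix}$ (acting on column vectors). $(f,g,h)$ is good if its mapping cone is an exact triangle. Middling good: $(f,g,h)$ is middling good if there are exact triangles $X\xrightarrow{f}X'\xrightarrow{f'}X''\xrightarrow{f''}\Sigma X$, $Y\xrightarrow{g}Y'\xrightarrow{g'}Y''\xrightarrow{g''}\Sigma Y$, $Z\xrightarrow{h}Z'\xrightarrow{h'}Z''\xrightarrow{h''}\Sigma Z$ and an exact triangle $X''\xrightarrow{u''}Y''\xrightarrow{v''}Z''\xrightarrow{w''}\Sigma X''$ with $g'u'=u''f'$, $h'v'=v''g'$, $(\Sigma f')w'=w''h'$,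 $g''u''=(\Sigma u)f''$, $h''v''=(\Sigma v)g''$ and $(\Sigma f'')w''=-(\Sigma w)h''$. Octahedra: given composable maps $P\xrightarrow{a}Q\xrightarrow{b}R$ and exact triangles $P\xrightarrow{a}Q\xrightarrow{a'}C_a\xrightarrow{a''}\Sigma P$, $Q\xrightarrow{b}R\xrightarrow{b'}C_b\xrightarrow{b''}\Sigma Q$, $P\xrightarrow{ba}R\xrightarrow{c'}C\xrightarrow{c''}\Sigma P$, an octahedron for the composite $ba$ consists of maps $\alpha\colon C_a\to C$, $\beta\colon C\to C_b$, $\gamma\colon C_b\to\Sigma C_a$ such that $C_a\xrightarrow{\alpha}C\xrightarrow{\beta}C_b\xrightarrow{\gamma}\Sigma C_a$ is exact and $\alpha a'=c'b$, $c''\alpha=a''$, $\beta c'=b'$, $\gamma=(\Sigma a')b''$, $b''\beta=(\Sigma a)c''$. Verdier good: choose exact triangles $X\xrightarrow{f}X'\xrightarrow{f'}X''\xrightarrow{f''}\Sigma X$, $Y\xrightarrow{g}Y'\xrightarrow{g'}Y''\xrightarrow{g''}\Sigma Y$ and $X\xrightarrow{gu=u'f}Y'\xrightarrow{\tilde v}A\xrightarrow{\tilde w}\Sigma X$. The map $(f,g,h)$ is Verdier good if there exist an octahedron $(\alpha_1\colon Z\to A,\ \beta_1\colon A\to Y'',\ \gamma_1)$ for the composite $X\xrightarrow{u}Y\xrightarrow{g}Y'$ and an octahedron $(\alpha_2\colon X''\to A,\ \beta_2\colon A\to Z',\ \gamma_2)$ for the composite $X\xrightarrow{f}X'\xrightarrow{u'}Y'$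 (both using the given and chosen triangles, in particular the same triangle on $gu=u'f$) such that $h=\beta_2\alpha_1$. This does not depend on the chosen triangles. Toda bracket: for composable maps $A_0\xrightarrow{a_1}A_1\xrightarrow{a_2}A_2\xrightarrow{a_3}A_3$, choose an exact triangle $A_0\xrightarrow{a_1}A_1\xrightarrow{p}C\xrightarrow{q}\Sigma A_0$. Then $\langle a_3,a_2,a_1\rangle\subseteq\mathcal{T}(\Sigma A_0,A_3)$ is the set of maps $\psi\colon\Sigma A_0\to A_3$ for which there exists $\varphi\colon C\to A_2$ with $\varphi p=a_2$ and $a_3\varphi=\psi q$. *)

theory Defs
  imports "HOL-Algebra.Group"
begin

section \<open>Categories\<close>

text \<open>Arrows carry their domain and codomain; \<open>g \<cdot> f\<close> is ``first \<open>f\<close>, then \<open>g\<close>''.\<close>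

record ('o, 'm) cat =
  Ob :: "'o set"
  Arr :: "'m set"
  Dom :: "'m \<Rightarrow> 'o"
  Cod :: "'m \<Rightarrow> 'o"
  Ident :: "'o \<Rightarrow> 'm"
  Comp :: "'m \<Rightarrow> 'm \<Rightarrow> 'm"  (infixr "\<cdot>\<index>" 75)

definition Hom :: "('o, 'm, 'z) cat_scheme \<Rightarrow> 'o \<Rightarrow> 'o \<Rightarrow> 'm set" where
  "Hom C X Y = {f \<in> Arr C. Dom C f = X \<and> Cod C f = Y}"

locale category =
  fixes C :: "('o, 'm, 'z) cat_scheme" (structure)
  assumes Dom_Ob: "f \<in> Arr C \<Longrightarrow> Dom C f \<in> Ob C"
    and Cod_Ob: "f \<in> Arr C \<Longrightarrow> Cod C f \<in> Ob C"
    and Ident_Hom: "X \<in> Ob C \<Longrightarrow> Ident C X \<in> Hom C X X"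
    and Comp_Hom: "\<lbrakk>f \<in> Hom C X Y; g \<in> Hom C Y Z\<rbrakk> \<Longrightarrow> g \<cdot> f \<in> Hom C X Z"
    and Comp_assoc: "\<lbrakk>f \<in> Hom C X Y; g \<in> Hom C Y Z; h \<in> Hom C Z W\<rbrakk>
                       \<Longrightarrow> (h \<cdot> g) \<cdot> f = h \<cdot> (g \<cdot> f)"
    and Comp_Ident: "f \<in> Hom C X Y \<Longrightarrow> f \<cdot> Ident C X = f"
    and Ident_Comp: "f \<in> Hom C X Y \<Longrightarrow> Ident C Y \<cdot> f = f"

definition is_iso :: "('o, 'm, 'z) cat_scheme \<Rightarrow> 'm \<Rightarrow> bool" where
  "is_iso C f \<longleftrightarrow> f \<in> Arr C \<and>
     (\<exists>g \<in> Hom C (Cod C f) (Dom C f).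
        Comp C g f = Ident C (Dom C f) \<and> Comp C f g = Ident C (Cod C f))"

definition endofunctor :: "('o, 'm, 'z) cat_scheme \<Rightarrow> ('o \<Rightarrow> 'o) \<Rightarrow> ('m \<Rightarrow> 'm) \<Rightarrow> bool" where
  "endofunctor C Fo Fa \<longleftrightarrow>
     (\<forall>X \<in> Ob C. Fo X \<in> Ob C \<and> Fa (Ident C X) = Ident C (Fo X)) \<and>
     (\<forall>X Y. \<forall>f \<in> Hom C X Y. Fa f \<in> Hom C (Fo X) (Fo Y)) \<and>
     (\<forall>X Y Z. \<forall>f \<in> Hom C X Y. \<forall>g \<in> Hom C Y Z. Fa (Comp C g f) = Comp C (Fa g) (Fa f))"

definition natural_iso ::
  "('o, 'm, 'z) cat_scheme \<Rightarrow> ('o \<Rightarrow> 'o) \<Rightarrow> ('m \<Rightarrow> 'm) \<Rightarrow> ('o \<Rightarrow> 'o) \<Rightarrow> ('m \<Rightarrow> 'm) \<Rightarrow> ('o \<Rightarrow> 'm) \<Rightarrow> bool"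
  where
  "natural_iso C Fo Fa Go Ga \<tau> \<longleftrightarrow>
     (\<forall>X \<in> Ob C. \<tau> X \<in> Hom C (Fo X) (Go X) \<and> is_iso C (\<tau> X)) \<and>
     (\<forall>X Y. \<forall>f \<in> Hom C X Y. Comp C (\<tau> Y) (Fa f) = Comp C (Ga f) (\<tau> X))"


section \<open>Additive categories\<close>

text \<open>\<open>Biprod A B\<close> is a chosen biproduct of \<open>A\<close> and \<open>B\<close> with injections \<open>In1 A B\<close>, \<open>In2 A B\<close> and
  projections \<open>Pr1 A B\<close>, \<open>Pr2 A B\<close>.\<close>

record ('o, 'm) additive_cat = "('o, 'm) cat" +
  Zero :: "'o \<Rightarrow> 'o \<Rightarrow> 'm"
  Plus :: "'m \<Rightarrow> 'm \<Rightarrow> 'm"  (infixl "\<^bold>+\<index>" 65)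
  Biprod :: "'o \<Rightarrow> 'o \<Rightarrow> 'o"
  In1 :: "'o \<Rightarrow> 'o \<Rightarrow> 'm"
  In2 :: "'o \<Rightarrow> 'o \<Rightarrow> 'm"
  Pr1 :: "'o \<Rightarrow> 'o \<Rightarrow> 'm"
  Pr2 :: "'o \<Rightarrow> 'o \<Rightarrow> 'm"

definition hom_group :: "('o, 'm, 'z) additive_cat_scheme \<Rightarrow> 'o \<Rightarrow> 'o \<Rightarrow> 'm monoid" where
  "hom_group C X Y = \<lparr>carrier = Hom C X Y, monoid.mult = Plus C, one = Zero C X Y\<rparr>"

definition neg :: "('o, 'm, 'z) additive_cat_scheme \<Rightarrow> 'm \<Rightarrow> 'm" where
  "neg C f = m_inv (hom_group C (Dom C f) (Cod C f)) f"

definition zero_object :: "('o, 'm, 'z) additive_cat_scheme \<Rightarrow> 'o \<Rightarrow> bool" where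
  "zero_object C N \<longleftrightarrow> N \<in> Ob C \<and> (\<forall>X \<in> Ob C. (\<exists>!f. f \<in> Hom C X N) \<and> (\<exists>!f. f \<in> Hom C N X))"

locale additive_category = category C
  for C :: "('o, 'm, 'z) additive_cat_scheme" (structure) +
  assumes hom_group: "\<lbrakk>X \<in> Ob C; Y \<in> Ob C\<rbrakk> \<Longrightarrow> comm_group (hom_group C X Y)"
    and Comp_Plus: "\<lbrakk>f \<in> Hom C X Y; f' \<in> Hom C X Y; g \<in> Hom C Y Z\<rbrakk>
                      \<Longrightarrow> g \<cdot> (f \<^bold>+ f') = g \<cdot> f \<^bold>+ g \<cdot> f'"
    and Plus_Comp: "\<lbrakk>f \<in> Hom C X Y; g \<in> Hom C Y Z; g' \<in> Hom C Y Z\<rbrakk>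
                      \<Longrightarrow> (g \<^bold>+ g') \<cdot> f = g \<cdot> f \<^bold>+ g' \<cdot> f"
    and ex_zero_object: "\<exists>N. zero_object C N"
    and Biprod_Ob: "\<lbrakk>A \<in> Ob C; B \<in> Ob C\<rbrakk> \<Longrightarrow> Biprod C A B \<in> Ob C"
    and In1_Hom: "\<lbrakk>A \<in> Ob C; B \<in> Ob C\<rbrakk> \<Longrightarrow> In1 C A B \<in> Hom C A (Biprod C A B)"
    and In2_Hom: "\<lbrakk>A \<in> Ob C; B \<in> Ob C\<rbrakk> \<Longrightarrow> In2 C A B \<in> Hom C B (Biprod C A B)"
    and Pr1_Hom: "\<lbrakk>A \<in> Ob C; B \<in> Ob C\<rbrakk> \<Longrightarrow> Pr1 C A B \<in> Hom C (Biprod C A B) A"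
    and Pr2_Hom: "\<lbrakk>A \<in> Ob C; B \<in> Ob C\<rbrakk> \<Longrightarrow> Pr2 C A B \<in> Hom C (Biprod C A B) B"
    and Pr1_In1: "\<lbrakk>A \<in> Ob C; B \<in> Ob C\<rbrakk> \<Longrightarrow> Pr1 C A B \<cdot> In1 C A B = Ident C A"
    and Pr2_In2: "\<lbrakk>A \<in> Ob C; B \<in> Ob C\<rbrakk> \<Longrightarrow> Pr2 C A B \<cdot> In2 C A B = Ident C B"
    and Pr1_In2: "\<lbrakk>A \<in> Ob C; B \<in> Ob C\<rbrakk> \<Longrightarrow> Pr1 C A B \<cdot> In2 C A B = Zero C B A"
    and Pr2_In1: "\<lbrakk>A \<in> Ob C; B \<in> Ob C\<rbrakk> \<Longrightarrow> Pr2 C A B \<cdot> In1 C A B = Zero C A B"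
    and In_Pr_sum: "\<lbrakk>A \<in> Ob C; B \<in> Ob C\<rbrakk>
                      \<Longrightarrow> In1 C A B \<cdot> Pr1 C A B \<^bold>+ In2 C A B \<cdot> Pr2 C A B = Ident C (Biprod C A B)"

text \<open>\<open>block_matrix C a b c d\<close> is the map from \<open>A \<oplus> B\<close> to \<open>A' \<oplus> B'\<close> with rows \<open>[a b]\<close> and \<open>[c d]\<close>,
  acting on column vectors, for \<open>a : A \<rightarrow> A'\<close>, \<open>b : B \<rightarrow> A'\<close>, \<open>c : A \<rightarrow> B'\<close> and \<open>d : B \<rightarrow> B'\<close>.\<close>

definition block_matrix ::
  "('o, 'm, 'z) additive_cat_scheme \<Rightarrow> 'm \<Rightarrow> 'm \<Rightarrow> 'm \<Rightarrow> 'm \<Rightarrow> 'm" where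
  "block_matrix C a b c d =
     (let A = Dom C a; B = Dom C d; A' = Cod C a; B' = Cod C d in
        In1 C A' B' \<cdot> a \<cdot> Pr1 C A B \<^bold>+ In1 C A' B' \<cdot> b \<cdot> Pr2 C A B \<^bold>+
        In2 C A' B' \<cdot> c \<cdot> Pr1 C A B \<^bold>+ In2 C A' B' \<cdot> d \<cdot> Pr2 C A B)"
  for C (structure)

section \<open>Triangulated categories\<close>

text \<open>The functor \<open>(SigmaO, SigmaA)\<close> is the self-equivalence \<open>\<Sigma>\<close> and \<open>(InvSigmaO, InvSigmaA)\<close> is its
  quasi-inverse \<open>\<Sigma>\<inverse>\<close>. The isomorphisms \<open>to_SigInv X : X \<rightarrow> \<Sigma>\<Sigma>\<inverse>X\<close> and
  \<open>from_InvSig X : \<Sigma>\<inverse>\<Sigma>X \<rightarrow> X\<close> are explicit. They satisfy the triangle identities, so that they form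
  an adjoint equivalence and can be used as coherent identifications; the quasi-inverse and
  the isomorphisms of any equivalence can be chosen in this way.

  A triangle is a triple of maps \<open>(u, v, w)\<close>; its objects are determined by the maps.\<close>

record ('o, 'm) triang_cat = "('o, 'm) additive_cat" +
  SigmaO :: "'o \<Rightarrow> 'o"
  SigmaA :: "'m \<Rightarrow> 'm"
  InvSigmaO :: "'o \<Rightarrow> 'o"
  InvSigmaA :: "'m \<Rightarrow> 'm"
  to_SigInv :: "'o \<Rightarrow> 'm"
  from_InvSig :: "'o \<Rightarrow> 'm"
  Exact :: "('m \<times> 'm \<times> 'm) set"

definition candidate_triangle ::
  "('o, 'm, 'z) triang_cat_scheme \<Rightarrow> 'o \<Rightarrow> 'o \<Rightarrow> 'o \<Rightarrow> 'm \<times> 'm \<times> 'm \<Rightarrow> bool" where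
  "candidate_triangle T X Y Z = (\<lambda>(u, v, w).
     u \<in> Hom T X Y \<and> v \<in> Hom T Y Z \<and> w \<in> Hom T Z (SigmaO T X))"

definition exact_triangle ::
  "('o, 'm, 'z) triang_cat_scheme \<Rightarrow> 'o \<Rightarrow> 'o \<Rightarrow> 'o \<Rightarrow> 'm \<times> 'm \<times> 'm \<Rightarrow> bool" where
  "exact_triangle T X Y Z t \<longleftrightarrow> candidate_triangle T X Y Z t \<and> t \<in> Exact T"

definition triangle_map ::
  "('o, 'm, 'z) triang_cat_scheme \<Rightarrow> 'm \<times> 'm \<times> 'm \<Rightarrow> 'm \<times> 'm \<times> 'm \<Rightarrow> 'm \<times> 'm \<times> 'm \<Rightarrow> bool" where
  "triangle_map T = (\<lambda>(u, v, w) (u', v', w') (f, g, h).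
     f \<in> Hom T (Dom T u) (Dom T u') \<and>
     g \<in> Hom T (Dom T v) (Dom T v') \<and>
     h \<in> Hom T (Dom T w) (Dom T w') \<and>
     g \<cdot> u = u' \<cdot> f \<and> h \<cdot> v = v' \<cdot> g \<and> SigmaA T f \<cdot> w = w' \<cdot> h)"
  for T (structure)

definition rotate_triangle ::
  "('o, 'm, 'z) triang_cat_scheme \<Rightarrow> 'm \<times> 'm \<times> 'm \<Rightarrow> 'm \<times> 'm \<times> 'm" where
  "rotate_triangle T = (\<lambda>(u, v, w). (v, w, neg T (SigmaA T u)))"

definition rotate_map ::
  "('o, 'm, 'z) triang_cat_scheme \<Rightarrow> 'm \<times> 'm \<times> 'm \<Rightarrow> 'm \<times> 'm \<times> 'm" where
  "rotate_map T = (\<lambda>(f, g, h). (g, h, SigmaA T f))"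

text \<open>\<open>(p, q) \<in> cones T a\<close> is a choice of an exact triangle on the map \<open>a\<close>.\<close>

definition cones :: "('o, 'm, 'z) triang_cat_scheme \<Rightarrow> 'm \<Rightarrow> ('m \<times> 'm) set" where
  "cones T a = {(p, q). exact_triangle T (Dom T a) (Cod T a) (Cod T p) (a, p, q)}"

text \<open>\<open>octahedron T a b k_a k_b k_ba\<close>: the first two arguments are the composable maps, the next
  three the remaining maps of the given exact triangles on \<open>a\<close>, \<open>b\<close> and \<open>b \<cdot> a\<close>.\<close>

definition octahedron ::
  "('o, 'm, 'z) triang_cat_scheme \<Rightarrow> 'm \<Rightarrow> 'm \<Rightarrow> 'm \<times> 'm \<Rightarrow> 'm \<times> 'm \<Rightarrow> 'm \<times> 'm \<Rightarrow>
     'm \<times> 'm \<times> 'm \<Rightarrow> bool" where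
  "octahedron T a b = (\<lambda>(a', a'') (b', b'') (c', c'') (\<alpha>, \<beta>, \<gamma>).
     exact_triangle T (Cod T a') (Cod T c') (Cod T b') (\<alpha>, \<beta>, \<gamma>) \<and>
     \<alpha> \<cdot> a' = c' \<cdot> b \<and> c'' \<cdot> \<alpha> = a'' \<and> \<beta> \<cdot> c' = b' \<and>
     \<gamma> = SigmaA T a' \<cdot> b'' \<and> b'' \<cdot> \<beta> = SigmaA T a \<cdot> c'')"
  for T (structure)

locale triangulated_category = additive_category T
  for T :: "('o, 'm, 'z) triang_cat_scheme" (structure) +
  assumes Sigma_functor: "endofunctor T (SigmaO T) (SigmaA T)"
    and Sigma_additive: "\<lbrakk>f \<in> Hom T X Y; f' \<in> Hom T X Y\<rbrakk>
                           \<Longrightarrow> SigmaA T (f \<^bold>+ f') = SigmaA T f \<^bold>+ SigmaA T f'"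
    and InvSigma_functor: "endofunctor T (InvSigmaO T) (InvSigmaA T)"
    and to_SigInv_iso:
      "natural_iso T (\<lambda>X. X) (\<lambda>f. f)
         (\<lambda>X. SigmaO T (InvSigmaO T X)) (\<lambda>f. SigmaA T (InvSigmaA T f)) (to_SigInv T)"
    and from_InvSig_iso:
      "natural_iso T (\<lambda>X. InvSigmaO T (SigmaO T X)) (\<lambda>f. InvSigmaA T (SigmaA T f))
         (\<lambda>X. X) (\<lambda>f. f) (from_InvSig T)"
    and triangle_identity_Sigma:
      "X \<in> Ob T \<Longrightarrow> SigmaA T (from_InvSig T X) \<cdot> to_SigInv T (SigmaO T X) = Ident T (SigmaO T X)"
    and triangle_identity_InvSigma:
      "X \<in> Ob T \<Longrightarrow>
         from_InvSig T (InvSigmaO T X) \<cdot> InvSigmaA T (to_SigInv T X) = Ident T (InvSigmaO T X)"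
    and Exact_candidate: "t \<in> Exact T \<Longrightarrow> \<exists>X Y Z. candidate_triangle T X Y Z t"
    and Exact_iso:
      "\<lbrakk>t \<in> Exact T; candidate_triangle T X' Y' Z' t'; triangle_map T t t' (f, g, h);
        is_iso T f; is_iso T g; is_iso T h\<rbrakk> \<Longrightarrow> t' \<in> Exact T"
    and Exact_Ident:
      "\<lbrakk>X \<in> Ob T; zero_object T N\<rbrakk>
         \<Longrightarrow> (Ident T X, Zero T X N, Zero T N (SigmaO T X)) \<in> Exact T"
    and Exact_exists: "u \<in> Arr T \<Longrightarrow> \<exists>v w. (u, v, w) \<in> Exact T"
    and Exact_rotate:
      "candidate_triangle T X Y Z t \<Longrightarrow> t \<in> Exact T \<longleftrightarrow> rotate_triangle T t \<in> Exact T"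
    and Exact_fill_in:
      "\<lbrakk>(u, v, w) \<in> Exact T; (u', v', w') \<in> Exact T;
        f \<in> Hom T (Dom T u) (Dom T u'); g \<in> Hom T (Cod T u) (Cod T u'); g \<cdot> u = u' \<cdot> f\<rbrakk>
         \<Longrightarrow> \<exists>h. triangle_map T (u, v, w) (u', v', w') (f, g, h)"
    and Exact_octahedron:
      "\<lbrakk>a \<in> Hom T P Q; b \<in> Hom T Q R;
        k_a \<in> cones T a; k_b \<in> cones T b; k_ba \<in> cones T (b \<cdot> a)\<rbrakk>
         \<Longrightarrow> \<exists>\<alpha> \<beta> \<gamma>. octahedron T a b k_a k_b k_ba (\<alpha>, \<beta>, \<gamma>)"


section \<open>Classes of maps of triangles, and Toda brackets\<close>

text \<open>The canonical isomorphism from \<open>\<Sigma>A \<oplus> \<Sigma>B\<close> to \<open>\<Sigma>(A \<oplus> B)\<close>, needed to regard the mapping cone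
  of a map of triangles, which ends in \<open>\<Sigma>X' \<oplus> \<Sigma>Y\<close>, as a candidate triangle.\<close>

definition Sigma_Sum :: "('o, 'm, 'z) triang_cat_scheme \<Rightarrow> 'o \<Rightarrow> 'o \<Rightarrow> 'm" where
  "Sigma_Sum T A B =
     SigmaA T (In1 T A B) \<cdot> Pr1 T (SigmaO T A) (SigmaO T B) \<^bold>+
     SigmaA T (In2 T A B) \<cdot> Pr2 T (SigmaO T A) (SigmaO T B)"
  for T (structure)

definition mapping_cone ::
  "('o, 'm, 'z) triang_cat_scheme \<Rightarrow> 'm \<times> 'm \<times> 'm \<Rightarrow> 'm \<times> 'm \<times> 'm \<Rightarrow> 'm \<times> 'm \<times> 'm \<Rightarrow>
     'm \<times> 'm \<times> 'm" where
  "mapping_cone T = (\<lambda>(u, v, w) (u', v', w') (f, g, h).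
     (let X = Dom T u; Y = Dom T v; Z = Dom T w;
          X' = Dom T u'; Y' = Dom T v'; Z' = Dom T w'
      in (block_matrix T u' g (Zero T X' Z) (neg T v),
          block_matrix T v' h (Zero T Y' (SigmaO T X)) (neg T w),
          Sigma_Sum T X' Y \<cdot>
            block_matrix T w' (SigmaA T f) (Zero T Z' (SigmaO T Y)) (neg T (SigmaA T u)))))"
  for T (structure)

definition good ::
  "('o, 'm, 'z) triang_cat_scheme \<Rightarrow> 'm \<times> 'm \<times> 'm \<Rightarrow> 'm \<times> 'm \<times> 'm \<Rightarrow> 'm \<times> 'm \<times> 'm \<Rightarrow> bool"
  where
  "good T t t' m \<longleftrightarrow> mapping_cone T t t' m \<in> Exact T"

definition middling_good ::
  "('o, 'm, 'z) triang_cat_scheme \<Rightarrow> 'm \<times> 'm \<times> 'm \<Rightarrow> 'm \<times> 'm \<times> 'm \<Rightarrow> 'm \<times> 'm \<times> 'm \<Rightarrow> bool" where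
  "middling_good T = (\<lambda>(u, v, w) (u', v', w') (f, g, h).
     (\<exists>f' f'' g' g'' h' h'' u'' v'' w''.
        (f', f'') \<in> cones T f \<and> (g', g'') \<in> cones T g \<and> (h', h'') \<in> cones T h \<and>
        exact_triangle T (Cod T f') (Cod T g') (Cod T h') (u'', v'', w'') \<and>
        g' \<cdot> u' = u'' \<cdot> f' \<and> h' \<cdot> v' = v'' \<cdot> g' \<and> SigmaA T f' \<cdot> w' = w'' \<cdot> h' \<and>
        g'' \<cdot> u'' = SigmaA T u \<cdot> f'' \<and> h'' \<cdot> v'' = SigmaA T v \<cdot> g'' \<and>
        SigmaA T f'' \<cdot> w'' = neg T (SigmaA T w \<cdot> h'')))"
  for T (structure)

text \<open>Verdier goodness relative to chosen exact triangles on \<open>f\<close>, \<open>g\<close> and \<open>g \<cdot> u = u' \<cdot> f\<close>, whose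
  remaining maps are \<open>k_f\<close>, \<open>k_g\<close> and \<open>k_gu\<close>. Likewise the Toda bracket below is relative to a chosen
  exact triangle on its rightmost map. Results are to be stated for all choices.\<close>

definition verdier_good ::
  "('o, 'm, 'z) triang_cat_scheme \<Rightarrow> 'm \<times> 'm \<Rightarrow> 'm \<times> 'm \<Rightarrow> 'm \<times> 'm \<Rightarrow>
     'm \<times> 'm \<times> 'm \<Rightarrow> 'm \<times> 'm \<times> 'm \<Rightarrow> 'm \<times> 'm \<times> 'm \<Rightarrow> bool" where
  "verdier_good T k_f k_g k_gu = (\<lambda>(u, v, w) (u', v', w') (f, g, h).
     (\<exists>\<alpha>1 \<beta>1 \<gamma>1 \<alpha>2 \<beta>2 \<gamma>2.
        octahedron T u g (v, w) k_g k_gu (\<alpha>1, \<beta>1, \<gamma>1) \<and>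
        octahedron T f u' k_f (v', w') k_gu (\<alpha>2, \<beta>2, \<gamma>2) \<and>
        h = \<beta>2 \<cdot> \<alpha>1))"
  for T (structure)

definition toda_bracket ::
  "('o, 'm, 'z) triang_cat_scheme \<Rightarrow> 'm \<times> 'm \<Rightarrow> 'm \<Rightarrow> 'm \<Rightarrow> 'm \<Rightarrow> 'm set" where
  "toda_bracket T = (\<lambda>(p, q) a3 a2 a1.
     {\<psi> \<in> Hom T (SigmaO T (Dom T a1)) (Cod T a3).
        \<exists>\<phi> \<in> Hom T (Cod T p) (Cod T a2). \<phi> \<cdot> p = a2 \<and> a3 \<cdot> \<phi> = \<psi> \<cdot> q})"
  for T (structure)

text \<open>For \<open>w : Z \<rightarrow> \<Sigma>X\<close>, the map \<open>\<Sigma>\<inverse>w : \<Sigma>\<inverse>Z \<rightarrow> \<Sigma>\<inverse>\<Sigma>X \<cong> X\<close>.\<close>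

definition desuspend :: "('o, 'm, 'z) triang_cat_scheme \<Rightarrow> 'o \<Rightarrow> 'm \<Rightarrow> 'm" where
  "desuspend T X w = from_InvSig T X \<cdot> InvSigmaA T w"
  for T (structure)

text \<open>For \<open>a1 : \<Sigma>\<inverse>Z \<rightarrow> A1\<close>, the Toda bracket transported along \<open>Z \<cong> \<Sigma>\<Sigma>\<inverse>Z\<close> to a set of maps
  with domain \<open>Z\<close>.\<close>

definition toda_bracket_desuspended ::
  "('o, 'm, 'z) triang_cat_scheme \<Rightarrow> 'o \<Rightarrow> 'm \<times> 'm \<Rightarrow> 'm \<Rightarrow> 'm \<Rightarrow> 'm \<Rightarrow> 'm set" where
  "toda_bracket_desuspended T Z k a3 a2 a1 = (\<lambda>\<psi>. \<psi> \<cdot> to_SigInv T Z) ` toda_bracket T k a3 a2 a1"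
  for T (structure)

definition all_equivalent :: "bool list \<Rightarrow> bool" where
  "all_equivalent Ps \<longleftrightarrow> (\<forall>P \<in> set Ps. \<forall>Q \<in> set Ps. P \<longleftrightarrow> Q)"

end

theory Submission
  imports Defs
begin

text \<open>
  For each of the three shapes of maps, all five conditions are compared with one condition: the
  non-zero component \<open>m\<close> is \<open>\<phi>a\<close> for some \<open>\<phi>\<close> with \<open>n\<phi> = 0\<close>, where \<open>(n, a)\<close> is \<open>(u', u)\<close> for \<open>(f, 0, 0)\<close>,
  \<open>(v', v)\<close> for \<open>(0, g, 0)\<close> and \<open>(w', w)\<close> for \<open>(0, 0, h)\<close>. Comparing cones by fill-in maps shows that this is (4),
  and exactness of Hom sequences that it is (5).

  Good: an isomorphism from the mapping cone of the zero map, which is a direct sum of exact triangles,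
  to the mapping cone of the given map that is the identity on two adjacent vertices has \<open>-\<phi>\<close> as an
  off-diagonal entry; conversely, \<open>-\<phi>\<close> gives a unipotent isomorphism of that kind.

  Verdier good: for a fixed cone of \<open>gu\<close>, the third components coming from pairs of octahedra form a set
  stable under adding maps \<open>v'\<zeta>w\<close>. The octahedra given by the axiom can thus be corrected, and reading
  off \<open>\<phi>\<close> uses splittings of the cones of the zero components.

  Middling good: the splittings of the cones of the two zero components give a lift of the
  connecting map of the triangle on \<open>a\<close> to a cone of \<open>m\<close> and an extension of \<open>n\<close> to this cone, with zero
  composite. Conversely, the shape \<open>(0, 0, h)\<close> is handled
  with one octahedron and the other two shapes by rotating.
\<close>

section \<open>Additive categories\<close>

text \<open>The common condition is phrased through \<open>\<phi>\<close> rather than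
  \<open>\<theta>\<close> because it then mentions no third vertex: a change of sign of
  \<open>n\<close> or \<open>a\<close>, or an application of \<Sigma> to everything, leaves it
  unchanged. It therefore passes through rotations, and rotation invariance of Verdier goodness
  becomes a comparison of two of its instances.

  The obstacle for Verdier goodness is that the octahedral axiom returns some third component, with
  no control over which one. Once \<open>\<phi>\<close> exists, the component obtained and the
  prescribed one differ by a map \<open>v'\<zeta>w\<close>, which is exactly what can be corrected.

  Since \<Sigma> is only an equivalence, fill-in maps at the first and second vertices are built
  between suspensions and pulled back by full faithfulness. New triangles, such as direct sums, are
  recognised as exact by a comparison with a cone that a five lemma shows to be invertible.\<close>

lemma Hom_iff: "f \<in> Hom C X Y \<longleftrightarrow> f \<in> Arr C \<and> Dom C f = X \<and> Cod C f = Y"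
  by (simp add: Hom_def)

context category
begin

lemma Hom_Ob:
  assumes "f \<in> Hom C X Y"
  shows "X \<in> Ob C" and "Y \<in> Ob C"
  using assms Dom_Ob Cod_Ob by (auto simp: Hom_iff)

lemma comp_arr [simp]:
  assumes "f \<in> Arr C" "g \<in> Arr C" "Dom C g = Cod C f"
  shows "g \<cdot> f \<in> Arr C" "Dom C (g \<cdot> f) = Dom C f" "Cod C (g \<cdot> f) = Cod C g"
  using Comp_Hom[of f "Dom C f" "Cod C f" g "Cod C g"] assms by (auto simp: Hom_iff)

lemma ident_arr [simp]:
  assumes "X \<in> Ob C"
  shows "Ident C X \<in> Arr C" "Dom C (Ident C X) = X" "Cod C (Ident C X) = X"
  using Ident_Hom[OF assms] by (auto simp: Hom_iff)

lemma comp_assoc [simp]: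
  assumes "f \<in> Arr C" "g \<in> Arr C" "h \<in> Arr C" "Dom C g = Cod C f" "Dom C h = Cod C g"
  shows "(h \<cdot> g) \<cdot> f = h \<cdot> g \<cdot> f"
  using Comp_assoc[of f "Dom C f" "Cod C f" g "Cod C g" h "Cod C h"] assms by (auto simp: Hom_iff)

lemma comp_ident [simp]: "f \<in> Arr C \<Longrightarrow> Dom C f = X \<Longrightarrow> f \<cdot> Ident C X = f"
  using Comp_Ident by (auto simp: Hom_iff)

lemma ident_comp [simp]: "f \<in> Arr C \<Longrightarrow> Cod C f = X \<Longrightarrow> Ident C X \<cdot> f = f"
  using Ident_Comp by (auto simp: Hom_iff)

text \<open>Simplification associates composites to the right, which hides a commuting square
  followed by a further map. This and \<open>comp_eq\<close> carry an equation past such a map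
  \<open>x\<close>.\<close>

lemma comp_eq_comp:
  assumes "g \<cdot> f = g' \<cdot> f'"
    and "f \<in> Arr C" "g \<in> Arr C" "f' \<in> Arr C" "g' \<in> Arr C"
    and "Dom C g = Cod C f" "Dom C g' = Cod C f'"
    and "x \<in> Arr C" "Dom C f = Cod C x" "Dom C f' = Cod C x"
  shows "g \<cdot> f \<cdot> x = g' \<cdot> f' \<cdot> x"
  using assms comp_assoc by metis

lemma comp_eq:
  assumes "g \<cdot> f = k"
    and "f \<in> Arr C" "g \<in> Arr C" "Dom C g = Cod C f" "x \<in> Arr C" "Dom C f = Cod C x"
  shows "g \<cdot> f \<cdot> x = k \<cdot> x"
  using assms comp_assoc by metis

lemma is_isoI:
  assumes "f \<in> Hom C X Y" "g \<in> Hom C Y X" "g \<cdot> f = Ident C X" "f \<cdot> g = Ident C Y"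
  shows "is_iso C f"
  using assms unfolding is_iso_def by (auto simp: Hom_iff)

lemma is_iso_Ident [simp]: "X \<in> Ob C \<Longrightarrow> is_iso C (Ident C X)"
  by (rule is_isoI[where g = "Ident C X"]) (auto simp: Ident_Hom)

lemma is_isoE:
  assumes "is_iso C f" "f \<in> Hom C X Y"
  obtains g where "g \<in> Hom C Y X" "g \<cdot> f = Ident C X" "f \<cdot> g = Ident C Y"
  using assms unfolding is_iso_def by (auto simp: Hom_iff)

end

context additive_category
begin

lemma carrier_hom_group [simp]: "carrier (hom_group C X Y) = Hom C X Y"
  and mult_hom_group [simp]: "x \<otimes>\<^bsub>hom_group C X Y\<^esub> y = x \<^bold>+ y"
  and one_hom_group [simp]: "\<one>\<^bsub>hom_group C X Y\<^esub> = Zero C X Y"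
  by (simp_all add: hom_group_def)

lemma Zero_Hom: "X \<in> Ob C \<Longrightarrow> Y \<in> Ob C \<Longrightarrow> Zero C X Y \<in> Hom C X Y"
  using group.is_monoid[OF comm_group.axioms(2)[OF hom_group[of X Y]]] monoid.one_closed by fastforce

lemma Zero_arr [simp]:
  assumes "X \<in> Ob C" "Y \<in> Ob C"
  shows "Zero C X Y \<in> Arr C" "Dom C (Zero C X Y) = X" "Cod C (Zero C X Y) = Y"
  using Zero_Hom[OF assms] by (auto simp: Hom_iff)

lemma Plus_Hom: "f \<in> Hom C X Y \<Longrightarrow> g \<in> Hom C X Y \<Longrightarrow> f \<^bold>+ g \<in> Hom C X Y"
  using group.is_monoid[OF comm_group.axioms(2)[OF hom_group[of X Y]]] monoid.m_closed Hom_Ob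
  by fastforce

lemma Plus_arr [simp]:
  assumes "f \<in> Arr C" "g \<in> Arr C" "Dom C g = Dom C f" "Cod C g = Cod C f"
  shows "f \<^bold>+ g \<in> Arr C" "Dom C (f \<^bold>+ g) = Dom C f" "Cod C (f \<^bold>+ g) = Cod C f"
  using Plus_Hom[of f "Dom C f" "Cod C f" g] assms by (auto simp: Hom_iff)

lemma Plus_assoc [simp]:
  assumes "f \<in> Arr C" "g \<in> Arr C" "h \<in> Arr C" "Dom C g = Dom C f" "Cod C g = Cod C f"
    "Dom C h = Dom C f" "Cod C h = Cod C f"
  shows "(f \<^bold>+ g) \<^bold>+ h = f \<^bold>+ (g \<^bold>+ h)"
proof -
  interpret comm_group "hom_group C (Dom C f) (Cod C f)"
    using assms by (intro hom_group) (auto intro: Dom_Ob Cod_Ob)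
  show ?thesis using m_assoc[of f g h] assms by (simp add: Hom_iff)
qed

lemma Plus_commute:
  assumes "f \<in> Arr C" "g \<in> Arr C" "Dom C g = Dom C f" "Cod C g = Cod C f"
  shows "f \<^bold>+ g = g \<^bold>+ f"
proof -
  interpret comm_group "hom_group C (Dom C f) (Cod C f)"
    using assms by (intro hom_group) (auto intro: Dom_Ob Cod_Ob)
  show ?thesis using m_comm[of f g] assms by (simp add: Hom_iff)
qed

lemma Plus_Zero [simp]:
  assumes "f \<in> Arr C" "Dom C f = X" "Cod C f = Y"
  shows "f \<^bold>+ Zero C X Y = f" "Zero C X Y \<^bold>+ f = f"
proof -
  interpret comm_group "hom_group C X Y"
    using assms by (intro hom_group) (auto intro: Dom_Ob Cod_Ob)
  show "f \<^bold>+ Zero C X Y = f" "Zero C X Y \<^bold>+ f = f"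
    using r_one[of f] l_one[of f] assms by (simp_all add: Hom_iff)
qed

lemma neg_arr [simp]:
  assumes "f \<in> Arr C"
  shows "neg C f \<in> Arr C" "Dom C (neg C f) = Dom C f" "Cod C (neg C f) = Cod C f"
    and "neg C f \<^bold>+ f = Zero C (Dom C f) (Cod C f)" "f \<^bold>+ neg C f = Zero C (Dom C f) (Cod C f)"
proof -
  interpret comm_group "hom_group C (Dom C f) (Cod C f)"
    using assms by (intro hom_group) (auto intro: Dom_Ob Cod_Ob)
  show "neg C f \<in> Arr C" "Dom C (neg C f) = Dom C f" "Cod C (neg C f) = Cod C f"
    "neg C f \<^bold>+ f = Zero C (Dom C f) (Cod C f)" "f \<^bold>+ neg C f = Zero C (Dom C f) (Cod C f)"
    using inv_closed[of f] l_inv[of f] r_inv[of f] assms by (simp_all add: Hom_iff neg_def)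
qed

lemma neg_Hom: "f \<in> Hom C X Y \<Longrightarrow> neg C f \<in> Hom C X Y"
  by (simp add: Hom_iff)

lemma neg_unique:
  assumes "f \<in> Hom C X Y" "g \<in> Hom C X Y" "f \<^bold>+ g = Zero C X Y"
  shows "g = neg C f"
proof -
  interpret comm_group "hom_group C X Y"
    using assms(1) by (intro hom_group Hom_Ob)
  show ?thesis using inv_equality[of g f] Plus_commute[of f g] assms by (simp add: Hom_iff neg_def)
qed

lemma eq_if_diff_Zero:
  assumes "f \<in> Hom C X Y" "g \<in> Hom C X Y" "f \<^bold>+ neg C g = Zero C X Y"
  shows "f = g"
proof -
  have "neg C g \<^bold>+ f = Zero C X Y" using Plus_commute[of f "neg C g"] assms by (simp add: Hom_iff)
  moreover have "neg C g \<^bold>+ g = Zero C X Y" using assms by (simp add: Hom_iff)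
  ultimately show ?thesis
    using neg_unique[of "neg C g" X Y f] neg_unique[of "neg C g" X Y g] assms(1,2) neg_Hom by metis
qed

lemma Plus_neg_cancel [simp]:
  assumes "f \<in> Arr C" "g \<in> Arr C" "Dom C g = Dom C f" "Cod C g = Cod C f"
  shows "f \<^bold>+ (neg C f \<^bold>+ g) = g" "neg C f \<^bold>+ (f \<^bold>+ g) = g"
  using assms Plus_assoc[of f "neg C f" g] Plus_assoc[of "neg C f" f g] by (simp_all del: Plus_assoc)

lemma Plus_neg_cancel_right:
  assumes "f \<in> Arr C" "g \<in> Arr C" "Dom C g = Dom C f" "Cod C g = Cod C f"
  shows "g \<^bold>+ (f \<^bold>+ neg C g) = f"
  using assms Plus_commute[of f "neg C g"] by simp

lemma neg_neg [simp]: "f \<in> Arr C \<Longrightarrow> neg C (neg C f) = f"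
  using neg_unique[of "neg C f" "Dom C f" "Cod C f" f] by (simp add: Hom_iff)

lemma neg_Zero [simp]: "X \<in> Ob C \<Longrightarrow> Y \<in> Ob C \<Longrightarrow> neg C (Zero C X Y) = Zero C X Y"
  using neg_unique[of "Zero C X Y" X Y "Zero C X Y"] by (simp add: Hom_iff)

lemma neg_Plus [simp]:
  assumes "f \<in> Arr C" "g \<in> Arr C" "Dom C g = Dom C f" "Cod C g = Cod C f"
  shows "neg C (f \<^bold>+ g) = neg C f \<^bold>+ neg C g"
proof -
  have "g \<^bold>+ (neg C f \<^bold>+ neg C g) = neg C f"
    using Plus_neg_cancel_right[of "neg C f" g] assms by simp
  then have "(f \<^bold>+ g) \<^bold>+ (neg C f \<^bold>+ neg C g) = Zero C (Dom C f) (Cod C f)"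
    using assms by simp
  then show ?thesis
    using assms by (intro neg_unique[of _ "Dom C f" "Cod C f", symmetric]) (simp_all add: Hom_iff)
qed

lemma comp_Plus [simp]:
  assumes "f \<in> Arr C" "f' \<in> Arr C" "g \<in> Arr C" "Dom C f' = Dom C f" "Cod C f' = Cod C f"
    "Dom C g = Cod C f"
  shows "g \<cdot> (f \<^bold>+ f') = g \<cdot> f \<^bold>+ g \<cdot> f'"
  using Comp_Plus[of f "Dom C f" "Cod C f" f' g "Cod C g"] assms by (simp add: Hom_iff)

lemma Plus_comp [simp]:
  assumes "f \<in> Arr C" "g \<in> Arr C" "g' \<in> Arr C" "Dom C g' = Dom C g" "Cod C g' = Cod C g"
    "Dom C g = Cod C f"
  shows "(g \<^bold>+ g') \<cdot> f = g \<cdot> f \<^bold>+ g' \<cdot> f"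
  using Plus_Comp[of f "Dom C f" "Cod C f" g "Cod C g" g'] assms by (simp add: Hom_iff)

text \<open>Cancellation in the Hom group; through it additive operations, here composition and
  later \<Sigma>, are seen to preserve zero maps.\<close>

lemma Zero_if_idem:
  assumes "f \<in> Hom C X Y" "f \<^bold>+ f = f"
  shows "f = Zero C X Y"
  using assms Plus_neg_cancel(2)[of f f] by (simp add: Hom_iff)

lemma comp_Zero [simp]:
  assumes "g \<in> Arr C" "Dom C g = Y" "X \<in> Ob C"
  shows "g \<cdot> Zero C X Y = Zero C X (Cod C g)"
proof (rule Zero_if_idem)
  have Y: "Y \<in> Ob C" using assms Dom_Ob by blast
  then show "g \<cdot> Zero C X Y \<in> Hom C X (Cod C g)" using assms by (simp add: Hom_iff)
  show "g \<cdot> Zero C X Y \<^bold>+ g \<cdot> Zero C X Y = g \<cdot> Zero C X Y"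
    using comp_Plus[of "Zero C X Y" "Zero C X Y" g] assms Y by simp
qed

lemma Zero_comp [simp]:
  assumes "g \<in> Arr C" "Cod C g = Y" "Z \<in> Ob C"
  shows "Zero C Y Z \<cdot> g = Zero C (Dom C g) Z"
proof (rule Zero_if_idem)
  have Y: "Y \<in> Ob C" using assms Cod_Ob by blast
  then show "Zero C Y Z \<cdot> g \<in> Hom C (Dom C g) Z" using assms by (simp add: Hom_iff)
  show "Zero C Y Z \<cdot> g \<^bold>+ Zero C Y Z \<cdot> g = Zero C Y Z \<cdot> g"
    using Plus_comp[of g "Zero C Y Z" "Zero C Y Z"] assms Y by simp
qed

lemma comp_neg [simp]:
  assumes "f \<in> Arr C" "g \<in> Arr C" "Dom C g = Cod C f"
  shows "g \<cdot> neg C f = neg C (g \<cdot> f)"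
  using assms comp_Plus[of f "neg C f" g]
  by (intro neg_unique[of _ "Dom C f" "Cod C g"]) (simp_all add: Hom_iff Dom_Ob del: comp_Plus)

lemma neg_comp [simp]:
  assumes "f \<in> Arr C" "g \<in> Arr C" "Dom C g = Cod C f"
  shows "neg C g \<cdot> f = neg C (g \<cdot> f)"
  using assms Plus_comp[of f g "neg C g"]
  by (intro neg_unique[of _ "Dom C f" "Cod C g"]) (simp_all add: Hom_iff Cod_Ob del: Plus_comp)

lemma neg_eq_iff [simp]: "f \<in> Arr C \<Longrightarrow> g \<in> Arr C \<Longrightarrow> neg C f = neg C g \<longleftrightarrow> f = g"
  by (metis neg_neg)

lemma is_iso_neg_Ident [simp]: "X \<in> Ob C \<Longrightarrow> is_iso C (neg C (Ident C X))"
  by (rule is_isoI[where g = "neg C (Ident C X)" and X = X and Y = X]) (auto simp: Hom_iff)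

lemma zero_object_Ob: "zero_object C N \<Longrightarrow> N \<in> Ob C"
  by (simp add: zero_object_def)

lemma zero_object_unique:
  assumes "zero_object C N" "X \<in> Ob C"
  shows "f \<in> Hom C X N \<Longrightarrow> g \<in> Hom C X N \<Longrightarrow> f = g"
    and "f \<in> Hom C N X \<Longrightarrow> g \<in> Hom C N X \<Longrightarrow> f = g"
  using assms unfolding zero_object_def by blast+

end

section \<open>Exact triangles\<close>

context triangulated_category
begin

section \<open>Suspension as a fully faithful additive functor\<close>

lemma Sigma_Ob [simp]: "X \<in> Ob T \<Longrightarrow> SigmaO T X \<in> Ob T"
  using Sigma_functor by (simp add: endofunctor_def)

lemma InvSigma_Ob [simp]: "X \<in> Ob T \<Longrightarrow> InvSigmaO T X \<in> Ob T"
  using InvSigma_functor by (simp add: endofunctor_def)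

lemma Sigma_Hom: "f \<in> Hom T X Y \<Longrightarrow> SigmaA T f \<in> Hom T (SigmaO T X) (SigmaO T Y)"
  using Sigma_functor unfolding endofunctor_def by blast

lemma Sigma_arr [simp]:
  assumes "f \<in> Arr T"
  shows "SigmaA T f \<in> Arr T" "Dom T (SigmaA T f) = SigmaO T (Dom T f)"
    "Cod T (SigmaA T f) = SigmaO T (Cod T f)"
  using assms Sigma_Hom[of f "Dom T f" "Cod T f"] by (simp_all add: Hom_iff)

lemma InvSigma_Hom: "f \<in> Hom T X Y \<Longrightarrow> InvSigmaA T f \<in> Hom T (InvSigmaO T X) (InvSigmaO T Y)"
  using InvSigma_functor unfolding endofunctor_def by blast

lemma InvSigma_arr [simp]:
  assumes "f \<in> Arr T"
  shows "InvSigmaA T f \<in> Arr T" "Dom T (InvSigmaA T f) = InvSigmaO T (Dom T f)"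
    "Cod T (InvSigmaA T f) = InvSigmaO T (Cod T f)"
  using assms InvSigma_Hom[of f "Dom T f" "Cod T f"] by (simp_all add: Hom_iff)

lemma Sigma_Ident [simp]: "X \<in> Ob T \<Longrightarrow> SigmaA T (Ident T X) = Ident T (SigmaO T X)"
  using Sigma_functor by (simp add: endofunctor_def)

lemma Sigma_comp [simp]:
  assumes "f \<in> Arr T" "g \<in> Arr T" "Dom T g = Cod T f"
  shows "SigmaA T (g \<cdot> f) = SigmaA T g \<cdot> SigmaA T f"
proof -
  have "f \<in> Hom T (Dom T f) (Cod T f)" "g \<in> Hom T (Cod T f) (Cod T g)"
    using assms by (simp_all add: Hom_iff)
  then show ?thesis using Sigma_functor unfolding endofunctor_def by blast
qed

lemma InvSigma_comp [simp]:
  assumes "f \<in> Arr T" "g \<in> Arr T" "Dom T g = Cod T f"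
  shows "InvSigmaA T (g \<cdot> f) = InvSigmaA T g \<cdot> InvSigmaA T f"
proof -
  have "f \<in> Hom T (Dom T f) (Cod T f)" "g \<in> Hom T (Cod T f) (Cod T g)"
    using assms by (simp_all add: Hom_iff)
  then show ?thesis using InvSigma_functor unfolding endofunctor_def by blast
qed

lemma Sigma_Plus [simp]:
  assumes "f \<in> Arr T" "g \<in> Arr T" "Dom T g = Dom T f" "Cod T g = Cod T f"
  shows "SigmaA T (f \<^bold>+ g) = SigmaA T f \<^bold>+ SigmaA T g"
  using assms Sigma_additive by (auto simp: Hom_iff)

lemma Sigma_Zero [simp]:
  assumes "X \<in> Ob T" "Y \<in> Ob T"
  shows "SigmaA T (Zero T X Y) = Zero T (SigmaO T X) (SigmaO T Y)"
  using assms Sigma_Plus[of "Zero T X Y" "Zero T X Y"] by - (rule Zero_if_idem, simp_all add: Hom_iff)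

lemma Sigma_neg [simp]:
  assumes "f \<in> Arr T"
  shows "SigmaA T (neg T f) = neg T (SigmaA T f)"
  using assms Sigma_Plus[of f "neg T f"]
  by - (rule neg_unique[of _ "SigmaO T (Dom T f)" "SigmaO T (Cod T f)"],
    simp_all add: Hom_iff Dom_Ob Cod_Ob del: Sigma_Plus)

lemma to_SigInv_arr [simp]:
  assumes "X \<in> Ob T"
  shows "to_SigInv T X \<in> Arr T" "Dom T (to_SigInv T X) = X"
    "Cod T (to_SigInv T X) = SigmaO T (InvSigmaO T X)" "is_iso T (to_SigInv T X)"
  using assms to_SigInv_iso by (auto simp: natural_iso_def Hom_iff)

lemma from_InvSig_arr [simp]:
  assumes "X \<in> Ob T"
  shows "from_InvSig T X \<in> Arr T" "Dom T (from_InvSig T X) = InvSigmaO T (SigmaO T X)"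
    "Cod T (from_InvSig T X) = X" "is_iso T (from_InvSig T X)"
  using assms from_InvSig_iso by (auto simp: natural_iso_def Hom_iff)

lemma to_SigInv_natural:
  assumes "f \<in> Hom T X Y"
  shows "to_SigInv T Y \<cdot> f = SigmaA T (InvSigmaA T f) \<cdot> to_SigInv T X"
  using assms to_SigInv_iso by (auto simp: natural_iso_def)

lemma from_InvSig_natural:
  assumes "f \<in> Hom T X Y"
  shows "from_InvSig T Y \<cdot> InvSigmaA T (SigmaA T f) = f \<cdot> from_InvSig T X"
  using assms from_InvSig_iso by (auto simp: natural_iso_def)

lemma comp_iso_cancel_right:
  assumes "is_iso T i" "f \<in> Hom T Y Z" "g \<in> Hom T Y Z" "i \<in> Hom T X Y" "f \<cdot> i = g \<cdot> i"
  shows "f = g"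
proof -
  obtain j where j: "j \<in> Hom T Y X" "i \<cdot> j = Ident T Y"
    using is_isoE[OF assms(1,4)] by metis
  have "f \<cdot> i \<cdot> j = f" "g \<cdot> i \<cdot> j = g" using assms(2-4) j by (simp_all add: Hom_iff)
  moreover have "(f \<cdot> i) \<cdot> j = f \<cdot> i \<cdot> j" "(g \<cdot> i) \<cdot> j = g \<cdot> i \<cdot> j"
    using assms(2-4) j(1) by (simp_all add: Hom_iff)
  ultimately show ?thesis using assms(5) by metis
qed

lemma comp_iso_cancel_left:
  assumes "is_iso T i" "f \<in> Hom T X Y" "g \<in> Hom T X Y" "i \<in> Hom T Y Z" "i \<cdot> f = i \<cdot> g"
  shows "f = g"
proof -
  obtain j where j: "j \<in> Hom T Z Y" "j \<cdot> i = Ident T Y"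
    using is_isoE[OF assms(1,4)] by metis
  have "(j \<cdot> i) \<cdot> f = f" "(j \<cdot> i) \<cdot> g = g" using assms(2-4) j(2) by (simp_all add: Hom_iff)
  moreover have "(j \<cdot> i) \<cdot> f = j \<cdot> i \<cdot> f" "(j \<cdot> i) \<cdot> g = j \<cdot> i \<cdot> g"
    using assms j(1) by (simp_all add: Hom_iff)
  ultimately show ?thesis using assms(5) by metis
qed

text \<open>Naturality of \<open>from_InvSig\<close> recovers \<open>f\<close> from
  \<open>SigmaA T f\<close> up to composition with isomorphisms.\<close>

lemma Sigma_faithful:
  assumes "f \<in> Hom T X Y" "g \<in> Hom T X Y" "SigmaA T f = SigmaA T g"
  shows "f = g"
proof (rule comp_iso_cancel_right[of "from_InvSig T X"])
  show "f \<cdot> from_InvSig T X = g \<cdot> from_InvSig T X"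
    using assms from_InvSig_natural[of f X Y] from_InvSig_natural[of g X Y] by simp
qed (use assms Hom_Ob[OF assms(1)] in \<open>simp_all add: Hom_iff\<close>)

lemma InvSigma_faithful:
  assumes "f \<in> Hom T X Y" "g \<in> Hom T X Y" "InvSigmaA T f = InvSigmaA T g"
  shows "f = g"
proof (rule comp_iso_cancel_left[of "to_SigInv T Y"])
  show "to_SigInv T Y \<cdot> f = to_SigInv T Y \<cdot> g"
    using assms to_SigInv_natural[of f X Y] to_SigInv_natural[of g X Y] by simp
qed (use assms Hom_Ob[OF assms(1)] in \<open>simp_all add: Hom_iff\<close>)

text \<open>The preimage is \<open>InvSigmaA T F\<close> conjugated by the counit
  \<open>from_InvSig\<close>. By naturality \<open>SigmaA T f\<close> and \<open>F\<close> agree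
  after applying \<open>InvSigmaA T\<close>, which is faithful.\<close>

lemma Sigma_full:
  assumes "F \<in> Hom T (SigmaO T X) (SigmaO T Y)" "X \<in> Ob T" "Y \<in> Ob T"
  obtains f where "f \<in> Hom T X Y" "SigmaA T f = F"
proof -
  obtain j where j: "j \<in> Hom T X (InvSigmaO T (SigmaO T X))"
    "from_InvSig T X \<cdot> j = Ident T X" "j \<cdot> from_InvSig T X = Ident T (InvSigmaO T (SigmaO T X))"
    using is_isoE[of "from_InvSig T X" "InvSigmaO T (SigmaO T X)" X] assms by (auto simp: Hom_iff)
  define f where "f = from_InvSig T Y \<cdot> InvSigmaA T F \<cdot> j"
  have f: "f \<in> Hom T X Y" using assms j(1) by (simp add: f_def Hom_iff)
  have "InvSigmaA T (SigmaA T f) = InvSigmaA T F"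
  proof (rule comp_iso_cancel_left[of "from_InvSig T Y"])
    show "from_InvSig T Y \<cdot> InvSigmaA T (SigmaA T f) = from_InvSig T Y \<cdot> InvSigmaA T F"
      using f j assms from_InvSig_natural[OF f] by (simp add: f_def Hom_iff)
  qed (use f assms in \<open>simp_all add: Hom_iff\<close>)
  then have "SigmaA T f = F"
    using InvSigma_faithful[of "SigmaA T f" "SigmaO T X" "SigmaO T Y" F] f assms Sigma_Hom by blast
  with f that show ?thesis by blast
qed

section \<open>Exact triangles: rotation, isomorphisms and fill-in maps\<close>

lemma exact_triangle_iff:
  "exact_triangle T X Y Z (u, v, w) \<longleftrightarrow>
     u \<in> Hom T X Y \<and> v \<in> Hom T Y Z \<and> w \<in> Hom T Z (SigmaO T X) \<and> (u, v, w) \<in> Exact T"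
  by (simp add: exact_triangle_def candidate_triangle_def)

lemma exact_Hom:
  assumes "exact_triangle T X Y Z (u, v, w)"
  shows "u \<in> Hom T X Y" "v \<in> Hom T Y Z" "w \<in> Hom T Z (SigmaO T X)"
  using assms by (simp_all add: exact_triangle_iff)

lemma exact_arr:
  assumes "exact_triangle T X Y Z (u, v, w)"
  shows "u \<in> Arr T" "Dom T u = X" "Cod T u = Y" "v \<in> Arr T" "Dom T v = Y" "Cod T v = Z"
    "w \<in> Arr T" "Dom T w = Z" "Cod T w = SigmaO T X"
  using exact_Hom[OF assms] by (simp_all add: Hom_iff)

lemma exact_Ob:
  assumes "exact_triangle T X Y Z (u, v, w)"
  shows "X \<in> Ob T" "Y \<in> Ob T" "Z \<in> Ob T"
  using exact_Hom[OF assms] Hom_Ob by blast+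

lemma cones_iff: "a \<in> Hom T X Y \<Longrightarrow> (p, q) \<in> cones T a \<longleftrightarrow> exact_triangle T X Y (Cod T p) (a, p, q)"
  by (simp add: cones_def Hom_iff)

lemma conesI: "exact_triangle T X Y Z (a, p, q) \<Longrightarrow> (p, q) \<in> cones T a"
  by (simp add: cones_def exact_arr)

lemma exact_exists:
  assumes "u \<in> Hom T X Y"
  obtains Z v w where "exact_triangle T X Y Z (u, v, w)"
proof -
  obtain v w where "(u, v, w) \<in> Exact T" using assms Exact_exists unfolding Hom_iff by blast
  moreover from Exact_candidate[OF this] assms have "\<exists>Z. exact_triangle T X Y Z (u, v, w)"
    using calculation by (auto simp: exact_triangle_iff candidate_triangle_def Hom_iff)
  ultimately show ?thesis using that by blast
qed

lemma exact_rotate_iff: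
  assumes "u \<in> Hom T X Y" "v \<in> Hom T Y Z" "w \<in> Hom T Z (SigmaO T X)"
  shows "exact_triangle T X Y Z (u, v, w) \<longleftrightarrow>
    exact_triangle T Y Z (SigmaO T X) (v, w, neg T (SigmaA T u))"
  using Exact_rotate[of X Y Z "(u, v, w)"] assms
  by (simp add: exact_triangle_iff rotate_triangle_def candidate_triangle_def Hom_iff)

lemma exact_rotate:
  assumes "exact_triangle T X Y Z (u, v, w)"
  shows "exact_triangle T Y Z (SigmaO T X) (v, w, neg T (SigmaA T u))"
  using exact_rotate_iff[OF exact_Hom[OF assms]] assms by blast

lemma exact_iso:
  assumes "exact_triangle T X Y Z (u, v, w)"
    and "u' \<in> Hom T X' Y'" "v' \<in> Hom T Y' Z'" "w' \<in> Hom T Z' (SigmaO T X')"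
    and "f \<in> Hom T X X'" "g \<in> Hom T Y Y'" "h \<in> Hom T Z Z'"
    and "g \<cdot> u = u' \<cdot> f" "h \<cdot> v = v' \<cdot> g" "SigmaA T f \<cdot> w = w' \<cdot> h"
    and "is_iso T f" "is_iso T g" "is_iso T h"
  shows "exact_triangle T X' Y' Z' (u', v', w')"
  using Exact_iso[of "(u, v, w)" X' Y' Z' "(u', v', w')" f g h] assms
  by (simp add: exact_triangle_iff candidate_triangle_def triangle_map_def Hom_iff)

text \<open>The isomorphism is the identity on the outer vertices and minus the identity on the
  middle one, so two signs change together.\<close>

lemma exact_neg12:
  assumes "exact_triangle T X Y Z (u, v, w)"
  shows "exact_triangle T X Y Z (neg T u, neg T v, w)"
  using exact_Ob[OF assms] exact_arr[OF assms]
  by (intro exact_iso[OF assms, where f = "Ident T X" and g = "neg T (Ident T Y)" and h = "Ident T Z"])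
    (simp_all add: Hom_iff)

text \<open>Three rotations suspend the triangle and put a sign on all three maps;
  \<open>exact_neg12\<close> removes two of them.\<close>

lemma exact_Sigma:
  assumes "exact_triangle T X Y Z (u, v, w)"
  shows "exact_triangle T (SigmaO T X) (SigmaO T Y) (SigmaO T Z)
    (SigmaA T u, SigmaA T v, neg T (SigmaA T w))"
  using exact_neg12[OF exact_rotate[OF exact_rotate[OF exact_rotate[OF assms]]]] exact_arr[OF assms]
  by simp

lemma exact_fill3:
  assumes "exact_triangle T X Y Z (u, v, w)" "exact_triangle T X' Y' Z' (u', v', w')"
    and "f \<in> Hom T X X'" "g \<in> Hom T Y Y'" "g \<cdot> u = u' \<cdot> f"
  obtains h where "h \<in> Hom T Z Z'" "h \<cdot> v = v' \<cdot> g" "SigmaA T f \<cdot> w = w' \<cdot> h"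
proof -
  have "\<exists>h. triangle_map T (u, v, w) (u', v', w') (f, g, h)"
    using assms by (intro Exact_fill_in) (simp_all add: exact_triangle_iff Hom_iff)
  then show ?thesis
    using that exact_arr[OF assms(1)] exact_arr[OF assms(2)] by (auto simp: triangle_map_def)
qed

text \<open>The axiom fills in the third vertex only. One rotation makes the missing map a third one
  between suspensions; fullness of \<Sigma> desuspends it and faithfulness desuspends the
  square.\<close>

lemma exact_fill1:
  assumes E: "exact_triangle T X Y Z (u, v, w)" and E': "exact_triangle T X' Y' Z' (u', v', w')"
    and gh: "g \<in> Hom T Y Y'" "h \<in> Hom T Z Z'" "h \<cdot> v = v' \<cdot> g"
  obtains f where "f \<in> Hom T X X'" "g \<cdot> u = u' \<cdot> f" "SigmaA T f \<cdot> w = w' \<cdot> h"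
proof -
  obtain F where F: "F \<in> Hom T (SigmaO T X) (SigmaO T X')" "F \<cdot> w = w' \<cdot> h"
    "SigmaA T g \<cdot> neg T (SigmaA T u) = neg T (SigmaA T u') \<cdot> F"
    using exact_fill3[OF exact_rotate[OF E] exact_rotate[OF E'] gh] by blast
  obtain f where f: "f \<in> Hom T X X'" "SigmaA T f = F"
    using Sigma_full[OF F(1)] exact_Ob[OF E] exact_Ob[OF E'] by blast
  have "SigmaA T (g \<cdot> u) = SigmaA T (u' \<cdot> f)"
    using F(3) f(1) gh(1) exact_arr[OF E] exact_arr[OF E'] unfolding f(2)[symmetric]
    by (simp add: Hom_iff)
  then have "g \<cdot> u = u' \<cdot> f"
    using f(1) gh(1) exact_arr[OF E] exact_arr[OF E']
    by - (rule Sigma_faithful[of _ X Y'], simp_all add: Hom_iff)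
  then show ?thesis using that f F(2) by blast
qed

text \<open>After one rotation the missing middle map sits at the first vertex, so
  \<open>exact_fill1\<close> applies.\<close>

lemma exact_fill2:
  assumes E: "exact_triangle T X Y Z (u, v, w)" and E': "exact_triangle T X' Y' Z' (u', v', w')"
    and fh: "f \<in> Hom T X X'" "h \<in> Hom T Z Z'" "SigmaA T f \<cdot> w = w' \<cdot> h"
  obtains g where "g \<in> Hom T Y Y'" "g \<cdot> u = u' \<cdot> f" "h \<cdot> v = v' \<cdot> g"
proof -
  obtain g where g: "g \<in> Hom T Y Y'" "h \<cdot> v = v' \<cdot> g"
    "SigmaA T g \<cdot> neg T (SigmaA T u) = neg T (SigmaA T u') \<cdot> SigmaA T f"
    using exact_fill1[OF exact_rotate[OF E] exact_rotate[OF E'] fh(2) Sigma_Hom[OF fh(1)] fh(3)]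
    by blast
  have "SigmaA T (g \<cdot> u) = SigmaA T (u' \<cdot> f)"
    using g(1,3) fh(1) exact_arr[OF E] exact_arr[OF E'] by (simp add: Hom_iff)
  then have "g \<cdot> u = u' \<cdot> f"
    using g(1) fh(1) exact_arr[OF E] exact_arr[OF E']
    by - (rule Sigma_faithful[of _ X Y'], simp_all add: Hom_iff)
  then show ?thesis using that g by blast
qed

lemma exact_Ident:
  assumes "X \<in> Ob T" "zero_object T N"
  shows "exact_triangle T X X N (Ident T X, Zero T X N, Zero T N (SigmaO T X))"
  using assms Exact_Ident zero_object_Ob by (simp add: exact_triangle_iff Hom_iff)

text \<open>An object whose identity is zero is a zero object, and \<Sigma> preserves identities and
  zero maps.\<close>

lemma zero_object_Sigma:
  assumes "zero_object T N"
  shows "zero_object T (SigmaO T N)"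
proof -
  note N = zero_object_Ob[OF assms]
  have id: "Ident T (SigmaO T N) = Zero T (SigmaO T N) (SigmaO T N)"
    using zero_object_unique(1)[OF assms N, of "Ident T N" "Zero T N N"] N
    by (simp add: Hom_iff flip: Sigma_Ident Sigma_Zero)
  have "f = Zero T X (SigmaO T N)" if "f \<in> Hom T X (SigmaO T N)" for f X
    using Ident_Comp[OF that] that N Hom_Ob[OF that] unfolding id by (simp add: Hom_iff)
  moreover have "f = Zero T (SigmaO T N) X" if "f \<in> Hom T (SigmaO T N) X" for f X
    using Comp_Ident[OF that] that N Hom_Ob[OF that] unfolding id by (simp add: Hom_iff)
  ultimately show ?thesis
    unfolding zero_object_def using N Zero_Hom Sigma_Ob by metis
qed

text \<open>Its rotation is the trivial triangle on \<open>X\<close> with zero object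
  \<open>SigmaO T N\<close>.\<close>

lemma exact_Zero_Ident:
  assumes "X \<in> Ob T" "zero_object T N"
  shows "exact_triangle T N X X (Zero T N X, Ident T X, Zero T X (SigmaO T N))"
  using assms exact_Ident[OF assms(1) zero_object_Sigma[OF assms(2)]] zero_object_Ob[OF assms(2)]
  by (subst exact_rotate_iff) (simp_all add: Hom_iff)

section \<open>Exact Hom sequences and the five lemma\<close>

lemma exact_comp_Zero:
  assumes "exact_triangle T X Y Z (u, v, w)"
  shows "v \<cdot> u = Zero T X Z" "w \<cdot> v = Zero T Y (SigmaO T X)"
    "SigmaA T u \<cdot> w = Zero T Z (SigmaO T Y)"
proof -
  \<comment> \<open>The trivial triangle on \<open>X\<close> maps to the given one by
    \<open>(1, u)\<close>, so \<open>v \<cdot> u\<close> factors through a zero object. It is shown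
    for all triangles so that rotations give the other two composites.\<close>
  have *: "v \<cdot> u = Zero T X Z" if E: "exact_triangle T X Y Z (u, v, w)" for X Y Z u v w
  proof -
    obtain N where N: "zero_object T N" using ex_zero_object by blast
    have "u \<in> Hom T X Y" "u \<cdot> Ident T X = u \<cdot> Ident T X" using exact_Hom[OF E] by simp_all
    then obtain h where "h \<in> Hom T N Z" "h \<cdot> Zero T X N = v \<cdot> u"
      using exact_fill3[OF exact_Ident[OF exact_Ob(1)[OF E] N] E Ident_Hom[OF exact_Ob(1)[OF E]]]
      by metis
    then show ?thesis using exact_Ob[OF E] by (simp add: Hom_iff)
  qed
  show "v \<cdot> u = Zero T X Z" "w \<cdot> v = Zero T Y (SigmaO T X)"
    using *[OF assms] *[OF exact_rotate[OF assms]] .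
  have "neg T (neg T (SigmaA T u \<cdot> w)) = neg T (Zero T Z (SigmaO T Y))"
    using *[OF exact_rotate[OF exact_rotate[OF assms]]] exact_arr[OF assms] by simp
  then show "SigmaA T u \<cdot> w = Zero T Z (SigmaO T Y)"
    using exact_arr[OF assms] exact_Ob[OF assms] by simp
qed

text \<open>The lift is a fill-in at the first vertex of a map from the trivial triangle on
  \<open>W\<close>, with \<open>x\<close> in the middle and zero at the third vertex.\<close>

lemma exact_lift:
  assumes E: "exact_triangle T X Y Z (u, v, w)" and x: "x \<in> Hom T W Y" "v \<cdot> x = Zero T W Z"
  obtains z where "z \<in> Hom T W X" "x = u \<cdot> z"
proof -
  obtain N where N: "zero_object T N" using ex_zero_object by blast
  note W = Hom_Ob(1)[OF x(1)]
  have "Zero T N Z \<cdot> Zero T W N = v \<cdot> x"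
    using x W zero_object_Ob[OF N] exact_Ob[OF E] by (simp add: Hom_iff)
  then obtain z where "z \<in> Hom T W X" "x \<cdot> Ident T W = u \<cdot> z"
    using exact_fill1[OF exact_Ident[OF W N] E x(1)] Zero_Hom[OF zero_object_Ob[OF N]] exact_Ob[OF E]
    by metis
  then show ?thesis using that x by (simp add: Hom_iff)
qed

text \<open>Dually, the extension is a fill-in at the third vertex of a map to the triangle of
  \<open>exact_Zero_Ident\<close>, with \<open>x\<close> in the middle.\<close>

lemma exact_extend:
  assumes E: "exact_triangle T X Y Z (u, v, w)" and x: "x \<in> Hom T Y W" "x \<cdot> u = Zero T X W"
  obtains z where "z \<in> Hom T Z W" "x = z \<cdot> v"
proof -
  obtain N where N: "zero_object T N" using ex_zero_object by blast
  note W = Hom_Ob(2)[OF x(1)]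
  have "x \<cdot> u = Zero T N W \<cdot> Zero T X N"
    using x W zero_object_Ob[OF N] exact_Ob[OF E] by (simp add: Hom_iff)
  then obtain z where "z \<in> Hom T Z W" "z \<cdot> v = Ident T W \<cdot> x"
    using exact_fill3[OF E exact_Zero_Ident[OF W N] _ x(1)]
      Zero_Hom[OF _ zero_object_Ob[OF N]] exact_Ob[OF E] by metis
  then show ?thesis using that x by (simp add: Hom_iff)
qed

lemma exact_lift2:
  assumes "exact_triangle T X Y Z (u, v, w)" "x \<in> Hom T W Z" "w \<cdot> x = Zero T W (SigmaO T X)"
  obtains z where "z \<in> Hom T W Y" "x = v \<cdot> z"
  using exact_lift[OF exact_rotate[OF assms(1)] assms(2,3)] that by blast

lemma exact_lift3:
  assumes "exact_triangle T X Y Z (u, v, w)" "x \<in> Hom T W (SigmaO T X)"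
    "SigmaA T u \<cdot> x = Zero T W (SigmaO T Y)"
  obtains z where "z \<in> Hom T W Z" "x = w \<cdot> z"
proof -
  have "neg T (SigmaA T u) \<cdot> x = Zero T W (SigmaO T Y)"
    using assms exact_arr[OF assms(1)] exact_Ob[OF assms(1)] Hom_Ob[OF assms(2)]
    by (simp add: Hom_iff)
  then show ?thesis
    using exact_lift[OF exact_rotate[OF exact_rotate[OF assms(1)]] assms(2)] that by blast
qed

lemma exact_extend2:
  assumes "exact_triangle T X Y Z (u, v, w)" "x \<in> Hom T Z W" "x \<cdot> v = Zero T Y W"
  obtains z where "z \<in> Hom T (SigmaO T X) W" "x = z \<cdot> w"
  using exact_extend[OF exact_rotate[OF assms(1)] assms(2,3)] that by blast

text \<open>The sign that rotation puts on \<open>SigmaA T u\<close> is moved into the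
  extension.\<close>

lemma exact_extend3:
  assumes "exact_triangle T X Y Z (u, v, w)" "x \<in> Hom T (SigmaO T X) W" "x \<cdot> w = Zero T Z W"
  obtains z where "z \<in> Hom T (SigmaO T Y) W" "x = z \<cdot> SigmaA T u"
proof -
  obtain z where "z \<in> Hom T (SigmaO T Y) W" "x = z \<cdot> neg T (SigmaA T u)"
    using exact_extend[OF exact_rotate[OF exact_rotate[OF assms(1)]] assms(2,3)] .
  then show ?thesis
    using that[of "neg T z"] exact_arr[OF assms(1)] by (simp add: Hom_iff)
qed

lemma diff_eqI:
  assumes "x \<in> Hom T X Y" "y \<in> Hom T X Y" "x \<^bold>+ neg T y = d"
  shows "x = y \<^bold>+ d"
  using assms Plus_neg_cancel_right[of x y] by (auto simp: Hom_iff)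

text \<open>The five lemma for the covariant Hom sequences.\<close>

lemma exact_if_hom_exact:
  assumes E: "exact_triangle T X Y Z' (u, v', w')"
    and vw: "v \<in> Hom T Y Z" "w \<in> Hom T Z (SigmaO T X)"
    and h: "h \<in> Hom T Z Z'" "h \<cdot> v = v'" "w' \<cdot> h = w"
    and vu: "v \<cdot> u = Zero T X Z"
    and ker_w: "\<And>W x. x \<in> Hom T W Z \<Longrightarrow> w \<cdot> x = Zero T W (SigmaO T X) \<Longrightarrow> \<exists>y \<in> Hom T W Y. x = v \<cdot> y"
    and ker_u: "\<And>W x. x \<in> Hom T W (SigmaO T X) \<Longrightarrow> SigmaA T u \<cdot> x = Zero T W (SigmaO T Y) \<Longrightarrow>
      \<exists>z \<in> Hom T W Z. x = w \<cdot> z"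
  shows "is_iso T h" and "exact_triangle T X Y Z (u, v, w)"
proof -
  note [simp] = exact_arr[OF E] exact_Ob[OF E] Hom_Ob(1)[OF vw(2)]
  note Hom = exact_Hom[OF E]
  \<comment> \<open>Injectivity half of the five lemma: a map killed by \<open>h\<close> is lifted
    first through \<open>v\<close>, then through \<open>u\<close>.\<close>
  have inj: "x = Zero T W Z" if x: "x \<in> Hom T W Z" "h \<cdot> x = Zero T W Z'" for W x
  proof -
    note [simp] = Hom_Ob(1)[OF x(1)]
    have "w \<cdot> x = w' \<cdot> h \<cdot> x" using x(1) h(1) by (simp add: Hom_iff flip: h(3))
    then have "w \<cdot> x = Zero T W (SigmaO T X)" using x by simp
    then obtain y where y: "y \<in> Hom T W Y" "x = v \<cdot> y" using ker_w x(1) by blast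
    have "v' \<cdot> y = h \<cdot> v \<cdot> y" using y(1) vw(1) h(1) by (simp add: Hom_iff flip: h(2))
    then have "v' \<cdot> y = Zero T W Z'" using x(2) y(2) by simp
    then obtain z where z: "z \<in> Hom T W X" "y = u \<cdot> z" using exact_lift[OF E y(1)] by blast
    then have "x = (v \<cdot> u) \<cdot> z" using y(2) vw(1) by (simp add: Hom_iff)
    then show ?thesis using vu z(1) by (simp add: Hom_iff)
  qed
  have "SigmaA T u \<cdot> w' = Zero T Z' (SigmaO T Y)" using exact_comp_Zero[OF E] by blast
  then obtain x where x: "x \<in> Hom T Z' Z" "w' = w \<cdot> x" using ker_u[of w' Z'] Hom(3) by blast
  \<comment> \<open>\<open>h \<cdot> x\<close> is the identity only after composing with
    \<open>w'\<close>. The defect is killed by \<open>w'\<close>, hence comes from \<open>Y\<close>,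
    and adding \<open>v \<cdot> q\<close> to \<open>x\<close> corrects it.\<close>
  let ?d = "Ident T Z' \<^bold>+ neg T (h \<cdot> x)"
  have "w' \<cdot> h \<cdot> x = (w' \<cdot> h) \<cdot> x" using x(1) h(1) by (simp add: Hom_iff)
  then have "w' \<cdot> h \<cdot> x = w'" using x(2) h(3) by simp
  then have "w' \<cdot> ?d = Zero T Z' (SigmaO T X)"
    using x(1) h(1) by (simp add: Hom_iff)
  then obtain q where q: "q \<in> Hom T Z' Y" "?d = v' \<cdot> q"
    using exact_lift2[OF E, of ?d Z'] x(1) h(1) by (auto simp: Hom_iff)
  have "v' \<cdot> q = h \<cdot> v \<cdot> q" using q(1) vw(1) h(1) by (simp add: Hom_iff flip: h(2))
  then have "Ident T Z' = h \<cdot> x \<^bold>+ h \<cdot> v \<cdot> q"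
    using q(2) h(1) x(1) by - (rule diff_eqI[of _ Z' Z'], simp_all add: Hom_iff)
  define k where "k = x \<^bold>+ v \<cdot> q"
  have k: "k \<in> Hom T Z' Z" "h \<cdot> k = Ident T Z'"
    using \<open>Ident T Z' = _\<close> x(1) q(1) vw h(1) by (simp_all add: k_def Hom_iff)
  \<comment> \<open>A right inverse of a map with trivial kernel is also a left inverse.\<close>
  have "h \<cdot> (k \<cdot> h \<^bold>+ neg T (Ident T Z)) = Zero T Z Z'"
    using k h(1) comp_eq[OF k(2), of h] by (simp add: Hom_iff)
  then have "k \<cdot> h \<^bold>+ neg T (Ident T Z) = Zero T Z Z"
    using k(1) h(1) by - (rule inj, simp_all add: Hom_iff)
  then have kh: "k \<cdot> h = Ident T Z"
    using k(1) h(1) by - (rule eq_if_diff_Zero[of _ Z Z], simp_all add: Hom_iff)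
  show "is_iso T h" using is_isoI[OF h(1) k(1) kh k(2)] .
  \<comment> \<open>The primed triangle is the one known to be exact, so it is transported along the
    inverse of \<open>h\<close>.\<close>
  have "is_iso T k" using is_isoI[OF k(1) h(1) k(2) kh] .
  moreover have "k \<cdot> v' = v"
    using comp_eq[OF kh, of v] k(1) h(1) vw(1) by (simp add: Hom_iff flip: h(2))
  moreover have "w \<cdot> k = w'"
    using comp_assoc[of k h w'] k h(1,3) by (simp add: Hom_iff)
  ultimately show "exact_triangle T X Y Z (u, v, w)"
    using vw k(1) by (intro exact_iso[OF E, where f = "Ident T X" and g = "Ident T Y" and h = k])
      (simp_all add: Hom_iff)
qed

text \<open>A fill-in over identities is invertible by the five lemma; different choices of a cone
  are compared in this way later.\<close>

lemma exact_unique: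
  assumes E: "exact_triangle T X Y Z (u, v, w)" and E': "exact_triangle T X Y Z' (u, v', w')"
  obtains i where "i \<in> Hom T Z Z'" "is_iso T i" "i \<cdot> v = v'" "w' \<cdot> i = w"
proof -
  note [simp] = exact_arr[OF E] exact_Ob[OF E] exact_arr[OF E'] exact_Ob[OF E']
  obtain i where i: "i \<in> Hom T Z Z'" "i \<cdot> v = v' \<cdot> Ident T Y" "SigmaA T (Ident T X) \<cdot> w = w' \<cdot> i"
    using exact_fill3[OF E E', of "Ident T X" "Ident T Y"] by (auto simp: Hom_iff)
  then have "i \<cdot> v = v'" "w' \<cdot> i = w" by (simp_all add: Hom_iff)
  moreover have "is_iso T i"
    by (rule exact_if_hom_exact(1)[OF E' exact_Hom(2,3)[OF E] i(1) calculation exact_comp_Zero(1)[OF E]])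
      (meson exact_lift2[OF E] exact_lift3[OF E])+
  ultimately show ?thesis using that i(1) by blast
qed

end

section \<open>Lightning flashes, Toda brackets and Verdier goodness\<close>

context triangulated_category
begin

text \<open>The condition that the membership of zero in a Toda bracket and the lightning flash
  factorisation both unfold to: \<open>m\<close> factors through \<open>a\<close> by a map that \<open>n\<close> annihilates.\<close>

definition flash :: "'m \<Rightarrow> 'm \<Rightarrow> 'm \<Rightarrow> bool" where
  "flash n a m \<longleftrightarrow>
     (\<exists>\<phi> \<in> Hom T (Cod T a) (Dom T n). n \<cdot> \<phi> = Zero T (Cod T a) (Cod T n) \<and> m = \<phi> \<cdot> a)"

lemma flash_neg_left:
  assumes "n \<in> Arr T" "a \<in> Arr T"
  shows "flash (neg T n) a m \<longleftrightarrow> flash n a m"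
proof -
  have "neg T n \<cdot> \<phi> = Zero T (Cod T a) (Cod T n) \<longleftrightarrow> n \<cdot> \<phi> = Zero T (Cod T a) (Cod T n)"
    if "\<phi> \<in> Hom T (Cod T a) (Dom T n)" for \<phi>
    using that assms neg_eq_iff[of "n \<cdot> \<phi>" "Zero T (Cod T a) (Cod T n)"]
    by (simp add: Hom_iff Cod_Ob del: neg_eq_iff)
  then show ?thesis using assms unfolding flash_def by auto
qed

text \<open>The sign moves from \<open>a\<close> to the factor \<open>\<phi>\<close>, and
  \<open>n\<close> still annihilates that factor.\<close>

lemma flash_neg_right_imp:
  assumes "n \<in> Arr T" "a \<in> Arr T" "flash n (neg T a) m"
  shows "flash n a m"
proof -
  obtain \<phi> where \<phi>: "\<phi> \<in> Hom T (Cod T a) (Dom T n)" "n \<cdot> \<phi> = Zero T (Cod T a) (Cod T n)"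
    "m = \<phi> \<cdot> neg T a"
    using assms by (auto simp: flash_def)
  then show ?thesis
    unfolding flash_def using assms by (intro bexI[of _ "neg T \<phi>"]) (simp_all add: Hom_iff Cod_Ob)
qed

lemma flash_neg_right:
  assumes "n \<in> Arr T" "a \<in> Arr T"
  shows "flash n (neg T a) m \<longleftrightarrow> flash n a m"
  using flash_neg_right_imp[OF assms] flash_neg_right_imp[of n "neg T a" m] assms by auto

text \<open>One direction suspends the factor; for the other, fullness desuspends it and
  faithfulness desuspends its two equations.\<close>

lemma flash_Sigma:
  assumes n: "n \<in> Hom T Q R" and a: "a \<in> Hom T A B" and m: "m \<in> Hom T A Q"
  shows "flash (SigmaA T n) (SigmaA T a) (SigmaA T m) \<longleftrightarrow> flash n a m"
proof
  note [simp] = Hom_Ob[OF n] Hom_Ob[OF a]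
  show "flash (SigmaA T n) (SigmaA T a) (SigmaA T m)" if fl: "flash n a m"
  proof -
    obtain \<phi> where \<phi>: "\<phi> \<in> Hom T B Q" "n \<cdot> \<phi> = Zero T B R" "m = \<phi> \<cdot> a"
      using fl n a by (auto simp: flash_def Hom_iff)
    have "SigmaA T n \<cdot> SigmaA T \<phi> = SigmaA T (n \<cdot> \<phi>)" using \<phi>(1) n by (simp add: Hom_iff)
    then show ?thesis
      unfolding flash_def using \<phi> n a by (intro bexI[of _ "SigmaA T \<phi>"]) (simp_all add: Hom_iff)
  qed
  assume "flash (SigmaA T n) (SigmaA T a) (SigmaA T m)"
  then obtain \<Phi> where \<Phi>: "\<Phi> \<in> Hom T (SigmaO T B) (SigmaO T Q)"
    "SigmaA T n \<cdot> \<Phi> = Zero T (SigmaO T B) (SigmaO T R)" "SigmaA T m = \<Phi> \<cdot> SigmaA T a"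
    using n a by (auto simp: flash_def Hom_iff)
  obtain \<phi> where \<phi>: "\<phi> \<in> Hom T B Q" "SigmaA T \<phi> = \<Phi>" using Sigma_full[OF \<Phi>(1)] by auto
  have "n \<cdot> \<phi> = Zero T B R"
    using \<phi> \<Phi>(2) n by - (rule Sigma_faithful[of _ B R], simp_all add: Hom_iff)
  moreover have "m = \<phi> \<cdot> a"
    using \<phi> \<Phi>(3) m a by - (rule Sigma_faithful[of _ A Q], simp_all add: Hom_iff)
  ultimately show "flash n a m"
    unfolding flash_def using n a \<phi>(1) by (auto simp: Hom_iff)
qed

text \<open>By exactness, the maps killed by \<open>n\<close> are those of the form
  \<open>s \<cdot> \<theta>\<close>.\<close>

lemma lightning_iff_flash:
  assumes E: "exact_triangle T P Q R (s, n, t)" and a: "a \<in> Hom T A B"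
  shows "(\<exists>\<theta> \<in> Hom T B P. m = s \<cdot> \<theta> \<cdot> a) \<longleftrightarrow> flash n a m"
proof
  note [simp] = exact_arr[OF E] exact_Ob[OF E] Hom_Ob[OF a]
  assume "\<exists>\<theta> \<in> Hom T B P. m = s \<cdot> \<theta> \<cdot> a"
  then obtain \<theta> where "\<theta> \<in> Hom T B P" "m = s \<cdot> \<theta> \<cdot> a" by blast
  then show "flash n a m"
    unfolding flash_def using a comp_eq[OF exact_comp_Zero(1)[OF E], of \<theta>]
    by (intro bexI[of _ "s \<cdot> \<theta>"]) (simp_all add: Hom_iff)
next
  note [simp] = exact_arr[OF E] exact_Ob[OF E] Hom_Ob[OF a]
  assume "flash n a m"
  then obtain \<phi> where \<phi>: "\<phi> \<in> Hom T B Q" "n \<cdot> \<phi> = Zero T B R" "m = \<phi> \<cdot> a"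
    using a by (auto simp: flash_def Hom_iff)
  then obtain \<theta> where "\<theta> \<in> Hom T B P" "\<phi> = s \<cdot> \<theta>" using exact_lift[OF E] by blast
  then show "\<exists>\<theta> \<in> Hom T B P. m = s \<cdot> \<theta> \<cdot> a" using \<phi>(3) a by (auto simp: Hom_iff)
qed

text \<open>The factor is pulled back along the comparison of the two cones, which respects the maps
  from \<open>Q\<close>.\<close>

lemma flash_cone:
  assumes E: "exact_triangle T P Q R (a, p, q)" and E': "exact_triangle T P Q R' (a, p', q')"
    and n: "n \<in> Arr T" and fl: "flash n p m"
  shows "flash n p' m"
proof -
  note [simp] = exact_arr[OF E] exact_Ob[OF E] exact_arr[OF E'] exact_Ob[OF E']
  obtain \<phi> where \<phi>: "\<phi> \<in> Hom T R (Dom T n)" "n \<cdot> \<phi> = Zero T R (Cod T n)" "m = \<phi> \<cdot> p"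
    using fl by (auto simp: flash_def)
  obtain i where i: "i \<in> Hom T R' R" "i \<cdot> p' = p" using exact_unique[OF E' E] by blast
  show ?thesis
    unfolding flash_def using \<phi> i(1) n comp_eq[OF \<phi>(2), of i]
    by (intro bexI[of _ "\<phi> \<cdot> i"]) (simp_all add: Hom_iff i(2) Cod_Ob)
qed

text \<open>For \<open>\<psi> = 0\<close> the bracket asks for \<open>\<phi>\<close> with
  \<open>\<phi> \<cdot> p = m\<close> and \<open>n \<cdot> \<phi>\<close> zero, which is
  \<open>flash\<close> for the chosen cone; \<open>flash_cone\<close> removes the choice.\<close>

lemma toda_bracket_Zero_iff:
  assumes E: "exact_triangle T P Q R (a, p, q)" and k: "k \<in> cones T a"
    and m: "m \<in> Hom T Q S" and n: "n \<in> Hom T S U"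
  shows "Zero T (SigmaO T P) U \<in> toda_bracket T k n m a \<longleftrightarrow> flash n p m"
proof -
  obtain R' p' q' where k_eq: "k = (p', q')" and E': "exact_triangle T P Q R' (a, p', q')"
    using k exact_arr[OF E] by (auto simp: cones_def)
  note [simp] = exact_arr[OF E] exact_Ob[OF E] exact_arr[OF E'] exact_Ob[OF E'] Hom_Ob[OF n]
  have "Zero T (SigmaO T P) U \<in> toda_bracket T k n m a \<longleftrightarrow> flash n p' m"
    using m n unfolding toda_bracket_def flash_def k_eq by (auto simp: Hom_iff)
  also have "\<dots> \<longleftrightarrow> flash n p m"
    using flash_cone[OF E E'] flash_cone[OF E' E] n by (auto simp: Hom_iff)
  finally show ?thesis .
qed

text \<open>A rotation backwards, for the shape \<open>(f, 0, 0)\<close>, where (4) and (5) involve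
  desuspensions. The isomorphism \<open>to_SigInv\<close> replaces \<open>Z\<close> by a suspension,
  so that \<open>exact_rotate_iff\<close> can be read from right to left.\<close>

lemma exact_desuspend:
  assumes E: "exact_triangle T X Y Z (u, v, w)"
  shows "exact_triangle T (InvSigmaO T Z) X Y (desuspend T X w, u, neg T (to_SigInv T Z \<cdot> v))"
proof -
  note [simp] = exact_arr[OF E] exact_Ob[OF E]
  have [simp]: "desuspend T X w \<in> Arr T" "Dom T (desuspend T X w) = InvSigmaO T Z"
    "Cod T (desuspend T X w) = X"
    by (simp_all add: desuspend_def)
  \<comment> \<open>Naturality of \<open>to_SigInv\<close> moves it past \<open>w\<close>; the
    triangle identity for \<Sigma> then cancels it.\<close>
  have "SigmaA T (desuspend T X w) \<cdot> to_SigInv T Z =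
      SigmaA T (from_InvSig T X) \<cdot> to_SigInv T (SigmaO T X) \<cdot> w"
    using to_SigInv_natural[OF exact_Hom(3)[OF E]] by (simp add: desuspend_def)
  also have "\<dots> = w" using comp_eq[OF triangle_identity_Sigma, of X w] by simp
  finally have w: "SigmaA T (desuspend T X w) \<cdot> to_SigInv T Z = w" .
  have iso: "is_iso T (neg T (to_SigInv T Z))"
  proof -
    obtain j where j: "j \<in> Hom T (SigmaO T (InvSigmaO T Z)) Z" "j \<cdot> to_SigInv T Z = Ident T Z"
      "to_SigInv T Z \<cdot> j = Ident T (SigmaO T (InvSigmaO T Z))"
      using is_isoE[of "to_SigInv T Z" Z "SigmaO T (InvSigmaO T Z)"] by (auto simp: Hom_iff)
    then show ?thesis
      by (intro is_isoI[of _ Z "SigmaO T (InvSigmaO T Z)" "neg T j"]) (simp_all add: Hom_iff)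
  qed
  \<comment> \<open>The sign on \<open>to_SigInv\<close> produces the one that rotation puts on the
    suspended first map.\<close>
  have "exact_triangle T X Y (SigmaO T (InvSigmaO T Z))
    (u, neg T (to_SigInv T Z \<cdot> v), neg T (SigmaA T (desuspend T X w)))"
    by (rule exact_iso[OF E, where f = "Ident T X" and g = "Ident T Y" and h = "neg T (to_SigInv T Z)"])
      (use w iso in \<open>simp_all add: Hom_iff\<close>)
  then show ?thesis by (subst exact_rotate_iff) (simp_all add: Hom_iff)
qed

text \<open>Precomposition with the isomorphism \<open>to_SigInv\<close> is injective, so only the
  zero map is transported to zero.\<close>

lemma toda_bracket_desuspended_Zero_iff:
  assumes E: "exact_triangle T X Y Z (u, v, w)" and k: "k \<in> cones T (desuspend T X w)"
    and m: "m \<in> Hom T X S" and n: "n \<in> Hom T S U"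
  shows "Zero T Z U \<in> toda_bracket_desuspended T Z k n m (desuspend T X w) \<longleftrightarrow> flash n u m"
proof -
  let ?W = "SigmaO T (InvSigmaO T Z)"
  note [simp] = exact_Ob[OF E] Hom_Ob[OF n]
  have "Dom T (desuspend T X w) = InvSigmaO T Z" using exact_arr[OF exact_desuspend[OF E]] by simp
  then have "\<psi> \<in> Hom T ?W U" if "\<psi> \<in> toda_bracket T k n m (desuspend T X w)" for \<psi>
    using that n by (cases k) (auto simp: toda_bracket_def Hom_iff)
  then have "\<psi> \<cdot> to_SigInv T Z = Zero T Z U \<longleftrightarrow> \<psi> = Zero T ?W U"
    if "\<psi> \<in> toda_bracket T k n m (desuspend T X w)" for \<psi>
    using that comp_iso_cancel_right[of "to_SigInv T Z" \<psi> ?W U "Zero T ?W U" Z]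
    by (auto simp: Hom_iff)
  then have "Zero T Z U \<in> toda_bracket_desuspended T Z k n m (desuspend T X w) \<longleftrightarrow>
      Zero T ?W U \<in> toda_bracket T k n m (desuspend T X w)"
    unfolding toda_bracket_desuspended_def image_iff by metis
  then show ?thesis using toda_bracket_Zero_iff[OF exact_desuspend[OF E] k m n] by simp
qed

section \<open>Octahedra and Verdier goodness\<close>

lemma octahedron_iff:
  assumes "a' \<in> Hom T Q A" "b' \<in> Hom T R B" "c' \<in> Hom T R C"
  shows "octahedron T a b (a', a'') (b', b'') (c', c'') (\<alpha>, \<beta>, \<gamma>) \<longleftrightarrow>
    exact_triangle T A C B (\<alpha>, \<beta>, \<gamma>) \<and> \<alpha> \<cdot> a' = c' \<cdot> b \<and> c'' \<cdot> \<alpha> = a'' \<and> \<beta> \<cdot> c' = b' \<and>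
    \<gamma> = SigmaA T a' \<cdot> b'' \<and> b'' \<cdot> \<beta> = SigmaA T a \<cdot> c''"
  using assms by (simp add: octahedron_def Hom_iff)

text \<open>Of the two octahedra this keeps the maps entering
  \<open>\<beta>2 \<cdot> \<alpha>1\<close> and their compatibilities, from which the factorisations
  are read off later.\<close>

lemma verdier_goodE:
  assumes E: "exact_triangle T X Y Z (u, v, w)" and E': "exact_triangle T X' Y' Z' (u', v', w')"
    and Kf: "exact_triangle T X X' F (f, f', f'')" and Kg: "exact_triangle T Y Y' G (g, g', g'')"
    and Kc: "exact_triangle T X Y' C (c, c', c'')"
    and V: "verdier_good T (f', f'') (g', g'') (c', c'') (u, v, w) (u', v', w') (f, g, h)"
  obtains \<alpha>1 \<beta>2 where "\<alpha>1 \<in> Hom T Z C" "\<beta>2 \<in> Hom T C Z'" "\<alpha>1 \<cdot> v = c' \<cdot> g" "c'' \<cdot> \<alpha>1 = w"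
    "\<beta>2 \<cdot> c' = v'" "w' \<cdot> \<beta>2 = SigmaA T f \<cdot> c''" "h = \<beta>2 \<cdot> \<alpha>1"
proof -
  obtain \<alpha>1 \<beta>1 \<gamma>1 \<alpha>2 \<beta>2 \<gamma>2 where
    o: "octahedron T u g (v, w) (g', g'') (c', c'') (\<alpha>1, \<beta>1, \<gamma>1)"
      "octahedron T f u' (f', f'') (v', w') (c', c'') (\<alpha>2, \<beta>2, \<gamma>2)" "h = \<beta>2 \<cdot> \<alpha>1"
    using V unfolding verdier_good_def by auto
  note o1 = o(1)[unfolded octahedron_iff[OF exact_Hom(2)[OF E] exact_Hom(2)[OF Kg] exact_Hom(2)[OF Kc]]]
  note o2 = o(2)[unfolded octahedron_iff[OF exact_Hom(2)[OF Kf] exact_Hom(2)[OF E'] exact_Hom(2)[OF Kc]]]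
  show ?thesis using that[of \<alpha>1 \<beta>2] o1 o2 o(3) by (auto simp: exact_triangle_iff)
qed

text \<open>The axiom gives one octahedron for each of the two factorisations over the same cone.
  The resulting \<open>h\<close> cannot be prescribed here.\<close>

lemma verdier_good_exists:
  assumes E: "exact_triangle T X Y Z (u, v, w)" and E': "exact_triangle T X' Y' Z' (u', v', w')"
    and Kf: "exact_triangle T X X' F (f, f', f'')" and Kg: "exact_triangle T Y Y' G (g, g', g'')"
    and Kc: "exact_triangle T X Y' C (g \<cdot> u, c', c'')" and gu: "g \<cdot> u = u' \<cdot> f"
  obtains h where "h \<in> Hom T Z Z'"
    "verdier_good T (f', f'') (g', g'') (c', c'') (u, v, w) (u', v', w') (f, g, h)"
proof -
  note Kc' = Kc[unfolded gu]
  obtain \<alpha>1 \<beta>1 \<gamma>1 where o1: "octahedron T u g (v, w) (g', g'') (c', c'') (\<alpha>1, \<beta>1, \<gamma>1)"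
    using Exact_octahedron[OF exact_Hom(1)[OF E] exact_Hom(1)[OF Kg] conesI[OF E] conesI[OF Kg]
      conesI[OF Kc]] by blast
  obtain \<alpha>2 \<beta>2 \<gamma>2 where o2: "octahedron T f u' (f', f'') (v', w') (c', c'') (\<alpha>2, \<beta>2, \<gamma>2)"
    using Exact_octahedron[OF exact_Hom(1)[OF Kf] exact_Hom(1)[OF E'] conesI[OF Kf] conesI[OF E']
      conesI[OF Kc']] by blast
  have V: "verdier_good T (f', f'') (g', g'') (c', c'') (u, v, w) (u', v', w') (f, g, \<beta>2 \<cdot> \<alpha>1)"
    using o1 o2 unfolding verdier_good_def by auto
  obtain \<alpha>1' \<beta>2' where "\<alpha>1' \<in> Hom T Z C" "\<beta>2' \<in> Hom T C Z'" "\<beta>2 \<cdot> \<alpha>1 = \<beta>2' \<cdot> \<alpha>1'"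
    using verdier_goodE[OF E E' Kf Kg Kc V] by metis
  then show ?thesis using that[OF _ V] by (simp add: Comp_Hom)
qed

text \<open>Conjugating one octahedron by the automorphism \<open>1 + c'\<zeta>c''\<close> of the cone on \<open>gu\<close> changes the
  composite \<open>\<beta>\<^sub>2\<alpha>\<^sub>1\<close> by \<open>v'\<zeta>w\<close>.\<close>

lemma verdier_good_add_lightning:
  assumes E: "exact_triangle T X Y Z (u, v, w)" and E': "exact_triangle T X' Y' Z' (u', v', w')"
    and Kf: "exact_triangle T X X' F (f, f', f'')" and Kg: "exact_triangle T Y Y' G (g, g', g'')"
    and Kc: "exact_triangle T X Y' C (c, c', c'')"
    and V: "verdier_good T (f', f'') (g', g'') (c', c'') (u, v, w) (u', v', w') (f, g, h)"
    and \<zeta>: "\<zeta> \<in> Hom T (SigmaO T X) Y'"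
  shows "verdier_good T (f', f'') (g', g'') (c', c'') (u, v, w) (u', v', w') (f, g, h \<^bold>+ v' \<cdot> \<zeta> \<cdot> w)"
proof -
  note [simp] = exact_arr[OF E] exact_Ob[OF E] exact_arr[OF E'] exact_Ob[OF E'] exact_arr[OF Kf]
    exact_Ob[OF Kf] exact_arr[OF Kg] exact_Ob[OF Kg] exact_arr[OF Kc] exact_Ob[OF Kc]
  obtain \<alpha>1 \<beta>1 \<gamma>1 \<alpha>2 \<beta>2 \<gamma>2 where
    o: "octahedron T u g (v, w) (g', g'') (c', c'') (\<alpha>1, \<beta>1, \<gamma>1)"
      "octahedron T f u' (f', f'') (v', w') (c', c'') (\<alpha>2, \<beta>2, \<gamma>2)" "h = \<beta>2 \<cdot> \<alpha>1"
    using V unfolding verdier_good_def by auto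
  note oct1 = octahedron_iff[OF exact_Hom(2)[OF E] exact_Hom(2)[OF Kg] exact_Hom(2)[OF Kc]]
  note o1 = o(1)[unfolded oct1]
  note o2 = o(2)[unfolded octahedron_iff[OF exact_Hom(2)[OF Kf] exact_Hom(2)[OF E'] exact_Hom(2)[OF Kc]]]
  have O1: "exact_triangle T Z C G (\<alpha>1, \<beta>1, \<gamma>1)" and O2: "exact_triangle T F C Z' (\<alpha>2, \<beta>2, \<gamma>2)"
    using o1 o2 by blast+
  note [simp] = exact_arr[OF O1] exact_arr[OF O2]
  \<comment> \<open>Since \<open>c'' \<cdot> c'\<close> is zero, \<open>t\<close> squares to zero
    and \<open>1 + t\<close> has inverse \<open>1 - t\<close>. Moreover \<open>t \<cdot> c'\<close>
    and \<open>c'' \<cdot> t\<close> vanish, so conjugation preserves the octahedron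
    relations.\<close>
  define t where "t = c' \<cdot> \<zeta> \<cdot> c''"
  have t [simp]: "t \<in> Arr T" "Dom T t = C" "Cod T t = C" using \<zeta> by (simp_all add: t_def Hom_iff)
  have cc: "c'' \<cdot> c' = Zero T Y' (SigmaO T X)" using exact_comp_Zero[OF Kc] by blast
  have tc: "t \<cdot> c' = Zero T Y' C" using \<zeta> cc by (simp add: t_def Hom_iff)
  have ct: "c'' \<cdot> t = Zero T C (SigmaO T X)"
    using \<zeta> comp_eq[OF cc, of "\<zeta> \<cdot> c''"] by (simp add: t_def Hom_iff)
  have tt: "t \<cdot> t = Zero T C C"
    using \<zeta> ct by (subst t_def) (simp add: Hom_iff)
  define e where "e = Ident T C \<^bold>+ t"
  define e' where "e' = Ident T C \<^bold>+ neg T t"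
  have [simp]: "e \<in> Arr T" "Dom T e = C" "Cod T e = C" "e' \<in> Arr T" "Dom T e' = C" "Cod T e' = C"
    by (simp_all add: e_def e'_def)
  have ee': "e \<cdot> e' = Ident T C" "e' \<cdot> e = Ident T C"
    by (simp_all add: e_def e'_def tt)
  have "exact_triangle T Z C G (e \<cdot> \<alpha>1, \<beta>1 \<cdot> e', \<gamma>1)"
  proof (rule exact_iso[OF O1, where f = "Ident T Z" and g = e and h = "Ident T G"])
    show "is_iso T e" using ee' by (intro is_isoI[of e C C e']) (simp_all add: Hom_iff)
  qed (simp_all add: Hom_iff ee')
  moreover have "(e \<cdot> \<alpha>1) \<cdot> v = c' \<cdot> g"
    using o1 comp_eq[OF tc, of g] by (simp add: e_def)
  moreover have "c'' \<cdot> e \<cdot> \<alpha>1 = w"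
    using o1 comp_eq[OF ct, of \<alpha>1] by (simp add: e_def)
  moreover have "(\<beta>1 \<cdot> e') \<cdot> c' = g'"
    using o1 by (simp add: e'_def tc)
  moreover have "g'' \<cdot> \<beta>1 \<cdot> e' = SigmaA T u \<cdot> c''"
  proof -
    have "g'' \<cdot> \<beta>1 \<cdot> e' = SigmaA T u \<cdot> c'' \<cdot> e'"
      using o1 by (intro comp_eq_comp) simp_all
    also have "\<dots> = SigmaA T u \<cdot> c''" by (simp add: e'_def ct)
    finally show ?thesis .
  qed
  ultimately have "octahedron T u g (v, w) (g', g'') (c', c'') (e \<cdot> \<alpha>1, \<beta>1 \<cdot> e', \<gamma>1)"
    unfolding oct1 using o1 by blast
  \<comment> \<open>The extra term is \<open>\<beta>2 \<cdot> c' \<cdot> \<zeta> \<cdot> c'' \<cdot>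
    \<alpha>1\<close>, where \<open>\<beta>2 \<cdot> c' = v'\<close> and
    \<open>c'' \<cdot> \<alpha>1 = w\<close>.\<close>
  moreover have "h \<^bold>+ v' \<cdot> \<zeta> \<cdot> w = \<beta>2 \<cdot> e \<cdot> \<alpha>1"
  proof -
    have "\<beta>2 \<cdot> t \<cdot> \<alpha>1 = \<beta>2 \<cdot> c' \<cdot> \<zeta> \<cdot> c'' \<cdot> \<alpha>1" using \<zeta> by (simp add: t_def Hom_iff)
    also have "\<dots> = v' \<cdot> \<zeta> \<cdot> w" using \<zeta> o1 o2 comp_eq[of \<beta>2 c' v' "\<zeta> \<cdot> w"] by (simp add: Hom_iff)
    finally show ?thesis by (simp add: e_def o(3))
  qed
  ultimately show ?thesis using o(2) unfolding verdier_good_def by auto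
qed

lemma verdier_good_diff_lightning:
  assumes E: "exact_triangle T X Y Z (u, v, w)" and E': "exact_triangle T X' Y' Z' (u', v', w')"
    and Kf: "exact_triangle T X X' F (f, f', f'')" and Kg: "exact_triangle T Y Y' G (g, g', g'')"
    and Kc: "exact_triangle T X Y' C (c, c', c'')"
    and V: "verdier_good T (f', f'') (g', g'') (c', c'') (u, v, w) (u', v', w')
      (f, g, h \<^bold>+ v' \<cdot> \<zeta> \<cdot> w)"
    and h: "h \<in> Hom T Z Z'" and \<zeta>: "\<zeta> \<in> Hom T (SigmaO T X) Y'"
  shows "verdier_good T (f', f'') (g', g'') (c', c'') (u, v, w) (u', v', w') (f, g, h)"
  using verdier_good_add_lightning[OF E E' Kf Kg Kc V neg_Hom[OF \<zeta>]] h \<zeta> exact_arr[OF E]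
    exact_arr[OF E']
  by (simp add: Hom_iff)

text \<open>Here \<open>\<alpha>1 \<cdot> v\<close> and \<open>w' \<cdot> \<beta>2\<close> vanish,
  so \<open>\<alpha>1\<close> extends over \<open>w\<close> and \<open>\<beta>2\<close> lifts
  through \<open>v'\<close>; the composite is a lightning flash.\<close>

lemma verdier_good_h_iff:
  assumes E: "exact_triangle T X Y Z (u, v, w)" and E': "exact_triangle T X' Y' Z' (u', v', w')"
    and Kf: "exact_triangle T X X' F (Zero T X X', f', f'')"
    and Kg: "exact_triangle T Y Y' G (Zero T Y Y', g', g'')"
    and Kc: "exact_triangle T X Y' C (Zero T Y Y' \<cdot> u, c', c'')"
    and h: "h \<in> Hom T Z Z'"
  shows "verdier_good T (f', f'') (g', g'') (c', c'') (u, v, w) (u', v', w') (Zero T X X', Zero T Y Y', h)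
    \<longleftrightarrow> flash w' w h"
proof -
  note [simp] = exact_arr[OF E] exact_Ob[OF E] exact_arr[OF E'] exact_Ob[OF E']
    exact_arr(4-)[OF Kf] exact_Ob[OF Kf] exact_arr(4-)[OF Kg] exact_Ob[OF Kg] exact_arr(4-)[OF Kc] exact_Ob[OF Kc]
  have imp: "\<exists>\<theta> \<in> Hom T (SigmaO T X) Y'. h = v' \<cdot> \<theta> \<cdot> w"
    if V: "verdier_good T (f', f'') (g', g'') (c', c'') (u, v, w) (u', v', w') (Zero T X X', Zero T Y Y', h)"
    for h
  proof -
    obtain \<alpha>1 \<beta>2 where o: "\<alpha>1 \<in> Hom T Z C" "\<beta>2 \<in> Hom T C Z'" "\<alpha>1 \<cdot> v = c' \<cdot> Zero T Y Y'"
      "w' \<cdot> \<beta>2 = SigmaA T (Zero T X X') \<cdot> c''" "h = \<beta>2 \<cdot> \<alpha>1"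
      using verdier_goodE[OF E E' Kf Kg Kc V] .
    have "\<alpha>1 \<cdot> v = Zero T Y C" "w' \<cdot> \<beta>2 = Zero T C (SigmaO T X')" using o(3,4) by simp_all
    then obtain a b where "a \<in> Hom T (SigmaO T X) C" "\<alpha>1 = a \<cdot> w" "b \<in> Hom T C Y'" "\<beta>2 = v' \<cdot> b"
      using exact_extend2[OF E o(1)] exact_lift2[OF E' o(2)] by metis
    then show ?thesis using o(5) by (intro bexI[of _ "b \<cdot> a"]) (simp_all add: Hom_iff)
  qed
  have "verdier_good T (f', f'') (g', g'') (c', c'') (u, v, w) (u', v', w') (Zero T X X', Zero T Y Y', h)"
    if \<theta>: "\<theta> \<in> Hom T (SigmaO T X) Y'" "h = v' \<cdot> \<theta> \<cdot> w" for \<theta>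
  proof -
    \<comment> \<open>By \<open>imp\<close>, the component \<open>h0\<close> supplied by the axiom
      is itself a lightning flash, so it differs from \<open>h\<close> by a lightning flash.\<close>
    have "Zero T Y Y' \<cdot> u = u' \<cdot> Zero T X X'" by simp
    then obtain h0 where h0: "h0 \<in> Hom T Z Z'"
      "verdier_good T (f', f'') (g', g'') (c', c'') (u, v, w) (u', v', w') (Zero T X X', Zero T Y Y', h0)"
      using verdier_good_exists[OF E E' Kf Kg Kc] by blast
    then obtain \<theta>0 where \<theta>0: "\<theta>0 \<in> Hom T (SigmaO T X) Y'" "h0 = v' \<cdot> \<theta>0 \<cdot> w" using imp by blast
    have eq: "h0 = h \<^bold>+ v' \<cdot> (\<theta>0 \<^bold>+ neg T \<theta>) \<cdot> w"
      using \<theta> \<theta>0 Plus_neg_cancel_right[of "v' \<cdot> \<theta>0 \<cdot> w" "v' \<cdot> \<theta> \<cdot> w"] by (simp add: Hom_iff)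
    show ?thesis
      using verdier_good_diff_lightning[OF E E' Kf Kg Kc h0(2)[unfolded eq] h] \<theta>(1) \<theta>0(1)
      by (simp add: Hom_iff)
  qed
  then show ?thesis
    using imp[of h] lightning_iff_flash[OF exact_rotate[OF E'] exact_Hom(3)[OF E], of h] by blast
qed

text \<open>The suspended zero map annihilates the identity of \<open>SigmaO T X\<close>, which
  therefore lifts through \<open>q\<close>.\<close>

lemma exact_Zero_section:
  assumes E: "exact_triangle T X Y C (Zero T X Y, p, q)"
  obtains s where "s \<in> Hom T (SigmaO T X) C" "q \<cdot> s = Ident T (SigmaO T X)"
proof -
  note [simp] = exact_Ob[OF E]
  obtain s where "s \<in> Hom T (SigmaO T X) C" "Ident T (SigmaO T X) = q \<cdot> s"
    using exact_lift3[OF E, of "Ident T (SigmaO T X)" "SigmaO T X"] by (auto simp: Hom_iff)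
  then show ?thesis using that by metis
qed

lemma exact_Zero_retraction:
  assumes E: "exact_triangle T X Y C (Zero T X Y, p, q)"
  obtains r where "r \<in> Hom T C Y" "r \<cdot> p = Ident T Y"
proof -
  note [simp] = exact_Ob[OF E]
  obtain r where "r \<in> Hom T C Y" "Ident T Y = r \<cdot> p"
    using exact_extend[OF E, of "Ident T Y" Y] by (auto simp: Hom_iff)
  then show ?thesis using that by metis
qed

text \<open>As the second component is zero, \<open>\<alpha>1 = a \<cdot> w\<close>, where
  \<open>a\<close> can be made a section of \<open>c''\<close>. Then
  \<open>\<beta>2 \<cdot> a\<close> lifts \<open>SigmaA T f\<close> through \<open>w'\<close>, and
  the third component is this lift composed with \<open>w\<close>: it vanishes exactly when the lift
  factors through \<open>SigmaA T u\<close>.\<close>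

lemma verdier_good_f_iff:
  assumes E: "exact_triangle T X Y Z (u, v, w)" and E': "exact_triangle T X' Y' Z' (u', v', w')"
    and Kf: "exact_triangle T X X' F (f, f', f'')"
    and Kg: "exact_triangle T Y Y' G (Zero T Y Y', g', g'')"
    and Kc: "exact_triangle T X Y' C (Zero T Y Y' \<cdot> u, c', c'')"
    and uf: "u' \<cdot> f = Zero T X Y'"
  shows "verdier_good T (f', f'') (g', g'') (c', c'') (u, v, w) (u', v', w') (f, Zero T Y Y', Zero T Z Z')
    \<longleftrightarrow> flash u' u f"
proof -
  note [simp] = exact_arr[OF E] exact_Ob[OF E] exact_arr[OF E'] exact_Ob[OF E']
    exact_arr[OF Kf] exact_Ob[OF Kf] exact_arr(4-)[OF Kg] exact_Ob[OF Kg] exact_arr(4-)[OF Kc] exact_Ob[OF Kc]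
  have Kc0: "exact_triangle T X Y' C (Zero T X Y', c', c'')" using Kc by simp
  let ?V = "\<lambda>h. verdier_good T (f', f'') (g', g'') (c', c'') (u, v, w) (u', v', w') (f, Zero T Y Y', h)"
  have core: "\<exists>a \<beta>2. a \<in> Hom T (SigmaO T X) C \<and> \<beta>2 \<in> Hom T C Z' \<and> h = \<beta>2 \<cdot> a \<cdot> w \<and>
      w' \<cdot> \<beta>2 \<cdot> a = SigmaA T f" if V: "?V h" for h
  proof -
    obtain \<alpha>1 \<beta>2 where o: "\<alpha>1 \<in> Hom T Z C" "\<beta>2 \<in> Hom T C Z'" "\<alpha>1 \<cdot> v = c' \<cdot> Zero T Y Y'"
      "c'' \<cdot> \<alpha>1 = w" "w' \<cdot> \<beta>2 = SigmaA T f \<cdot> c''" "h = \<beta>2 \<cdot> \<alpha>1"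
      using verdier_goodE[OF E E' Kf Kg Kc V] .
    have "\<alpha>1 \<cdot> v = Zero T Y C" using o(3) by simp
    then obtain a0 where a0: "a0 \<in> Hom T (SigmaO T X) C" "\<alpha>1 = a0 \<cdot> w" using exact_extend2[OF E o(1)] by metis
    \<comment> \<open>\<open>a0\<close> is a section of \<open>c''\<close> up to \<open>?d\<close>,
      which vanishes on \<open>w\<close> and so is \<open>e \<cdot> SigmaA T u\<close>. Subtracting
      it by means of the section \<open>s\<close> leaves \<open>a \<cdot> w\<close>
      unchanged.\<close>
    let ?d = "c'' \<cdot> a0 \<^bold>+ neg T (Ident T (SigmaO T X))"
    have "?d \<cdot> w = Zero T Z (SigmaO T X)" using a0 o(4) by (simp add: Hom_iff)
    then obtain e where e: "e \<in> Hom T (SigmaO T Y) (SigmaO T X)" "?d = e \<cdot> SigmaA T u"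
      using exact_extend3[OF E, of ?d "SigmaO T X"] a0 by (auto simp: Hom_iff)
    obtain s where s: "s \<in> Hom T (SigmaO T X) C" "c'' \<cdot> s = Ident T (SigmaO T X)"
      using exact_Zero_section[OF Kc0] .
    define a where "a = a0 \<^bold>+ neg T (s \<cdot> e \<cdot> SigmaA T u)"
    have a: "a \<in> Hom T (SigmaO T X) C" using a0 s e by (simp add: a_def Hom_iff)
    have "c'' \<cdot> s \<cdot> e \<cdot> SigmaA T u = e \<cdot> SigmaA T u"
      using s e comp_eq[OF s(2), of "e \<cdot> SigmaA T u"] by (simp add: Hom_iff)
    moreover have "c'' \<cdot> a0 = Ident T (SigmaO T X) \<^bold>+ e \<cdot> SigmaA T u"
      using a0(1) by - (rule diff_eqI[OF _ _ e(2), of "SigmaO T X" "SigmaO T X"], simp_all add: Hom_iff)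
    ultimately have ca: "c'' \<cdot> a = Ident T (SigmaO T X)"
      using a0(1) s(1) e(1) by (simp add: a_def Hom_iff)
    have "a \<cdot> w = \<alpha>1"
      using a0 s e exact_comp_Zero(3)[OF E] by (simp add: a_def Hom_iff)
    moreover have "w' \<cdot> \<beta>2 \<cdot> a = SigmaA T f"
    proof -
      have "w' \<cdot> \<beta>2 \<cdot> a = SigmaA T f \<cdot> c'' \<cdot> a"
        using o(2) a by - (rule comp_eq_comp[OF o(5)], simp_all add: Hom_iff)
      then show ?thesis by (simp add: ca)
    qed
    ultimately show ?thesis using a o(2,6) by blast
  qed
  \<comment> \<open>Rotating \<open>E'\<close> twice turns the suspended form of (5) into a flash
    for \<open>-\<Sigma>u'\<close>; the sign and the suspension then drop out.\<close>
  have light: "(\<exists>b \<in> Hom T (SigmaO T Y) Z'. SigmaA T f = w' \<cdot> b \<cdot> SigmaA T u) \<longleftrightarrow> flash u' u f"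
    using lightning_iff_flash[OF exact_rotate[OF exact_rotate[OF E']] Sigma_Hom[OF exact_Hom(1)[OF E]]]
      flash_neg_left[of "SigmaA T u'" "SigmaA T u"]
      flash_Sigma[OF exact_Hom(1)[OF E'] exact_Hom(1)[OF E] exact_Hom(1)[OF Kf]]
    by simp
  have "\<exists>b \<in> Hom T (SigmaO T Y) Z'. SigmaA T f = w' \<cdot> b \<cdot> SigmaA T u" if V: "?V (Zero T Z Z')"
  proof -
    obtain a \<beta>2 where ab: "a \<in> Hom T (SigmaO T X) C" "\<beta>2 \<in> Hom T C Z'" "Zero T Z Z' = \<beta>2 \<cdot> a \<cdot> w"
      "w' \<cdot> \<beta>2 \<cdot> a = SigmaA T f"
      using core[OF V] by blast
    then have "(\<beta>2 \<cdot> a) \<cdot> w = Zero T Z Z'" by (simp add: Hom_iff)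
    then obtain b where "b \<in> Hom T (SigmaO T Y) Z'" "\<beta>2 \<cdot> a = b \<cdot> SigmaA T u"
      using exact_extend3[OF E Comp_Hom[OF ab(1,2)]] by metis
    then show ?thesis using ab(4) by metis
  qed
  moreover have "?V (Zero T Z Z')" if b: "b \<in> Hom T (SigmaO T Y) Z'" "SigmaA T f = w' \<cdot> b \<cdot> SigmaA T u" for b
  proof -
    have "Zero T Y Y' \<cdot> u = u' \<cdot> f" using uf by simp
    then obtain h where h: "h \<in> Hom T Z Z'" "?V h"
      using verdier_good_exists[OF E E' Kf Kg Kc] by blast
    obtain a \<beta>2 where ab: "a \<in> Hom T (SigmaO T X) C" "\<beta>2 \<in> Hom T C Z'" "h = \<beta>2 \<cdot> a \<cdot> w"
      "w' \<cdot> \<beta>2 \<cdot> a = SigmaA T f"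
      using core[OF h(2)] by blast
    \<comment> \<open>Both \<open>\<beta>2 \<cdot> a\<close> and \<open>b \<cdot> SigmaA T u\<close>
      lift \<open>SigmaA T f\<close> through \<open>w'\<close>, so they differ by some
      \<open>v' \<cdot> d\<close>. Composing with \<open>w\<close> exhibits \<open>h\<close> as
      \<open>v' \<cdot> d \<cdot> w\<close>.\<close>
    let ?d = "\<beta>2 \<cdot> a \<^bold>+ neg T (b \<cdot> SigmaA T u)"
    have "w' \<cdot> ?d = Zero T (SigmaO T X) (SigmaO T X')" using b ab by (simp add: Hom_iff)
    then obtain d where d: "d \<in> Hom T (SigmaO T X) Y'" "?d = v' \<cdot> d"
      using exact_lift2[OF E', of ?d "SigmaO T X"] b ab by (auto simp: Hom_iff)
    have "v' \<cdot> d \<cdot> w = ?d \<cdot> w" using d(1) by (simp add: d(2) Hom_iff)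
    then have "h = Zero T Z Z' \<^bold>+ v' \<cdot> d \<cdot> w"
      using ab b exact_comp_Zero(3)[OF E] by (simp add: Hom_iff)
    then show ?thesis
      using h(2) d(1)
      by - (rule verdier_good_diff_lightning[OF E E' Kf Kg Kc, where \<zeta> = d], simp_all add: Hom_iff)
  qed
  ultimately show ?thesis using light by blast
qed

text \<open>Dual to the previous case: \<open>\<beta>2 = v' \<cdot> b\<close>, where
  \<open>b\<close> can be made a retraction of \<open>c'\<close>. Then
  \<open>b \<cdot> \<alpha>1\<close> extends \<open>g\<close> along \<open>v\<close>, and
  \<open>h\<close> vanishes exactly when this extension factors through \<open>u'\<close>.\<close>

lemma verdier_good_g_iff:
  assumes E: "exact_triangle T X Y Z (u, v, w)" and E': "exact_triangle T X' Y' Z' (u', v', w')"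
    and Kf: "exact_triangle T X X' F (Zero T X X', f', f'')"
    and Kg: "exact_triangle T Y Y' G (g, g', g'')"
    and Kc: "exact_triangle T X Y' C (g \<cdot> u, c', c'')"
    and gu: "g \<cdot> u = Zero T X Y'"
  shows "verdier_good T (f', f'') (g', g'') (c', c'') (u, v, w) (u', v', w') (Zero T X X', g, Zero T Z Z')
    \<longleftrightarrow> flash v' v g"
proof -
  note [simp] = exact_arr[OF E] exact_Ob[OF E] exact_arr[OF E'] exact_Ob[OF E']
    exact_arr(4-)[OF Kf] exact_Ob[OF Kf] exact_arr[OF Kg] exact_Ob[OF Kg] exact_arr(4-)[OF Kc] exact_Ob[OF Kc]
  have Kc0: "exact_triangle T X Y' C (Zero T X Y', c', c'')" using Kc gu by simp
  let ?V = "\<lambda>h. verdier_good T (f', f'') (g', g'') (c', c'') (u, v, w) (u', v', w') (Zero T X X', g, h)"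
  have core: "\<exists>b \<alpha>1. b \<in> Hom T C Y' \<and> \<alpha>1 \<in> Hom T Z C \<and> h = v' \<cdot> b \<cdot> \<alpha>1 \<and> b \<cdot> \<alpha>1 \<cdot> v = g"
    if V: "?V h" for h
  proof -
    obtain \<alpha>1 \<beta>2 where o: "\<alpha>1 \<in> Hom T Z C" "\<beta>2 \<in> Hom T C Z'" "\<alpha>1 \<cdot> v = c' \<cdot> g"
      "\<beta>2 \<cdot> c' = v'" "w' \<cdot> \<beta>2 = SigmaA T (Zero T X X') \<cdot> c''" "h = \<beta>2 \<cdot> \<alpha>1"
      using verdier_goodE[OF E E' Kf Kg Kc V] .
    have "w' \<cdot> \<beta>2 = Zero T C (SigmaO T X')" using o(5) by simp
    then obtain b0 where b0: "b0 \<in> Hom T C Y'" "\<beta>2 = v' \<cdot> b0" using exact_lift2[OF E' o(2)] by metis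
    \<comment> \<open>The error of \<open>b0\<close> as a retraction of \<open>c'\<close> is killed
      by \<open>v'\<close>, hence is \<open>u' \<cdot> e\<close>; subtracting it by means of
      \<open>r\<close> leaves \<open>v' \<cdot> b\<close> unchanged.\<close>
    let ?d = "b0 \<cdot> c' \<^bold>+ neg T (Ident T Y')"
    have "v' \<cdot> ?d = Zero T Y' Z'" using b0 o(4) by (simp add: Hom_iff)
    then obtain e where e: "e \<in> Hom T Y' X'" "?d = u' \<cdot> e"
      using exact_lift[OF E', of ?d Y'] b0 by (auto simp: Hom_iff)
    obtain r where r: "r \<in> Hom T C Y'" "r \<cdot> c' = Ident T Y'"
      using exact_Zero_retraction[OF Kc0] .
    define b where "b = b0 \<^bold>+ neg T (u' \<cdot> e \<cdot> r)"
    have b: "b \<in> Hom T C Y'" using b0 r e by (simp add: b_def Hom_iff)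
    have "b0 \<cdot> c' = Ident T Y' \<^bold>+ u' \<cdot> e"
      using b0(1) by - (rule diff_eqI[OF _ _ e(2), of Y' Y'], simp_all add: Hom_iff)
    then have bc: "b \<cdot> c' = Ident T Y'"
      using b0(1) r e(1) by (simp add: b_def Hom_iff)
    have "v' \<cdot> b = \<beta>2"
      using b0 r e comp_eq[OF exact_comp_Zero(1)[OF E'], of "e \<cdot> r"] by (simp add: b_def Hom_iff)
    then have "h = v' \<cdot> b \<cdot> \<alpha>1" using o(1,6) b comp_eq[of v' b \<beta>2 \<alpha>1] by (simp add: Hom_iff)
    moreover have "b \<cdot> \<alpha>1 \<cdot> v = g"
      using o(1,3) b comp_eq[OF bc, of g] by (simp add: Hom_iff)
    ultimately show ?thesis using b o(1) by blast
  qed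
  have "\<exists>\<theta> \<in> Hom T Z X'. g = u' \<cdot> \<theta> \<cdot> v" if V: "?V (Zero T Z Z')"
  proof -
    obtain b \<alpha>1 where ab: "b \<in> Hom T C Y'" "\<alpha>1 \<in> Hom T Z C" "Zero T Z Z' = v' \<cdot> b \<cdot> \<alpha>1" "b \<cdot> \<alpha>1 \<cdot> v = g"
      using core[OF V] by blast
    then obtain \<theta> where \<theta>: "\<theta> \<in> Hom T Z X'" "b \<cdot> \<alpha>1 = u' \<cdot> \<theta>"
      using exact_lift[OF E' Comp_Hom[OF ab(2,1)]] by metis
    then have "g = u' \<cdot> \<theta> \<cdot> v" using ab comp_eq_comp[OF \<theta>(2), of v] by (simp add: Hom_iff)
    then show ?thesis using \<theta>(1) by blast
  qed
  moreover have "?V (Zero T Z Z')" if \<theta>: "\<theta> \<in> Hom T Z X'" "g = u' \<cdot> \<theta> \<cdot> v" for \<theta>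
  proof -
    have "g \<cdot> u = u' \<cdot> Zero T X X'" using gu by simp
    then obtain h where h: "h \<in> Hom T Z Z'" "?V h"
      using verdier_good_exists[OF E E' Kf Kg Kc] by blast
    obtain b \<alpha>1 where ab: "b \<in> Hom T C Y'" "\<alpha>1 \<in> Hom T Z C" "h = v' \<cdot> b \<cdot> \<alpha>1" "b \<cdot> \<alpha>1 \<cdot> v = g"
      using core[OF h(2)] by blast
    \<comment> \<open>Both \<open>b \<cdot> \<alpha>1\<close> and \<open>u' \<cdot> \<theta>\<close>
      extend \<open>g\<close> along \<open>v\<close>, so they differ by some
      \<open>d \<cdot> w\<close>; since \<open>v' \<cdot> u'\<close> is zero, \<open>h\<close>
      equals \<open>v' \<cdot> d \<cdot> w\<close>.\<close>
    let ?d = "b \<cdot> \<alpha>1 \<^bold>+ neg T (u' \<cdot> \<theta>)"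
    have "?d \<cdot> v = Zero T Y Y'" using \<theta> ab by (simp add: Hom_iff)
    then obtain d where d: "d \<in> Hom T (SigmaO T X) Y'" "?d = d \<cdot> w"
      using exact_extend2[OF E, of ?d Y'] \<theta> ab by (auto simp: Hom_iff)
    have "v' \<cdot> d \<cdot> w = v' \<cdot> ?d" using d(1) by (simp add: d(2) Hom_iff)
    then have "h = Zero T Z Z' \<^bold>+ v' \<cdot> d \<cdot> w"
      using ab \<theta> comp_eq[OF exact_comp_Zero(1)[OF E'], of \<theta>] by (simp add: Hom_iff)
    then show ?thesis
      using h(2) d(1)
      by - (rule verdier_good_diff_lightning[OF E E' Kf Kg Kc, where \<zeta> = d], simp_all add: Hom_iff)
  qed
  ultimately show ?thesis using lightning_iff_flash[OF E' exact_Hom(2)[OF E], of g] by blast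
qed

end

section \<open>Biproducts and direct sums of triangles\<close>

context additive_category
begin

text \<open>Stated for an arbitrary diagram rather than for the chosen \<open>Biprod\<close>,
  because suspended biproducts, sums with a zero object and biproducts with a sheared injection must
  be treated alike.\<close>

definition biproduct :: "'o \<Rightarrow> 'o \<Rightarrow> 'o \<Rightarrow> 'm \<Rightarrow> 'm \<Rightarrow> 'm \<Rightarrow> 'm \<Rightarrow> bool" where
  "biproduct P A B i1 i2 p1 p2 \<longleftrightarrow>
     i1 \<in> Hom C A P \<and> i2 \<in> Hom C B P \<and> p1 \<in> Hom C P A \<and> p2 \<in> Hom C P B \<and>
     p1 \<cdot> i1 = Ident C A \<and> p2 \<cdot> i2 = Ident C B \<and> p1 \<cdot> i2 = Zero C B A \<and> p2 \<cdot> i1 = Zero C A B \<and>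
     i1 \<cdot> p1 \<^bold>+ i2 \<cdot> p2 = Ident C P"

lemma biproduct_arr:
  assumes "biproduct P A B i1 i2 p1 p2"
  shows "i1 \<in> Arr C" "Dom C i1 = A" "Cod C i1 = P" "i2 \<in> Arr C" "Dom C i2 = B" "Cod C i2 = P"
    "p1 \<in> Arr C" "Dom C p1 = P" "Cod C p1 = A" "p2 \<in> Arr C" "Dom C p2 = P" "Cod C p2 = B"
    "A \<in> Ob C" "B \<in> Ob C" "P \<in> Ob C"
  using assms unfolding biproduct_def by (auto simp: Hom_iff Dom_Ob Cod_Ob)

lemma biproduct_eqs:
  assumes "biproduct P A B i1 i2 p1 p2"
  shows "p1 \<cdot> i1 = Ident C A" "p2 \<cdot> i2 = Ident C B" "p1 \<cdot> i2 = Zero C B A" "p2 \<cdot> i1 = Zero C A B"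
    and "x \<in> Arr C \<Longrightarrow> Cod C x = A \<Longrightarrow> p1 \<cdot> i1 \<cdot> x = x"
    and "y \<in> Arr C \<Longrightarrow> Cod C y = B \<Longrightarrow> p2 \<cdot> i2 \<cdot> y = y"
    and "y \<in> Arr C \<Longrightarrow> Cod C y = B \<Longrightarrow> p1 \<cdot> i2 \<cdot> y = Zero C (Dom C y) A"
    and "x \<in> Arr C \<Longrightarrow> Cod C x = A \<Longrightarrow> p2 \<cdot> i1 \<cdot> x = Zero C (Dom C x) B"
proof -
  show *: "p1 \<cdot> i1 = Ident C A" "p2 \<cdot> i2 = Ident C B" "p1 \<cdot> i2 = Zero C B A" "p2 \<cdot> i1 = Zero C A B"
    using assms by (simp_all add: biproduct_def)
  note [simp] = biproduct_arr[OF assms]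
  show "x \<in> Arr C \<Longrightarrow> Cod C x = A \<Longrightarrow> p1 \<cdot> i1 \<cdot> x = x"
    and "y \<in> Arr C \<Longrightarrow> Cod C y = B \<Longrightarrow> p2 \<cdot> i2 \<cdot> y = y"
    and "y \<in> Arr C \<Longrightarrow> Cod C y = B \<Longrightarrow> p1 \<cdot> i2 \<cdot> y = Zero C (Dom C y) A"
    and "x \<in> Arr C \<Longrightarrow> Cod C x = A \<Longrightarrow> p2 \<cdot> i1 \<cdot> x = Zero C (Dom C x) B"
    using comp_eq[OF *(1), of x] comp_eq[OF *(2), of y] comp_eq[OF *(3), of y] comp_eq[OF *(4), of x]
    by simp_all
qed

lemma biproduct_eq_from:
  assumes B: "biproduct P A B i1 i2 p1 p2" and xy: "x \<in> Hom C P W" "y \<in> Hom C P W"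
    and eq: "x \<cdot> i1 = y \<cdot> i1" "x \<cdot> i2 = y \<cdot> i2"
  shows "x = y"
proof -
  note [simp] = biproduct_arr[OF B]
  have id: "i1 \<cdot> p1 \<^bold>+ i2 \<cdot> p2 = Ident C P" using B by (simp add: biproduct_def)
  have "x = x \<cdot> (i1 \<cdot> p1 \<^bold>+ i2 \<cdot> p2)" using xy by (simp add: id Hom_iff)
  also have "\<dots> = x \<cdot> i1 \<cdot> p1 \<^bold>+ x \<cdot> i2 \<cdot> p2" using xy by (simp add: Hom_iff)
  also have "x \<cdot> i1 \<cdot> p1 = y \<cdot> i1 \<cdot> p1" using xy by - (rule comp_eq_comp[OF eq(1)], simp_all add: Hom_iff)
  also have "x \<cdot> i2 \<cdot> p2 = y \<cdot> i2 \<cdot> p2" using xy by - (rule comp_eq_comp[OF eq(2)], simp_all add: Hom_iff)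
  also have "y \<cdot> i1 \<cdot> p1 \<^bold>+ y \<cdot> i2 \<cdot> p2 = y \<cdot> (i1 \<cdot> p1 \<^bold>+ i2 \<cdot> p2)" using xy by (simp add: Hom_iff)
  also have "\<dots> = y" using xy by (simp add: id Hom_iff)
  finally show ?thesis .
qed

lemma biproduct_decompose:
  assumes B: "biproduct P A B i1 i2 p1 p2" and x: "x \<in> Hom C W P"
  shows "x = i1 \<cdot> p1 \<cdot> x \<^bold>+ i2 \<cdot> p2 \<cdot> x"
proof -
  note [simp] = biproduct_arr[OF B]
  have id: "i1 \<cdot> p1 \<^bold>+ i2 \<cdot> p2 = Ident C P" using B by (simp add: biproduct_def)
  have "x = (i1 \<cdot> p1 \<^bold>+ i2 \<cdot> p2) \<cdot> x" using x by (simp add: id Hom_iff)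
  then show ?thesis using x by (simp add: Hom_iff)
qed

lemma biproduct_map_proj:
  assumes B: "biproduct P A1 A2 i1 i2 p1 p2" and B': "biproduct Q B1 B2 j1 j2 q1 q2"
    and u: "u \<in> Hom C P Q" and u1: "u1 \<in> Hom C A1 B1" "u \<cdot> i1 = j1 \<cdot> u1"
    and u2: "u2 \<in> Hom C A2 B2" "u \<cdot> i2 = j2 \<cdot> u2"
  shows "q1 \<cdot> u = u1 \<cdot> p1" and "q2 \<cdot> u = u2 \<cdot> p2"
proof -
  note [simp] = biproduct_arr[OF B] biproduct_arr[OF B'] biproduct_eqs[OF B] biproduct_eqs[OF B']
  show "q1 \<cdot> u = u1 \<cdot> p1" "q2 \<cdot> u = u2 \<cdot> p2"
    using u u1(1) u2(1)
    by - (rule biproduct_eq_from[OF B], simp_all add: Hom_iff u1(2) u2(2))+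
qed

lemma Biprod_arr [simp]:
  assumes "A \<in> Ob C" "B \<in> Ob C"
  shows "Biprod C A B \<in> Ob C"
    "In1 C A B \<in> Arr C" "Dom C (In1 C A B) = A" "Cod C (In1 C A B) = Biprod C A B"
    "In2 C A B \<in> Arr C" "Dom C (In2 C A B) = B" "Cod C (In2 C A B) = Biprod C A B"
    "Pr1 C A B \<in> Arr C" "Dom C (Pr1 C A B) = Biprod C A B" "Cod C (Pr1 C A B) = A"
    "Pr2 C A B \<in> Arr C" "Dom C (Pr2 C A B) = Biprod C A B" "Cod C (Pr2 C A B) = B"
  using In1_Hom[OF assms] In2_Hom[OF assms] Pr1_Hom[OF assms] Pr2_Hom[OF assms] assms Biprod_Ob
  by (simp_all add: Hom_iff)

lemma biproduct_Biprod:
  assumes "A \<in> Ob C" "B \<in> Ob C"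
  shows "biproduct (Biprod C A B) A B (In1 C A B) (In2 C A B) (Pr1 C A B) (Pr2 C A B)"
  using assms
  by (simp add: biproduct_def Hom_iff Pr1_In1 Pr2_In2 Pr1_In2 Pr2_In1 In_Pr_sum)

lemmas Biprod_eqs [simp] = biproduct_eqs[OF biproduct_Biprod]
lemmas Biprod_eq_from = biproduct_eq_from[OF biproduct_Biprod]

section \<open>Block matrices and shears\<close>

lemma block_matrix_arr [simp]:
  assumes "a \<in> Arr C" "b \<in> Arr C" "c \<in> Arr C" "d \<in> Arr C"
    "Dom C c = Dom C a" "Dom C d = Dom C b" "Cod C b = Cod C a" "Cod C d = Cod C c"
  shows "block_matrix C a b c d \<in> Arr C"
    "Dom C (block_matrix C a b c d) = Biprod C (Dom C a) (Dom C b)"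
    "Cod C (block_matrix C a b c d) = Biprod C (Cod C a) (Cod C c)"
  using assms by (simp_all add: block_matrix_def Let_def Dom_Ob Cod_Ob)

lemma block_matrix_In [simp]:
  assumes "a \<in> Arr C" "b \<in> Arr C" "c \<in> Arr C" "d \<in> Arr C"
    "Dom C a = A" "Dom C c = A" "Dom C b = B" "Dom C d = B"
    "Cod C b = Cod C a" "Cod C d = Cod C c"
  shows "block_matrix C a b c d \<cdot> In1 C A B = In1 C (Cod C a) (Cod C c) \<cdot> a \<^bold>+ In2 C (Cod C a) (Cod C c) \<cdot> c"
    and "block_matrix C a b c d \<cdot> In2 C A B = In1 C (Cod C a) (Cod C c) \<cdot> b \<^bold>+ In2 C (Cod C a) (Cod C c) \<cdot> d"
    and "x \<in> Arr C \<Longrightarrow> Cod C x = A \<Longrightarrow> block_matrix C a b c d \<cdot> In1 C A B \<cdot> x =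
      In1 C (Cod C a) (Cod C c) \<cdot> a \<cdot> x \<^bold>+ In2 C (Cod C a) (Cod C c) \<cdot> c \<cdot> x"
    and "y \<in> Arr C \<Longrightarrow> Cod C y = B \<Longrightarrow> block_matrix C a b c d \<cdot> In2 C A B \<cdot> y =
      In1 C (Cod C a) (Cod C c) \<cdot> b \<cdot> y \<^bold>+ In2 C (Cod C a) (Cod C c) \<cdot> d \<cdot> y"
proof -
  have [simp]: "A \<in> Ob C" "B \<in> Ob C" using assms Dom_Ob by blast+
  show "block_matrix C a b c d \<cdot> In1 C A B = In1 C (Cod C a) (Cod C c) \<cdot> a \<^bold>+ In2 C (Cod C a) (Cod C c) \<cdot> c"
    and "block_matrix C a b c d \<cdot> In2 C A B = In1 C (Cod C a) (Cod C c) \<cdot> b \<^bold>+ In2 C (Cod C a) (Cod C c) \<cdot> d"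
    and "x \<in> Arr C \<Longrightarrow> Cod C x = A \<Longrightarrow> block_matrix C a b c d \<cdot> In1 C A B \<cdot> x =
      In1 C (Cod C a) (Cod C c) \<cdot> a \<cdot> x \<^bold>+ In2 C (Cod C a) (Cod C c) \<cdot> c \<cdot> x"
    and "y \<in> Arr C \<Longrightarrow> Cod C y = B \<Longrightarrow> block_matrix C a b c d \<cdot> In2 C A B \<cdot> y =
      In1 C (Cod C a) (Cod C c) \<cdot> b \<cdot> y \<^bold>+ In2 C (Cod C a) (Cod C c) \<cdot> d \<cdot> y"
    using assms by (simp_all add: block_matrix_def Let_def Dom_Ob Cod_Ob)
qed

definition shear :: "'o \<Rightarrow> 'o \<Rightarrow> 'm \<Rightarrow> 'm" where
  "shear A B b = block_matrix C (Ident C A) b (Zero C A B) (Ident C B)"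

lemma shear_arr [simp]:
  assumes "b \<in> Arr C" "Dom C b = B" "Cod C b = A"
  shows "shear A B b \<in> Arr C" "Dom C (shear A B b) = Biprod C A B"
    "Cod C (shear A B b) = Biprod C A B"
proof -
  have "A \<in> Ob C" "B \<in> Ob C" using assms Dom_Ob Cod_Ob by blast+
  then show "shear A B b \<in> Arr C" "Dom C (shear A B b) = Biprod C A B"
    "Cod C (shear A B b) = Biprod C A B"
    using assms by (simp_all add: shear_def)
qed

lemma shear_In [simp]:
  assumes "b \<in> Arr C" "Dom C b = B" "Cod C b = A"
  shows "shear A B b \<cdot> In1 C A B = In1 C A B"
    and "shear A B b \<cdot> In2 C A B = In1 C A B \<cdot> b \<^bold>+ In2 C A B"
    and "x \<in> Arr C \<Longrightarrow> Cod C x = A \<Longrightarrow> shear A B b \<cdot> In1 C A B \<cdot> x = In1 C A B \<cdot> x"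
    and "y \<in> Arr C \<Longrightarrow> Cod C y = B \<Longrightarrow>
      shear A B b \<cdot> In2 C A B \<cdot> y = In1 C A B \<cdot> b \<cdot> y \<^bold>+ In2 C A B \<cdot> y"
proof -
  have "A \<in> Ob C" "B \<in> Ob C" using assms Dom_Ob Cod_Ob by blast+
  then show "shear A B b \<cdot> In1 C A B = In1 C A B"
    and "shear A B b \<cdot> In2 C A B = In1 C A B \<cdot> b \<^bold>+ In2 C A B"
    and "x \<in> Arr C \<Longrightarrow> Cod C x = A \<Longrightarrow> shear A B b \<cdot> In1 C A B \<cdot> x = In1 C A B \<cdot> x"
    and "y \<in> Arr C \<Longrightarrow> Cod C y = B \<Longrightarrow>
      shear A B b \<cdot> In2 C A B \<cdot> y = In1 C A B \<cdot> b \<cdot> y \<^bold>+ In2 C A B \<cdot> y"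
    using assms by (simp_all add: shear_def Dom_Ob)
qed

text \<open>Off-diagonal entries add under composition, so negating the entry gives the
  inverse.\<close>

lemma is_iso_shear:
  assumes "b \<in> Hom C B A"
  shows "is_iso C (shear A B b)"
proof -
  have Ob: "A \<in> Ob C" "B \<in> Ob C" using Hom_Ob[OF assms] by blast+
  have "shear A B (neg C b) \<cdot> shear A B b = Ident C (Biprod C A B)"
    "shear A B b \<cdot> shear A B (neg C b) = Ident C (Biprod C A B)"
    using assms Ob by - (rule Biprod_eq_from[OF Ob], simp_all add: Hom_iff)+
  then show ?thesis
    using assms by (intro is_isoI[of _ "Biprod C A B" "Biprod C A B" "shear A B (neg C b)"])
      (simp_all add: Hom_iff)
qed

end

section \<open>Direct sums of exact triangles\<close>

context triangulated_category
begin

lemma biproduct_Sigma: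
  assumes "biproduct P A B i1 i2 p1 p2"
  shows "biproduct (SigmaO T P) (SigmaO T A) (SigmaO T B) (SigmaA T i1) (SigmaA T i2)
    (SigmaA T p1) (SigmaA T p2)"
proof -
  note [simp] = biproduct_arr[OF assms]
  have "SigmaA T (i1 \<cdot> p1 \<^bold>+ i2 \<cdot> p2) = Ident T (SigmaO T P)"
    using assms unfolding biproduct_def by (simp del: Sigma_Plus)
  moreover have "SigmaA T p1 \<cdot> SigmaA T i1 = SigmaA T (p1 \<cdot> i1)" "SigmaA T p2 \<cdot> SigmaA T i2 = SigmaA T (p2 \<cdot> i2)"
    "SigmaA T p1 \<cdot> SigmaA T i2 = SigmaA T (p1 \<cdot> i2)" "SigmaA T p2 \<cdot> SigmaA T i1 = SigmaA T (p2 \<cdot> i1)"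
    by simp_all
  ultimately show ?thesis
    unfolding biproduct_def using biproduct_eqs[OF assms] by (simp add: Hom_iff del: Sigma_comp) simp
qed

text \<open>Fill-ins from the two summands to a cone of \<open>u\<close> assemble to a comparison
  map. The five lemma applies because the Hom sequence of the sum can be checked one summand at a
  time.\<close>

lemma exact_direct_sum:
  assumes E1: "exact_triangle T X1 Y1 Z1 (u1, v1, w1)" and E2: "exact_triangle T X2 Y2 Z2 (u2, v2, w2)"
    and BX: "biproduct X X1 X2 i1 i2 p1 p2" and BY: "biproduct Y Y1 Y2 j1 j2 q1 q2"
    and BZ: "biproduct Z Z1 Z2 k1 k2 r1 r2"
    and u: "u \<in> Hom T X Y" "u \<cdot> i1 = j1 \<cdot> u1" "u \<cdot> i2 = j2 \<cdot> u2"
    and v: "v \<in> Hom T Y Z" "v \<cdot> j1 = k1 \<cdot> v1" "v \<cdot> j2 = k2 \<cdot> v2"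
    and w: "w \<in> Hom T Z (SigmaO T X)" "w \<cdot> k1 = SigmaA T i1 \<cdot> w1" "w \<cdot> k2 = SigmaA T i2 \<cdot> w2"
  shows "exact_triangle T X Y Z (u, v, w)"
proof -
  note BSX = biproduct_Sigma[OF BX] and BSY = biproduct_Sigma[OF BY]
  note [simp] = exact_arr[OF E1] exact_Ob[OF E1] exact_arr[OF E2] exact_Ob[OF E2]
    biproduct_arr[OF BX] biproduct_arr[OF BY] biproduct_arr[OF BZ]
    biproduct_eqs[OF BX] biproduct_eqs[OF BY] biproduct_eqs[OF BZ]
    biproduct_eqs[OF BSX] biproduct_eqs[OF BSY]
    exact_comp_Zero[OF E1] exact_comp_Zero[OF E2]
  note H1 = exact_Hom[OF E1] and H2 = exact_Hom[OF E2]
  have [simp]: "u \<in> Arr T" "Dom T u = X" "Cod T u = Y" "v \<in> Arr T" "Dom T v = Y" "Cod T v = Z"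
    "w \<in> Arr T" "Dom T w = Z" "Cod T w = SigmaO T X"
    using u v w by (simp_all add: Hom_iff)
  have uS: "SigmaA T u \<cdot> SigmaA T i1 = SigmaA T j1 \<cdot> SigmaA T u1"
    "SigmaA T u \<cdot> SigmaA T i2 = SigmaA T j2 \<cdot> SigmaA T u2"
    using arg_cong[OF u(2), of "SigmaA T"] arg_cong[OF u(3), of "SigmaA T"] by simp_all
  note pv = biproduct_map_proj[OF BY BZ v(1) H1(2) v(2) H2(2) v(3)]
  note pw = biproduct_map_proj[OF BZ BSX w(1) H1(3) w(2) H2(3) w(3)]
  note pu = biproduct_map_proj[OF BSX BSY Sigma_Hom[OF u(1)] Sigma_Hom[OF H1(1)] uS(1) Sigma_Hom[OF H2(1)] uS(2)]
  obtain Z0 v0 w0 where E0: "exact_triangle T X Y Z0 (u, v0, w0)" using exact_exists[OF u(1)] .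
  note [simp] = exact_arr[OF E0] exact_Ob[OF E0]
  obtain h1 where h1: "h1 \<in> Hom T Z1 Z0" "h1 \<cdot> v1 = v0 \<cdot> j1" "SigmaA T i1 \<cdot> w1 = w0 \<cdot> h1"
    using exact_fill3[OF E1 E0, of i1 j1] u(2) by (auto simp: Hom_iff)
  obtain h2 where h2: "h2 \<in> Hom T Z2 Z0" "h2 \<cdot> v2 = v0 \<cdot> j2" "SigmaA T i2 \<cdot> w2 = w0 \<cdot> h2"
    using exact_fill3[OF E2 E0, of i2 j2] u(3) by (auto simp: Hom_iff)
  define h where "h = h1 \<cdot> r1 \<^bold>+ h2 \<cdot> r2"
  have h: "h \<in> Hom T Z Z0" "h \<cdot> k1 = h1" "h \<cdot> k2 = h2"
    using h1(1) h2(1) by (simp_all add: h_def Hom_iff)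
  have "h \<cdot> v = v0"
    using h(1) h1(1,2) h2(1,2) comp_eq[OF h(2), of v1] comp_eq[OF h(3), of v2]
    by - (rule biproduct_eq_from[OF BY], simp_all add: Hom_iff v(2,3))
  moreover have "w0 \<cdot> h = w"
    using h(1) h1(1) h2(1)
    by - (rule biproduct_eq_from[OF BZ], simp_all add: Hom_iff w(2,3) h(2,3) h1(3) h2(3))
  moreover have "v \<cdot> u = Zero T X Z"
    using comp_eq[OF v(2), of u1] comp_eq[OF v(3), of u2]
    by - (rule biproduct_eq_from[OF BX], simp_all add: Hom_iff u(2,3))
  moreover have "\<exists>y \<in> Hom T W Y. x = v \<cdot> y"
    if x: "x \<in> Hom T W Z" "w \<cdot> x = Zero T W (SigmaO T X)" for W x
  proof -
    note [simp] = Hom_Ob(1)[OF x(1)]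
    have [simp]: "x \<in> Arr T" "Dom T x = W" "Cod T x = Z" using x(1) by (simp_all add: Hom_iff)
    \<comment> \<open>Each component of \<open>x\<close> is killed by the third map of its summand;
      the two lifts are recombined by \<open>biproduct_decompose\<close>.\<close>
    have "w1 \<cdot> r1 \<cdot> x = SigmaA T p1 \<cdot> w \<cdot> x" "w2 \<cdot> r2 \<cdot> x = SigmaA T p2 \<cdot> w \<cdot> x"
      using comp_eq_comp[OF pw(1), of x] comp_eq_comp[OF pw(2), of x] by simp_all
    then have "w1 \<cdot> r1 \<cdot> x = Zero T W (SigmaO T X1)" "w2 \<cdot> r2 \<cdot> x = Zero T W (SigmaO T X2)"
      using x(2) by simp_all
    moreover have "r1 \<cdot> x \<in> Hom T W Z1" "r2 \<cdot> x \<in> Hom T W Z2" by (simp_all add: Hom_iff)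
    ultimately obtain y1 y2 where y: "y1 \<in> Hom T W Y1" "r1 \<cdot> x = v1 \<cdot> y1" "y2 \<in> Hom T W Y2" "r2 \<cdot> x = v2 \<cdot> y2"
      by (meson exact_lift2[OF E1] exact_lift2[OF E2])
    have "x = k1 \<cdot> v1 \<cdot> y1 \<^bold>+ k2 \<cdot> v2 \<cdot> y2"
      using biproduct_decompose[OF BZ x(1)] y by simp
    also have "\<dots> = v \<cdot> (j1 \<cdot> y1 \<^bold>+ j2 \<cdot> y2)"
      using y comp_eq_comp[OF v(2), of y1] comp_eq_comp[OF v(3), of y2] by (simp add: Hom_iff)
    finally show ?thesis using y by (intro bexI[of _ "j1 \<cdot> y1 \<^bold>+ j2 \<cdot> y2"]) (simp_all add: Hom_iff)
  qed
  moreover have "\<exists>z \<in> Hom T W Z. x = w \<cdot> z"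
    if x: "x \<in> Hom T W (SigmaO T X)" "SigmaA T u \<cdot> x = Zero T W (SigmaO T Y)" for W x
  proof -
    note [simp] = Hom_Ob(1)[OF x(1)]
    have [simp]: "x \<in> Arr T" "Dom T x = W" "Cod T x = SigmaO T X" using x(1) by (simp_all add: Hom_iff)
    have "SigmaA T u1 \<cdot> SigmaA T p1 \<cdot> x = SigmaA T q1 \<cdot> SigmaA T u \<cdot> x"
      "SigmaA T u2 \<cdot> SigmaA T p2 \<cdot> x = SigmaA T q2 \<cdot> SigmaA T u \<cdot> x"
      using comp_eq_comp[OF pu(1), of x] comp_eq_comp[OF pu(2), of x] by simp_all
    then have "SigmaA T u1 \<cdot> SigmaA T p1 \<cdot> x = Zero T W (SigmaO T Y1)"
      "SigmaA T u2 \<cdot> SigmaA T p2 \<cdot> x = Zero T W (SigmaO T Y2)"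
      using x(2) by simp_all
    moreover have "SigmaA T p1 \<cdot> x \<in> Hom T W (SigmaO T X1)" "SigmaA T p2 \<cdot> x \<in> Hom T W (SigmaO T X2)"
      by (simp_all add: Hom_iff)
    ultimately obtain z1 z2 where z: "z1 \<in> Hom T W Z1" "SigmaA T p1 \<cdot> x = w1 \<cdot> z1"
        "z2 \<in> Hom T W Z2" "SigmaA T p2 \<cdot> x = w2 \<cdot> z2"
      by (meson exact_lift3[OF E1] exact_lift3[OF E2])
    have "x = SigmaA T i1 \<cdot> w1 \<cdot> z1 \<^bold>+ SigmaA T i2 \<cdot> w2 \<cdot> z2"
      using biproduct_decompose[OF BSX x(1)] z by simp
    also have "\<dots> = w \<cdot> (k1 \<cdot> z1 \<^bold>+ k2 \<cdot> z2)"
      using z comp_eq_comp[OF w(2), of z1] comp_eq_comp[OF w(3), of z2] by (simp add: Hom_iff)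
    finally show ?thesis using z by (intro bexI[of _ "k1 \<cdot> z1 \<^bold>+ k2 \<cdot> z2"]) (simp_all add: Hom_iff)
  qed
  ultimately show ?thesis
    by (rule exact_if_hom_exact(2)[OF E0 v(1) w(1) h(1)])
qed

lemma Sigma_Sum_arr [simp]:
  assumes "A \<in> Ob T" "B \<in> Ob T"
  shows "Sigma_Sum T A B \<in> Arr T" "Dom T (Sigma_Sum T A B) = Biprod T (SigmaO T A) (SigmaO T B)"
    "Cod T (Sigma_Sum T A B) = SigmaO T (Biprod T A B)"
  using assms by (simp_all add: Sigma_Sum_def)

lemma Sigma_Sum_In [simp]:
  assumes "A \<in> Ob T" "B \<in> Ob T"
  shows "Sigma_Sum T A B \<cdot> In1 T (SigmaO T A) (SigmaO T B) = SigmaA T (In1 T A B)"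
    and "Sigma_Sum T A B \<cdot> In2 T (SigmaO T A) (SigmaO T B) = SigmaA T (In2 T A B)"
    and "x \<in> Arr T \<Longrightarrow> Cod T x = SigmaO T A \<Longrightarrow>
      Sigma_Sum T A B \<cdot> In1 T (SigmaO T A) (SigmaO T B) \<cdot> x = SigmaA T (In1 T A B) \<cdot> x"
    and "y \<in> Arr T \<Longrightarrow> Cod T y = SigmaO T B \<Longrightarrow>
      Sigma_Sum T A B \<cdot> In2 T (SigmaO T A) (SigmaO T B) \<cdot> y = SigmaA T (In2 T A B) \<cdot> y"
  using assms by (simp_all add: Sigma_Sum_def Dom_Ob)

end

section \<open>Good maps\<close>

text \<open>The locale is later instantiated with the rotated triangles, which transfers results
  from one shape of maps to the next.\<close>

locale triangle_pair = triangulated_category T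
  for T :: "('o, 'm, 'z) triang_cat_scheme" (structure) +
  fixes X Y Z X' Y' Z' :: 'o and u v w u' v' w' :: 'm
  assumes E: "exact_triangle T X Y Z (u, v, w)"
    and E': "exact_triangle T X' Y' Z' (u', v', w')"
begin

lemmas [simp] = exact_arr[OF E] exact_Ob[OF E] exact_arr[OF E'] exact_Ob[OF E']

text \<open>Each map of the mapping cone depends on a single component of the triangle map, so
  replacing one component changes just one of \<open>cone1\<close>, \<open>cone2\<close> and
  \<open>cone3\<close>.\<close>

definition cone1 where "cone1 g = block_matrix T u' g (Zero T X' Z) (neg T v)"
definition cone2 where "cone2 h = block_matrix T v' h (Zero T Y' (SigmaO T X)) (neg T w)"
definition cone3 where
  "cone3 f = Sigma_Sum T X' Y \<cdot>
     block_matrix T w' (SigmaA T f) (Zero T Z' (SigmaO T Y)) (neg T (SigmaA T u))"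

lemma mapping_cone_eq:
  "mapping_cone T (u, v, w) (u', v', w') (f, g, h) = (cone1 g, cone2 h, cone3 f)"
  by (simp add: mapping_cone_def cone1_def cone2_def cone3_def)

lemma cone1 [simp]:
  assumes "g \<in> Hom T Y Y'"
  shows "cone1 g \<in> Arr T" "Dom T (cone1 g) = Biprod T X' Y" "Cod T (cone1 g) = Biprod T Y' Z"
    "cone1 g \<cdot> In1 T X' Y = In1 T Y' Z \<cdot> u'"
    "cone1 g \<cdot> In2 T X' Y = In1 T Y' Z \<cdot> g \<^bold>+ neg T (In2 T Y' Z \<cdot> v)"
    "x \<in> Arr T \<Longrightarrow> Cod T x = X' \<Longrightarrow> cone1 g \<cdot> In1 T X' Y \<cdot> x = In1 T Y' Z \<cdot> u' \<cdot> x"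
  using assms by (simp_all add: cone1_def Hom_iff Dom_Ob)

lemma cone2 [simp]:
  assumes "h \<in> Hom T Z Z'"
  shows "cone2 h \<in> Arr T" "Dom T (cone2 h) = Biprod T Y' Z" "Cod T (cone2 h) = Biprod T Z' (SigmaO T X)"
    "cone2 h \<cdot> In1 T Y' Z = In1 T Z' (SigmaO T X) \<cdot> v'"
    "cone2 h \<cdot> In2 T Y' Z = In1 T Z' (SigmaO T X) \<cdot> h \<^bold>+ neg T (In2 T Z' (SigmaO T X) \<cdot> w)"
    "x \<in> Arr T \<Longrightarrow> Cod T x = Y' \<Longrightarrow> cone2 h \<cdot> In1 T Y' Z \<cdot> x = In1 T Z' (SigmaO T X) \<cdot> v' \<cdot> x"
  using assms by (simp_all add: cone2_def Hom_iff Dom_Ob)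

lemma cone3 [simp]:
  assumes "f \<in> Hom T X X'"
  shows "cone3 f \<in> Arr T" "Dom T (cone3 f) = Biprod T Z' (SigmaO T X)"
    "Cod T (cone3 f) = SigmaO T (Biprod T X' Y)"
    "cone3 f \<cdot> In1 T Z' (SigmaO T X) = SigmaA T (In1 T X' Y) \<cdot> w'"
    "cone3 f \<cdot> In2 T Z' (SigmaO T X) =
       SigmaA T (In1 T X' Y) \<cdot> SigmaA T f \<^bold>+ neg T (SigmaA T (In2 T X' Y) \<cdot> SigmaA T u)"
    "x \<in> Arr T \<Longrightarrow> Cod T x = Z' \<Longrightarrow>
       cone3 f \<cdot> In1 T Z' (SigmaO T X) \<cdot> x = SigmaA T (In1 T X' Y) \<cdot> w' \<cdot> x"
  using assms by (simp_all add: cone3_def Hom_iff Dom_Ob)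

lemmas [simp] = biproduct_eqs[OF biproduct_Sigma[OF biproduct_Biprod]]

lemma Zero_Homs [simp]:
  "Zero T X X' \<in> Hom T X X'" "Zero T Y Y' \<in> Hom T Y Y'" "Zero T Z Z' \<in> Hom T Z Z'"
  by (simp_all add: Hom_iff)

lemma good_iff:
  assumes "f \<in> Hom T X X'" "g \<in> Hom T Y Y'" "h \<in> Hom T Z Z'"
  shows "good T (u, v, w) (u', v', w') (f, g, h) \<longleftrightarrow>
    exact_triangle T (Biprod T X' Y) (Biprod T Y' Z) (Biprod T Z' (SigmaO T X)) (cone1 g, cone2 h, cone3 f)"
  using assms cone1(1-3)[of g] cone2(1-3)[of h] cone3(1-3)[of f]
  by (simp add: good_def mapping_cone_eq exact_triangle_iff Hom_iff)

abbreviation "O1 \<equiv> Zero T X X'"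
abbreviation "O2 \<equiv> Zero T Y Y'"
abbreviation "O3 \<equiv> Zero T Z Z'"

text \<open>Without off-diagonal entries it is the sum of the second triangle and the rotated first
  one, whose two additional signs come from \<open>exact_neg12\<close>.\<close>

lemma exact_cone_Zero:
  "exact_triangle T (Biprod T X' Y) (Biprod T Y' Z) (Biprod T Z' (SigmaO T X)) (cone1 O2, cone2 O3, cone3 O1)"
  by (rule exact_direct_sum[OF E' exact_neg12[OF exact_rotate[OF E]] biproduct_Biprod biproduct_Biprod biproduct_Biprod])
    (simp_all, simp_all add: Hom_iff)

text \<open>First projections map the cone of the zero map onto the second triangle. Applied to an
  off-diagonal entry, this will show that \<open>n\<close> annihilates
  \<open>\<phi>\<close>.\<close>

lemma Pr1_cones:
  shows "Pr1 T Z' (SigmaO T X) \<cdot> cone2 O3 = v' \<cdot> Pr1 T Y' Z"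
    and "SigmaA T (Pr1 T X' Y) \<cdot> cone3 O1 = w' \<cdot> Pr1 T Z' (SigmaO T X)"
    and "Pr1 T Y' Z \<cdot> cone1 O2 = u' \<cdot> Pr1 T X' Y"
proof -
  show "Pr1 T Z' (SigmaO T X) \<cdot> cone2 O3 = v' \<cdot> Pr1 T Y' Z"
    by (rule Biprod_eq_from[of Y' Z]) (simp_all, simp_all add: Hom_iff)
  show "SigmaA T (Pr1 T X' Y) \<cdot> cone3 O1 = w' \<cdot> Pr1 T Z' (SigmaO T X)"
    by (rule Biprod_eq_from[of Z' "SigmaO T X"]) (simp_all, simp_all add: Hom_iff)
  show "Pr1 T Y' Z \<cdot> cone1 O2 = u' \<cdot> Pr1 T X' Y"
    by (rule Biprod_eq_from[of X' Y]) (simp_all, simp_all add: Hom_iff)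
qed

text \<open>\<open>h\<close> enters only \<open>cone2\<close>, so identities on the first two
  vertices are compatible and are completed at the third vertex.\<close>

lemma good_h_iff_flash:
  assumes h: "h \<in> Hom T Z Z'"
  shows "good T (u, v, w) (u', v', w') (O1, O2, h) \<longleftrightarrow> flash w' w h"
proof
  note [simp] = h
  note [simp] = h[unfolded Hom_iff]
  assume "good T (u, v, w) (u', v', w') (O1, O2, h)"
  then have G: "exact_triangle T (Biprod T X' Y) (Biprod T Y' Z) (Biprod T Z' (SigmaO T X))
    (cone1 O2, cone2 h, cone3 O1)" by (simp add: good_iff)
  obtain k where k: "k \<in> Hom T (Biprod T Z' (SigmaO T X)) (Biprod T Z' (SigmaO T X))"
    "k \<cdot> cone2 O3 = cone2 h" "cone3 O1 = cone3 O1 \<cdot> k"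
    using exact_fill3[OF exact_cone_Zero G, of "Ident T (Biprod T X' Y)" "Ident T (Biprod T Y' Z)"]
    by (auto simp: Hom_iff)
  have [simp]: "k \<in> Arr T" "Dom T k = Biprod T Z' (SigmaO T X)" "Cod T k = Biprod T Z' (SigmaO T X)"
    using k(1) by (simp_all add: Hom_iff)
  \<comment> \<open>The comparison need not be triangular; its entry from \<open>SigmaO T X\<close>
    to \<open>Z'\<close> suffices, with a sign that cancels the one on \<open>w\<close> in
    \<open>cone2\<close>.\<close>
  define \<phi> where "\<phi> = neg T (Pr1 T Z' (SigmaO T X) \<cdot> k \<cdot> In2 T Z' (SigmaO T X))"
  have [simp]: "\<phi> \<in> Arr T" "Dom T \<phi> = SigmaO T X" "Cod T \<phi> = Z'" by (simp_all add: \<phi>_def)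
  have "Pr1 T Z' (SigmaO T X) \<cdot> (k \<cdot> cone2 O3) \<cdot> In2 T Y' Z = \<phi> \<cdot> w"
    by (simp add: \<phi>_def)
  then have "h = \<phi> \<cdot> w" unfolding k(2) by simp
  moreover have "w' \<cdot> \<phi> = Zero T (SigmaO T X) (SigmaO T X')"
  proof -
    \<comment> \<open>\<open>cone3 O1\<close> is unchanged by composing with \<open>k\<close>, and
      its first row is zero on the second summand.\<close>
    have "w' \<cdot> Pr1 T Z' (SigmaO T X) \<cdot> k \<cdot> In2 T Z' (SigmaO T X) =
      SigmaA T (Pr1 T X' Y) \<cdot> cone3 O1 \<cdot> k \<cdot> In2 T Z' (SigmaO T X)"
      by (rule comp_eq_comp) (simp_all add: Pr1_cones)
    also have "\<dots> = SigmaA T (Pr1 T X' Y) \<cdot> (cone3 O1 \<cdot> k) \<cdot> In2 T Z' (SigmaO T X)" by simp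
    also have "\<dots> = Zero T (SigmaO T X) (SigmaO T X')" unfolding k(3)[symmetric] by simp
    finally show ?thesis by (simp add: \<phi>_def)
  qed
  ultimately show "flash w' w h"
    unfolding flash_def by (intro bexI[of _ \<phi>]) (simp_all add: Hom_iff)
next
  note [simp] = h
  note [simp] = h[unfolded Hom_iff]
  assume "flash w' w h"
  then obtain \<phi> where \<phi>: "\<phi> \<in> Hom T (SigmaO T X) Z'" "w' \<cdot> \<phi> = Zero T (SigmaO T X) (SigmaO T X')" "h = \<phi> \<cdot> w"
    by (auto simp: flash_def)
  note [simp] = \<phi>(1)[unfolded Hom_iff]
  have "exact_triangle T (Biprod T X' Y) (Biprod T Y' Z) (Biprod T Z' (SigmaO T X))
    (cone1 O2, cone2 h, cone3 O1)"
  proof (rule exact_iso[OF exact_cone_Zero, where f = "Ident T (Biprod T X' Y)"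
        and g = "Ident T (Biprod T Y' Z)" and h = "shear Z' (SigmaO T X) (neg T \<phi>)"])
    \<comment> \<open>On the second summand the entry \<open>-\<phi>\<close> meets
      \<open>-w\<close>, giving \<open>\<phi> \<cdot> w = h\<close>.\<close>
    show "shear Z' (SigmaO T X) (neg T \<phi>) \<cdot> cone2 O3 = cone2 h \<cdot> Ident T (Biprod T Y' Z)"
      by (rule Biprod_eq_from[of Y' Z], simp_all, simp_all add: Hom_iff \<phi>(3))
    show "SigmaA T (Ident T (Biprod T X' Y)) \<cdot> cone3 O1 = cone3 O1 \<cdot> shear Z' (SigmaO T X) (neg T \<phi>)"
      by (rule Biprod_eq_from[of Z' "SigmaO T X"], simp_all, simp_all add: Hom_iff \<phi>(2))
    show "is_iso T (shear Z' (SigmaO T X) (neg T \<phi>))" by (rule is_iso_shear) (simp add: Hom_iff)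
  qed (simp_all, simp_all add: Hom_iff)
  then show "good T (u, v, w) (u', v', w') (O1, O2, h)" by (simp add: good_iff)
qed

text \<open>\<open>g\<close> enters only \<open>cone1\<close>, so the comparison is the identity on
  the outer vertices and is filled in at the middle one.\<close>

lemma good_g_iff_flash:
  assumes g: "g \<in> Hom T Y Y'"
  shows "good T (u, v, w) (u', v', w') (O1, g, O3) \<longleftrightarrow> flash v' v g"
proof
  note [simp] = g
  note [simp] = g[unfolded Hom_iff]
  assume "good T (u, v, w) (u', v', w') (O1, g, O3)"
  then have G: "exact_triangle T (Biprod T X' Y) (Biprod T Y' Z) (Biprod T Z' (SigmaO T X))
    (cone1 g, cone2 O3, cone3 O1)" by (simp add: good_iff)
  obtain k where k: "k \<in> Hom T (Biprod T Y' Z) (Biprod T Y' Z)"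
    "k \<cdot> cone1 O2 = cone1 g" "cone2 O3 = cone2 O3 \<cdot> k"
    using exact_fill2[OF exact_cone_Zero G, of "Ident T (Biprod T X' Y)" "Ident T (Biprod T Z' (SigmaO T X))"]
    by (auto simp: Hom_iff)
  have [simp]: "k \<in> Arr T" "Dom T k = Biprod T Y' Z" "Cod T k = Biprod T Y' Z"
    using k(1) by (simp_all add: Hom_iff)
  define \<phi> where "\<phi> = neg T (Pr1 T Y' Z \<cdot> k \<cdot> In2 T Y' Z)"
  have [simp]: "\<phi> \<in> Arr T" "Dom T \<phi> = Z" "Cod T \<phi> = Y'" by (simp_all add: \<phi>_def)
  have "Pr1 T Y' Z \<cdot> (k \<cdot> cone1 O2) \<cdot> In2 T X' Y = \<phi> \<cdot> v"
    by (simp add: \<phi>_def)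
  then have "g = \<phi> \<cdot> v" unfolding k(2) by simp
  moreover have "v' \<cdot> \<phi> = Zero T Z Z'"
  proof -
    have "v' \<cdot> Pr1 T Y' Z \<cdot> k \<cdot> In2 T Y' Z =
      Pr1 T Z' (SigmaO T X) \<cdot> cone2 O3 \<cdot> k \<cdot> In2 T Y' Z"
      by (rule comp_eq_comp) (simp_all add: Pr1_cones)
    also have "\<dots> = Pr1 T Z' (SigmaO T X) \<cdot> (cone2 O3 \<cdot> k) \<cdot> In2 T Y' Z" by simp
    also have "\<dots> = Zero T Z Z'" unfolding k(3)[symmetric] by simp
    finally show ?thesis by (simp add: \<phi>_def)
  qed
  ultimately show "flash v' v g"
    unfolding flash_def by (intro bexI[of _ \<phi>]) (simp_all add: Hom_iff)
next
  note [simp] = g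
  note [simp] = g[unfolded Hom_iff]
  assume "flash v' v g"
  then obtain \<phi> where \<phi>: "\<phi> \<in> Hom T Z Y'" "v' \<cdot> \<phi> = Zero T Z Z'" "g = \<phi> \<cdot> v"
    by (auto simp: flash_def)
  note [simp] = \<phi>(1)[unfolded Hom_iff]
  have "exact_triangle T (Biprod T X' Y) (Biprod T Y' Z) (Biprod T Z' (SigmaO T X))
    (cone1 g, cone2 O3, cone3 O1)"
  proof (rule exact_iso[OF exact_cone_Zero, where f = "Ident T (Biprod T X' Y)"
        and g = "shear Y' Z (neg T \<phi>)" and h = "Ident T (Biprod T Z' (SigmaO T X))"])
    show "shear Y' Z (neg T \<phi>) \<cdot> cone1 O2 = cone1 g \<cdot> Ident T (Biprod T X' Y)"
      by (rule Biprod_eq_from[of X' Y], simp_all, simp_all add: Hom_iff \<phi>(3))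
    show "Ident T (Biprod T Z' (SigmaO T X)) \<cdot> cone2 O3 = cone2 O3 \<cdot> shear Y' Z (neg T \<phi>)"
      by (rule Biprod_eq_from[of Y' Z], simp_all, simp_all add: Hom_iff \<phi>(2))
    show "is_iso T (shear Y' Z (neg T \<phi>))" by (rule is_iso_shear) (simp add: Hom_iff)
  qed (simp_all, simp_all add: Hom_iff)
  then show "good T (u, v, w) (u', v', w') (O1, g, O3)" by (simp add: good_iff)
qed

text \<open>\<open>f\<close> enters only \<open>cone3\<close>, so the comparison is filled in at the
  first vertex. It meets \<open>cone3\<close> through \<Sigma>, hence the equation for
  \<open>f\<close> is recovered by faithfulness.\<close>

lemma good_f_iff_flash:
  assumes f: "f \<in> Hom T X X'"
  shows "good T (u, v, w) (u', v', w') (f, O2, O3) \<longleftrightarrow> flash u' u f"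
proof
  note [simp] = f
  note [simp] = f[unfolded Hom_iff]
  assume "good T (u, v, w) (u', v', w') (f, O2, O3)"
  then have G: "exact_triangle T (Biprod T X' Y) (Biprod T Y' Z) (Biprod T Z' (SigmaO T X))
    (cone1 O2, cone2 O3, cone3 f)" by (simp add: good_iff)
  obtain k where k: "k \<in> Hom T (Biprod T X' Y) (Biprod T X' Y)"
    "cone1 O2 = cone1 O2 \<cdot> k" "SigmaA T k \<cdot> cone3 O1 = cone3 f"
    using exact_fill1[OF exact_cone_Zero G, of "Ident T (Biprod T Y' Z)" "Ident T (Biprod T Z' (SigmaO T X))"]
    by (auto simp: Hom_iff)
  have [simp]: "k \<in> Arr T" "Dom T k = Biprod T X' Y" "Cod T k = Biprod T X' Y"
    using k(1) by (simp_all add: Hom_iff)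
  define \<phi> where "\<phi> = neg T (Pr1 T X' Y \<cdot> k \<cdot> In2 T X' Y)"
  have [simp]: "\<phi> \<in> Arr T" "Dom T \<phi> = Y" "Cod T \<phi> = X'" by (simp_all add: \<phi>_def)
  have "SigmaA T (Pr1 T X' Y) \<cdot> (SigmaA T k \<cdot> cone3 O1) \<cdot> In2 T Z' (SigmaO T X) = SigmaA T (\<phi> \<cdot> u)"
    by (simp add: \<phi>_def)
  then have "SigmaA T f = SigmaA T (\<phi> \<cdot> u)" unfolding k(3) by simp
  then have "f = \<phi> \<cdot> u" by - (rule Sigma_faithful[of _ X X'], simp_all add: Hom_iff)
  moreover have "u' \<cdot> \<phi> = Zero T Y Y'"
  proof -
    have "u' \<cdot> Pr1 T X' Y \<cdot> k \<cdot> In2 T X' Y =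
      Pr1 T Y' Z \<cdot> cone1 O2 \<cdot> k \<cdot> In2 T X' Y"
      by (rule comp_eq_comp) (simp_all add: Pr1_cones)
    also have "\<dots> = Pr1 T Y' Z \<cdot> (cone1 O2 \<cdot> k) \<cdot> In2 T X' Y" by simp
    also have "\<dots> = Zero T Y Y'" unfolding k(2)[symmetric] by simp
    finally show ?thesis by (simp add: \<phi>_def)
  qed
  ultimately show "flash u' u f"
    unfolding flash_def by (intro bexI[of _ \<phi>]) (simp_all add: Hom_iff)
next
  note [simp] = f
  note [simp] = f[unfolded Hom_iff]
  assume "flash u' u f"
  then obtain \<phi> where \<phi>: "\<phi> \<in> Hom T Y X'" "u' \<cdot> \<phi> = Zero T Y Y'" "f = \<phi> \<cdot> u"
    by (auto simp: flash_def)
  note [simp] = \<phi>(1)[unfolded Hom_iff]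
  have S: "SigmaA T (shear X' Y (neg T \<phi>)) \<cdot> SigmaA T (In1 T X' Y) = SigmaA T (In1 T X' Y)"
    "SigmaA T (shear X' Y (neg T \<phi>)) \<cdot> SigmaA T (In2 T X' Y) =
      neg T (SigmaA T (In1 T X' Y) \<cdot> SigmaA T \<phi>) \<^bold>+ SigmaA T (In2 T X' Y)"
    by (simp_all flip: Sigma_comp)
  have "exact_triangle T (Biprod T X' Y) (Biprod T Y' Z) (Biprod T Z' (SigmaO T X))
    (cone1 O2, cone2 O3, cone3 f)"
  proof (rule exact_iso[OF exact_cone_Zero, where f = "shear X' Y (neg T \<phi>)"
        and g = "Ident T (Biprod T Y' Z)" and h = "Ident T (Biprod T Z' (SigmaO T X))"])
    show "Ident T (Biprod T Y' Z) \<cdot> cone1 O2 = cone1 O2 \<cdot> shear X' Y (neg T \<phi>)"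
      by (rule Biprod_eq_from[of X' Y], simp_all, simp_all add: Hom_iff \<phi>(2))
    show "SigmaA T (shear X' Y (neg T \<phi>)) \<cdot> cone3 O1 = cone3 f \<cdot> Ident T (Biprod T Z' (SigmaO T X))"
      using comp_eq[OF S(1), of w'] comp_eq[OF S(2), of "SigmaA T u"]
      by - (rule Biprod_eq_from[of Z' "SigmaO T X"], simp_all, simp_all add: Hom_iff \<phi>(3))
    show "is_iso T (shear X' Y (neg T \<phi>))" by (rule is_iso_shear) (simp add: Hom_iff)
  qed (simp_all, simp_all add: Hom_iff)
  then show "good T (u, v, w) (u', v', w') (f, O2, O3)" by (simp add: good_iff)
qed

end

section \<open>Middling good maps\<close>

context triangulated_category
begin

lemma conesE:
  assumes "k \<in> cones T a" "a \<in> Hom T X Y"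
  obtains C p q where "k = (p, q)" "exact_triangle T X Y C (a, p, q)"
  using assms by (auto simp: cones_def Hom_iff)

text \<open>Filling in between the identity of \<open>P\<close> and \<open>\<alpha>\<close> gives
  \<open>\<phi>\<close> with \<open>\<phi> \<cdot> a = m\<close> and
  \<open>m' \<cdot> \<phi> = \<alpha> \<cdot> b\<close>. Then
  \<open>n \<cdot> \<phi> = \<beta> \<cdot> \<alpha> \<cdot> b\<close> vanishes.\<close>

lemma flash_if_null_composite:
  assumes E: "exact_triangle T P Q R (a, b, c)" and K: "exact_triangle T P M L (m, m', m'')"
    and \<alpha>: "\<alpha> \<in> Hom T R L" "m'' \<cdot> \<alpha> = c" and \<beta>: "\<beta> \<in> Hom T L N" "\<beta> \<cdot> m' = n"
    and \<beta>\<alpha>: "\<beta> \<cdot> \<alpha> = Zero T R N"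
  shows "flash n a m"
proof -
  note [simp] = exact_arr[OF E] exact_Ob[OF E] exact_arr[OF K] exact_Ob[OF K] Hom_Ob[OF \<beta>(1)]
  obtain \<phi> where \<phi>: "\<phi> \<in> Hom T Q M" "\<phi> \<cdot> a = m \<cdot> Ident T P" "\<alpha> \<cdot> b = m' \<cdot> \<phi>"
    using exact_fill2[OF E K Ident_Hom[OF exact_Ob(1)[OF E]] \<alpha>(1)] \<alpha>(2) by auto
  have [simp]: "n \<in> Arr T" "Dom T n = M" "Cod T n = N" using \<beta> by (auto simp: Hom_iff)
  have "n \<cdot> \<phi> = \<beta> \<cdot> \<alpha> \<cdot> b"
    using \<phi>(1) \<beta>(1) comp_eq[OF \<beta>(2), of \<phi>] by (simp add: Hom_iff \<phi>(3))
  also have "\<dots> = Zero T Q N"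
    using \<alpha>(1) \<beta>(1) comp_eq[OF \<beta>\<alpha>, of b] by (simp add: Hom_iff)
  finally show ?thesis
    unfolding flash_def using \<phi>(1,2) by (intro bexI[of _ \<phi>]) (simp_all add: Hom_iff)
qed

text \<open>A section of the last map of any cone of the zero map compares the biproduct with that
  cone, and the five lemma applies.\<close>

lemma exact_Zero_Biprod:
  assumes [simp]: "X \<in> Ob T" "Y \<in> Ob T"
  shows "exact_triangle T X Y (Biprod T Y (SigmaO T X))
    (Zero T X Y, In1 T Y (SigmaO T X), Pr2 T Y (SigmaO T X))"
proof -
  obtain C p q where E: "exact_triangle T X Y C (Zero T X Y, p, q)"
    using exact_exists[OF Zero_Hom] assms by metis
  note [simp] = exact_arr(4-)[OF E] exact_Ob[OF E]
  obtain s where s: "s \<in> Hom T (SigmaO T X) C" "q \<cdot> s = Ident T (SigmaO T X)"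
    using exact_Zero_section[OF E] .
  note [simp] = s(1)[unfolded Hom_iff]
  let ?h = "p \<cdot> Pr1 T Y (SigmaO T X) \<^bold>+ s \<cdot> Pr2 T Y (SigmaO T X)"
  have "q \<cdot> p = Zero T Y (SigmaO T X)" using exact_comp_Zero[OF E] by blast
  then have "q \<cdot> ?h = Pr2 T Y (SigmaO T X)"
    using s(2) by - (rule Biprod_eq_from[of Y "SigmaO T X"], simp_all, simp_all add: Hom_iff)
  moreover have "\<exists>y \<in> Hom T W Y. x = In1 T Y (SigmaO T X) \<cdot> y"
    if x: "x \<in> Hom T W (Biprod T Y (SigmaO T X))" "Pr2 T Y (SigmaO T X) \<cdot> x = Zero T W (SigmaO T X)" for W x
  proof -
    have "x = In1 T Y (SigmaO T X) \<cdot> Pr1 T Y (SigmaO T X) \<cdot> x"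
      using biproduct_decompose[OF biproduct_Biprod x(1)] x Hom_Ob[OF x(1)] by (simp add: Hom_iff)
    then show ?thesis using x(1) by (intro bexI[of _ "Pr1 T Y (SigmaO T X) \<cdot> x"]) (simp_all add: Hom_iff)
  qed
  moreover have "\<exists>z \<in> Hom T W (Biprod T Y (SigmaO T X)). x = Pr2 T Y (SigmaO T X) \<cdot> z"
    if "x \<in> Hom T W (SigmaO T X)" for W x
    using that by (intro bexI[of _ "In2 T Y (SigmaO T X) \<cdot> x"]) (simp_all add: Hom_iff)
  ultimately show ?thesis
    by (intro exact_if_hom_exact(2)[OF E, of _ _ _ ?h]) (simp_all add: Hom_iff)
qed

lemma zero_object_Ident:
  assumes "zero_object T N"
  shows "Ident T N = Zero T N N"
  using zero_object_unique(1)[OF assms zero_object_Ob[OF assms]] zero_object_Ob[OF assms]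
  by (meson Ident_Hom Zero_Hom)

text \<open>With these degenerate biproducts, adding a trivial triangle leaves the third vertex
  unchanged.\<close>

lemma biproduct_zero_object_right:
  assumes N: "zero_object T N" and [simp]: "A \<in> Ob T"
  shows "biproduct A A N (Ident T A) (Zero T N A) (Ident T A) (Zero T A N)"
  using zero_object_Ob[OF N] zero_object_Ident[OF N] by (simp add: biproduct_def Hom_iff)

lemma biproduct_zero_object_left:
  assumes N: "zero_object T N" and [simp]: "A \<in> Ob T"
  shows "biproduct A N A (Zero T N A) (Ident T A) (Zero T A N) (Ident T A)"
  using zero_object_Ob[OF N] zero_object_Ident[OF N] by (simp add: biproduct_def Hom_iff)

text \<open>The injections are those of the standard diagram followed by the shear with entry
  \<open>b\<close>; an off-diagonal entry is thus absorbed into the choice of biproduct.\<close>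

lemma biproduct_sheared:
  assumes b: "b \<in> Hom T B A"
  shows "biproduct (Biprod T A B) A B (In1 T A B) (In1 T A B \<cdot> b \<^bold>+ In2 T A B)
    (Pr1 T A B \<^bold>+ neg T (b \<cdot> Pr2 T A B)) (Pr2 T A B)"
proof -
  note [simp] = Hom_Ob[OF b] b[unfolded Hom_iff]
  have "In1 T A B \<cdot> (Pr1 T A B \<^bold>+ neg T (b \<cdot> Pr2 T A B)) \<^bold>+
      (In1 T A B \<cdot> b \<^bold>+ In2 T A B) \<cdot> Pr2 T A B = Ident T (Biprod T A B)"
    by (rule Biprod_eq_from[of A B]) (simp_all, simp_all add: Hom_iff)
  then show ?thesis unfolding biproduct_def by (simp add: Hom_iff)
qed

end

context triangle_pair
begin

lemma middling_good_iff:
  assumes "f \<in> Hom T X X'" "g \<in> Hom T Y Y'" "h \<in> Hom T Z Z'"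
  shows "middling_good T (u, v, w) (u', v', w') (f, g, h) \<longleftrightarrow>
    (\<exists>F G H f' f'' g' g'' h' h'' u'' v'' w''.
       exact_triangle T X X' F (f, f', f'') \<and> exact_triangle T Y Y' G (g, g', g'') \<and>
       exact_triangle T Z Z' H (h, h', h'') \<and> exact_triangle T F G H (u'', v'', w'') \<and>
       g' \<cdot> u' = u'' \<cdot> f' \<and> h' \<cdot> v' = v'' \<cdot> g' \<and> SigmaA T f' \<cdot> w' = w'' \<cdot> h' \<and>
       g'' \<cdot> u'' = SigmaA T u \<cdot> f'' \<and> h'' \<cdot> v'' = SigmaA T v \<cdot> g'' \<and>
       SigmaA T f'' \<cdot> w'' = neg T (SigmaA T w \<cdot> h''))" (is "_ \<longleftrightarrow> ?R")
proof
  assume "middling_good T (u, v, w) (u', v', w') (f, g, h)"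
  then obtain f' f'' g' g'' h' h'' u'' v'' w'' where
    K: "(f', f'') \<in> cones T f" "(g', g'') \<in> cones T g" "(h', h'') \<in> cones T h" and
    r: "exact_triangle T (Cod T f') (Cod T g') (Cod T h') (u'', v'', w'')"
       "g' \<cdot> u' = u'' \<cdot> f'" "h' \<cdot> v' = v'' \<cdot> g'" "SigmaA T f' \<cdot> w' = w'' \<cdot> h'"
       "g'' \<cdot> u'' = SigmaA T u \<cdot> f''" "h'' \<cdot> v'' = SigmaA T v \<cdot> g''"
       "SigmaA T f'' \<cdot> w'' = neg T (SigmaA T w \<cdot> h'')"
    unfolding middling_good_def prod.case by (elim exE conjE) (rule that)
  show ?R
    by (rule exI[of _ "Cod T f'"], rule exI[of _ "Cod T g'"], rule exI[of _ "Cod T h'"],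
        rule exI[of _ f'], rule exI[of _ f''], rule exI[of _ g'], rule exI[of _ g''],
        rule exI[of _ h'], rule exI[of _ h''], rule exI[of _ u''], rule exI[of _ v''], rule exI[of _ w''])
      (use K[unfolded assms[THEN cones_iff]] r in \<open>intro conjI\<close>)
next
  assume ?R
  then obtain F G H f' f'' g' g'' h' h'' u'' v'' w'' where
    K: "exact_triangle T X X' F (f, f', f'')" "exact_triangle T Y Y' G (g, g', g'')"
      "exact_triangle T Z Z' H (h, h', h'')" and
    r: "exact_triangle T F G H (u'', v'', w'')"
       "g' \<cdot> u' = u'' \<cdot> f'" "h' \<cdot> v' = v'' \<cdot> g'" "SigmaA T f' \<cdot> w' = w'' \<cdot> h'"
       "g'' \<cdot> u'' = SigmaA T u \<cdot> f''" "h'' \<cdot> v'' = SigmaA T v \<cdot> g''"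
       "SigmaA T f'' \<cdot> w'' = neg T (SigmaA T w \<cdot> h'')"
    by blast
  have Cod: "Cod T f' = F" "Cod T g' = G" "Cod T h' = H"
    using exact_arr(6)[OF K(1)] exact_arr(6)[OF K(2)] exact_arr(6)[OF K(3)] by simp_all
  show "middling_good T (u, v, w) (u', v', w') (f, g, h)"
    unfolding middling_good_def prod.case
    by (rule exI[of _ f'], rule exI[of _ f''], rule exI[of _ g'], rule exI[of _ g''],
        rule exI[of _ h'], rule exI[of _ h''], rule exI[of _ u''], rule exI[of _ v''], rule exI[of _ w''])
      (use conesI[OF K(1)] conesI[OF K(2)] conesI[OF K(3)] r Cod in simp)
qed

text \<open>A section \<open>t\<close> of \<open>g''\<close> makes \<open>v''\<close> a lift of
  \<open>\<Sigma>v\<close> to the cone of \<open>h\<close>, and a retraction \<open>r\<close> of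
  \<open>f'\<close> makes \<open>w''\<close> an extension of \<open>w'\<close>. Their composite
  contains \<open>w'' \<cdot> v''\<close>, which is zero; the sign on the lift matches the twice
  rotated triangle.\<close>

lemma flash_if_middling_good_h:
  assumes h: "h \<in> Hom T Z Z'" and M: "middling_good T (u, v, w) (u', v', w') (O1, O2, h)"
  shows "flash w' w h"
proof -
  obtain F G H f' f'' g' g'' h' h'' u'' v'' w'' where
    Kf: "exact_triangle T X X' F (O1, f', f'')" and Kg: "exact_triangle T Y Y' G (O2, g', g'')" and
    Kh: "exact_triangle T Z Z' H (h, h', h'')" and K: "exact_triangle T F G H (u'', v'', w'')" and
    sq: "SigmaA T f' \<cdot> w' = w'' \<cdot> h'" "h'' \<cdot> v'' = SigmaA T v \<cdot> g''"
    using M middling_good_iff[OF Zero_Homs(1,2) h] by blast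
  note [simp] = exact_arr(4-)[OF Kf] exact_Ob[OF Kf] exact_arr(4-)[OF Kg] exact_Ob[OF Kg]
    exact_arr[OF Kh] exact_Ob[OF Kh] exact_arr[OF K]
  obtain t where t: "t \<in> Hom T (SigmaO T Y) G" "g'' \<cdot> t = Ident T (SigmaO T Y)"
    using exact_Zero_section[OF Kg] .
  obtain r where r: "r \<in> Hom T F X'" "r \<cdot> f' = Ident T X'"
    using exact_Zero_retraction[OF Kf] .
  note [simp] = t(1)[unfolded Hom_iff] r(1)[unfolded Hom_iff]
  show ?thesis
  proof (rule flash_if_null_composite[OF exact_rotate[OF exact_rotate[OF E]] Kh])
    show "h'' \<cdot> neg T (v'' \<cdot> t) = neg T (SigmaA T v)"
      using comp_eq_comp[OF sq(2), of t] t(2) by simp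
    have "SigmaA T r \<cdot> SigmaA T f' = Ident T (SigmaO T X')"
      using arg_cong[OF r(2), of "SigmaA T"] by simp
    then show "(SigmaA T r \<cdot> w'') \<cdot> h' = w'"
      using sq(1) comp_eq[of "SigmaA T r" "SigmaA T f'" _ w'] by simp
    have "w'' \<cdot> v'' = Zero T G (SigmaO T F)" using exact_comp_Zero[OF K] by blast
    then show "(SigmaA T r \<cdot> w'') \<cdot> neg T (v'' \<cdot> t) = Zero T (SigmaO T Y) (SigmaO T X')"
      using comp_eq[of w'' v'' _ t] by simp
  qed (simp_all add: Hom_iff)
qed

text \<open>The same pattern with a section of \<open>f''\<close> and a retraction of
  \<open>h'\<close>; the composite vanishes because \<open>v'' \<cdot> u''\<close> does.\<close>

lemma flash_if_middling_good_g:
  assumes g: "g \<in> Hom T Y Y'" and M: "middling_good T (u, v, w) (u', v', w') (O1, g, O3)"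
  shows "flash v' v g"
proof -
  obtain F G H f' f'' g' g'' h' h'' u'' v'' w'' where
    Kf: "exact_triangle T X X' F (O1, f', f'')" and Kg: "exact_triangle T Y Y' G (g, g', g'')" and
    Kh: "exact_triangle T Z Z' H (O3, h', h'')" and K: "exact_triangle T F G H (u'', v'', w'')" and
    sq: "h' \<cdot> v' = v'' \<cdot> g'" "g'' \<cdot> u'' = SigmaA T u \<cdot> f''"
    using M middling_good_iff[OF Zero_Homs(1) g Zero_Homs(3)] by blast
  note [simp] = exact_arr(4-)[OF Kf] exact_Ob[OF Kf] exact_arr[OF Kg] exact_Ob[OF Kg]
    exact_arr(4-)[OF Kh] exact_Ob[OF Kh] exact_arr[OF K]
  obtain s where s: "s \<in> Hom T (SigmaO T X) F" "f'' \<cdot> s = Ident T (SigmaO T X)"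
    using exact_Zero_section[OF Kf] .
  obtain r where r: "r \<in> Hom T H Z'" "r \<cdot> h' = Ident T Z'"
    using exact_Zero_retraction[OF Kh] .
  note [simp] = s(1)[unfolded Hom_iff] r(1)[unfolded Hom_iff]
  show ?thesis
  proof (rule flash_if_null_composite[OF exact_rotate[OF E] Kg])
    show "g'' \<cdot> neg T (u'' \<cdot> s) = neg T (SigmaA T u)"
      using comp_eq_comp[OF sq(2), of s] s(2) by simp
    show "(r \<cdot> v'') \<cdot> g' = v'"
      using sq(1) comp_eq[OF r(2), of v'] by simp
    have "v'' \<cdot> u'' = Zero T F H" using exact_comp_Zero[OF K] by blast
    then show "(r \<cdot> v'') \<cdot> neg T (u'' \<cdot> s) = Zero T (SigmaO T X) Z'"
      using comp_eq[of v'' u'' _ s] by simp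
  qed (simp_all add: Hom_iff)
qed

text \<open>Here the null composite is \<open>SigmaA T u'' \<cdot> w''\<close>, one suspension
  higher. The argument runs on suspended triangles, where the anticommuting square matches the signs
  of \<open>exact_Sigma\<close>, and \<open>flash_Sigma\<close> leads back.\<close>

lemma flash_if_middling_good_f:
  assumes f: "f \<in> Hom T X X'" and M: "middling_good T (u, v, w) (u', v', w') (f, O2, O3)"
  shows "flash u' u f"
proof -
  obtain F G H f' f'' g' g'' h' h'' u'' v'' w'' where
    Kf: "exact_triangle T X X' F (f, f', f'')" and Kg: "exact_triangle T Y Y' G (O2, g', g'')" and
    Kh: "exact_triangle T Z Z' H (O3, h', h'')" and K: "exact_triangle T F G H (u'', v'', w'')" and
    sq: "g' \<cdot> u' = u'' \<cdot> f'" "SigmaA T f'' \<cdot> w'' = neg T (SigmaA T w \<cdot> h'')"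
    using M middling_good_iff[OF f Zero_Homs(2,3)] by blast
  note [simp] = exact_arr[OF Kf] exact_Ob[OF Kf] exact_arr(4-)[OF Kg] exact_Ob[OF Kg]
    exact_arr(4-)[OF Kh] exact_Ob[OF Kh] exact_arr[OF K]
  obtain s where s: "s \<in> Hom T (SigmaO T Z) H" "h'' \<cdot> s = Ident T (SigmaO T Z)"
    using exact_Zero_section[OF Kh] .
  obtain r where r: "r \<in> Hom T G Y'" "r \<cdot> g' = Ident T Y'"
    using exact_Zero_retraction[OF Kg] .
  note [simp] = s(1)[unfolded Hom_iff] r(1)[unfolded Hom_iff]
  have "flash (SigmaA T u') (SigmaA T u) (SigmaA T f)"
  proof (rule flash_if_null_composite[OF exact_Sigma[OF E] exact_Sigma[OF Kf]])
    have "SigmaA T f'' \<cdot> w'' \<cdot> s = neg T (SigmaA T w \<cdot> h'') \<cdot> s"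
      using sq(2) by (intro comp_eq) simp_all
    then show "neg T (SigmaA T f'') \<cdot> neg T (w'' \<cdot> s) = neg T (SigmaA T w)"
      using s(2) by simp
    have "r \<cdot> u'' \<cdot> f' = u'" using comp_eq[OF r(2), of u'] by (simp flip: sq(1))
    then show "SigmaA T (r \<cdot> u'') \<cdot> SigmaA T f' = SigmaA T u'"
      by (simp flip: Sigma_comp)
    have "SigmaA T u'' \<cdot> w'' = Zero T H (SigmaO T G)" using exact_comp_Zero[OF K] by blast
    then show "SigmaA T (r \<cdot> u'') \<cdot> neg T (w'' \<cdot> s) = Zero T (SigmaO T Z) (SigmaO T Y')"
      using comp_eq[of "SigmaA T u''" w'' _ s] by simp
  qed (simp_all add: Hom_iff)
  then show ?thesis
    using flash_Sigma[OF exact_Hom(1)[OF E'] exact_Hom(1)[OF E] f] by simp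
qed

text \<open>For \<open>h = -v'\<eta>w\<close>, the octahedron for the factorisation of the matrix with rows \<open>[u' \<eta>]\<close> and
  \<open>[0 \<Sigma>u]\<close> through \<open>Y' \<oplus> \<Sigma>X\<close> has third vertex a cone of \<open>h\<close>.\<close>

lemma middling_good_h_if_flash:
  assumes h: "h \<in> Hom T Z Z'" and fl: "flash w' w h"
  shows "middling_good T (u, v, w) (u', v', w') (O1, O2, h)"
proof -
  note [simp] = h[unfolded Hom_iff]
  obtain \<theta> where \<theta>: "\<theta> \<in> Hom T (SigmaO T X) Y'" "h = v' \<cdot> \<theta> \<cdot> w"
    using lightning_iff_flash[OF exact_rotate[OF E'] exact_Hom(3)[OF E], of h] fl by blast
  \<comment> \<open>The sign makes the last map of the octahedron below equal to
    \<open>-\<Sigma>h\<close>, as a rotation of a triangle on \<open>h\<close> requires.\<close>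
  define \<eta> where "\<eta> = neg T \<theta>"
  have \<eta>: "\<eta> \<in> Hom T (SigmaO T X) Y'" "h = neg T (v' \<cdot> \<eta> \<cdot> w)"
    using \<theta> by (simp_all add: \<eta>_def Hom_iff)
  note [simp] = \<eta>(1)[unfolded Hom_iff]
  obtain N where N: "zero_object T N" using ex_zero_object by blast
  note [simp] = zero_object_Ob[OF N]
  let ?P = "Biprod T X' (SigmaO T X)" and ?Q = "Biprod T Y' (SigmaO T X)"
    and ?R = "Biprod T Y' (SigmaO T Y)"
  \<comment> \<open>\<open>a\<close> is diagonal with entries \<open>u'\<close> and the identity,
    followed by the shear with entry \<open>\<eta>\<close>; \<open>b\<close> is diagonal. Their
    cones are therefore \<open>Z'\<close> and \<open>SigmaO T Z\<close>, while
    \<open>b \<cdot> a\<close> serves as \<open>u''\<close> between the split cones of the zero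
    maps.\<close>
  define a where "a = block_matrix T u' \<eta> (Zero T X' (SigmaO T X)) (Ident T (SigmaO T X))"
  define b where "b = block_matrix T (Ident T Y') (Zero T (SigmaO T X) Y') (Zero T Y' (SigmaO T Y)) (SigmaA T u)"
  define a' where "a' = v' \<cdot> (Pr1 T Y' (SigmaO T X) \<^bold>+ neg T (\<eta> \<cdot> Pr2 T Y' (SigmaO T X)))"
  define a'' where "a'' = SigmaA T (In1 T X' (SigmaO T X)) \<cdot> w'"
  define b' where "b' = SigmaA T v \<cdot> Pr2 T Y' (SigmaO T Y)"
  define b'' where "b'' = neg T (SigmaA T (In2 T Y' (SigmaO T X)) \<cdot> SigmaA T w)"
  have [simp]: "a \<in> Arr T" "Dom T a = ?P" "Cod T a = ?Q" "b \<in> Arr T" "Dom T b = ?Q" "Cod T b = ?R"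
    "a' \<in> Arr T" "Dom T a' = ?Q" "Cod T a' = Z'" "a'' \<in> Arr T" "Dom T a'' = Z'" "Cod T a'' = SigmaO T ?P"
    "b' \<in> Arr T" "Dom T b' = ?R" "Cod T b' = SigmaO T Z" "b'' \<in> Arr T" "Dom T b'' = SigmaO T Z"
    "Cod T b'' = SigmaO T ?Q"
    by (simp_all add: a_def b_def a'_def a''_def b'_def b''_def)
  have a_In: "a \<cdot> In1 T X' (SigmaO T X) = In1 T Y' (SigmaO T X) \<cdot> u'"
    "a \<cdot> In2 T X' (SigmaO T X) = In1 T Y' (SigmaO T X) \<cdot> \<eta> \<^bold>+ In2 T Y' (SigmaO T X)"
    by (simp_all add: a_def)
  have b_In: "b \<cdot> In1 T Y' (SigmaO T X) = In1 T Y' (SigmaO T Y)"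
    "b \<cdot> In2 T Y' (SigmaO T X) = In2 T Y' (SigmaO T Y) \<cdot> SigmaA T u"
    by (simp_all add: b_def)
  have vv: "v' \<cdot> u' = Zero T X' Z'" using exact_comp_Zero[OF E'] by blast
  \<comment> \<open>Relative to the sheared biproduct on the target, \<open>a\<close> is diagonal:
    the triangle is the sum of the second triangle and a trivial one.\<close>
  have Ka: "exact_triangle T ?P ?Q Z' (a, a', a'')"
    by (rule exact_direct_sum[OF E' exact_Ident[OF _ N] biproduct_Biprod biproduct_sheared[OF \<eta>(1)]
          biproduct_zero_object_right[OF N]])
      (simp_all add: a_In, simp_all add: a'_def a''_def Hom_iff)
  have Kb: "exact_triangle T ?Q ?R (SigmaO T Z) (b, b', b'')"
    by (rule exact_direct_sum[OF exact_Ident[OF _ N] exact_Sigma[OF E] biproduct_Biprod biproduct_Biprod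
          biproduct_zero_object_left[OF N]])
      (simp_all add: b_In, simp_all add: b'_def b''_def Hom_iff)
  obtain C c' c'' where Kc: "exact_triangle T ?P ?R C (b \<cdot> a, c', c'')"
    using exact_exists[of "b \<cdot> a" ?P ?R] by (auto simp: Hom_iff)
  note [simp] = exact_arr(4-)[OF Kc] exact_Ob[OF Kc]
  obtain \<alpha> \<beta> \<gamma> where "octahedron T a b (a', a'') (b', b'') (c', c'') (\<alpha>, \<beta>, \<gamma>)"
    using Exact_octahedron[OF exact_Hom(1)[OF Ka] exact_Hom(1)[OF Kb] conesI[OF Ka] conesI[OF Kb] conesI[OF Kc]]
    by blast
  note o = this[unfolded octahedron_iff[OF exact_Hom(2)[OF Ka] exact_Hom(2)[OF Kb] exact_Hom(2)[OF Kc]]]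
  have O: "exact_triangle T Z' C (SigmaO T Z) (\<alpha>, \<beta>, \<gamma>)" using o by blast
  note [simp] = exact_arr[OF O]
  \<comment> \<open>On \<open>SigmaO T X\<close> the map \<open>a'\<close> is
    \<open>-(v' \<cdot> \<eta>)\<close>; with the sign in \<open>b''\<close>, the composite defining
    \<open>\<gamma>\<close> is the suspension of \<open>v' \<cdot> \<eta> \<cdot> w\<close>.\<close>
  have "\<gamma> = neg T (SigmaA T h)"
    using o by (simp add: a'_def b''_def \<eta>(2) flip: Sigma_comp)
  then have Kh: "exact_triangle T Z Z' C (h, \<alpha>, \<beta>)"
    using O by (subst exact_rotate_iff) (simp_all add: Hom_iff)
  show ?thesis
    unfolding middling_good_iff[OF Zero_Homs(1,2) h]
  proof (intro exI conjI)
    show "exact_triangle T X X' ?P (O1, In1 T X' (SigmaO T X), Pr2 T X' (SigmaO T X))"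
      "exact_triangle T Y Y' ?R (O2, In1 T Y' (SigmaO T Y), Pr2 T Y' (SigmaO T Y))"
      by (simp_all add: exact_Zero_Biprod)
    show "exact_triangle T Z Z' C (h, \<alpha>, \<beta>)" "exact_triangle T ?P ?R C (b \<cdot> a, c', c'')"
      using Kh Kc .
    show "In1 T Y' (SigmaO T Y) \<cdot> u' = (b \<cdot> a) \<cdot> In1 T X' (SigmaO T X)"
      using comp_eq[OF b_In(1), of u'] by (simp add: a_In)
    \<comment> \<open>On the first summand \<open>a'\<close> is \<open>v'\<close> and
      \<open>b\<close> is the first injection.\<close>
    have "\<alpha> \<cdot> a' \<cdot> In1 T Y' (SigmaO T X) = c' \<cdot> b \<cdot> In1 T Y' (SigmaO T X)"
      using o by (intro comp_eq_comp) simp_all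
    then show "\<alpha> \<cdot> v' = c' \<cdot> In1 T Y' (SigmaO T Y)"
      by (simp add: b_In a'_def)
    show "SigmaA T (In1 T X' (SigmaO T X)) \<cdot> w' = c'' \<cdot> \<alpha>"
      using o by (simp add: a''_def)
    have Pa: "Pr2 T Y' (SigmaO T X) \<cdot> a = Pr2 T X' (SigmaO T X)"
      by (rule Biprod_eq_from[of X' "SigmaO T X"]) (simp_all, simp_all add: Hom_iff a_In)
    have "Pr2 T Y' (SigmaO T Y) \<cdot> b = SigmaA T u \<cdot> Pr2 T Y' (SigmaO T X)"
      by (rule Biprod_eq_from[of Y' "SigmaO T X"]) (simp_all, simp_all add: Hom_iff b_In)
    from comp_eq_comp[OF this, of a]
    show "Pr2 T Y' (SigmaO T Y) \<cdot> b \<cdot> a = SigmaA T u \<cdot> Pr2 T X' (SigmaO T X)"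
      by (simp add: Pa)
    show "\<beta> \<cdot> c' = SigmaA T v \<cdot> Pr2 T Y' (SigmaO T Y)"
      using o by (simp add: b'_def)
    \<comment> \<open>Since \<open>a\<close> respects second projections, \<open>\<Sigma>a\<close>
      can be inserted and replaced by the octahedron relation for
      \<open>b'' \<cdot> \<beta>\<close>; the sign in \<open>b''\<close> gives the anticommuting
      square.\<close>
    have "SigmaA T (Pr2 T X' (SigmaO T X)) \<cdot> c'' = SigmaA T (Pr2 T Y' (SigmaO T X)) \<cdot> SigmaA T a \<cdot> c''"
      by (simp flip: Pa)
    also have "\<dots> = SigmaA T (Pr2 T Y' (SigmaO T X)) \<cdot> b'' \<cdot> \<beta>" using o by simp
    also have "\<dots> = neg T (SigmaA T w \<cdot> \<beta>)" by (simp add: b''_def)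
    finally show "SigmaA T (Pr2 T X' (SigmaO T X)) \<cdot> c'' = neg T (SigmaA T w \<cdot> \<beta>)" .
  qed
qed

section \<open>Rotating three-by-three diagrams\<close>

lemma rotated_pair:
  "triangle_pair T Y Z (SigmaO T X) Y' Z' (SigmaO T X') v w (neg T (SigmaA T u))
     v' w' (neg T (SigmaA T u'))"
  by unfold_locales (rule exact_rotate[OF E] exact_rotate[OF E'])+

text \<open>The given diagram contains a cone of \<open>SigmaA T f\<close>, not the suspension of a
  cone of \<open>f\<close>; the isomorphism \<open>i\<close> mediates. The sign of the last map in
  \<open>exact_Sigma\<close> turns a commuting square into the required anticommuting one.\<close>

lemma middling_good_if_rotated:
  assumes f: "f \<in> Hom T X X'" and g: "g \<in> Hom T Y Y'" and h: "h \<in> Hom T Z Z'"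
    and M: "middling_good T (v, w, neg T (SigmaA T u)) (v', w', neg T (SigmaA T u')) (g, h, SigmaA T f)"
  shows "middling_good T (u, v, w) (u', v', w') (f, g, h)"
proof -
  note [simp] = f[unfolded Hom_iff] g[unfolded Hom_iff] h[unfolded Hom_iff]
  obtain G H K g' g'' h' h'' k' k'' v'' w0 u0 where
    Kg: "exact_triangle T Y Y' G (g, g', g'')" and Kh: "exact_triangle T Z Z' H (h, h', h'')" and
    Kk: "exact_triangle T (SigmaO T X) (SigmaO T X') K (SigmaA T f, k', k'')" and
    R: "exact_triangle T G H K (v'', w0, u0)" and
    sq: "h' \<cdot> v' = v'' \<cdot> g'" "k' \<cdot> w' = w0 \<cdot> h'" "SigmaA T g' \<cdot> neg T (SigmaA T u') = u0 \<cdot> k'"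
       "h'' \<cdot> v'' = SigmaA T v \<cdot> g''" "k'' \<cdot> w0 = SigmaA T w \<cdot> h''"
       "SigmaA T g'' \<cdot> u0 = neg T (SigmaA T (neg T (SigmaA T u)) \<cdot> k'')"
    using M triangle_pair.middling_good_iff[OF rotated_pair g h Sigma_Hom[OF f]] by blast
  note [simp] = exact_arr[OF Kg] exact_Ob[OF Kg] exact_arr[OF Kh] exact_Ob[OF Kh]
    exact_arr(4-)[OF Kk] exact_Ob[OF Kk] exact_arr[OF R]
  obtain F f' f'' where Kf: "exact_triangle T X X' F (f, f', f'')" using exact_exists[OF f] .
  note [simp] = exact_arr[OF Kf] exact_Ob[OF Kf]
  obtain i where i: "i \<in> Hom T K (SigmaO T F)" "is_iso T i" "i \<cdot> k' = SigmaA T f'"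
    "neg T (SigmaA T f'') \<cdot> i = k''"
    using exact_unique[OF Kk exact_Sigma[OF Kf]] .
  obtain j where j: "j \<in> Hom T (SigmaO T F) K" "j \<cdot> i = Ident T K" "i \<cdot> j = Ident T (SigmaO T F)"
    using is_isoE[OF i(2,1)] .
  note [simp] = i(1)[unfolded Hom_iff] j(1)[unfolded Hom_iff]
  have jk: "j \<cdot> SigmaA T f' = k'" using comp_eq[OF j(2), of k'] by (simp flip: i(3))
  have kj: "k'' \<cdot> j = neg T (SigmaA T f'')" using j(3) by (simp flip: i(4))
  \<comment> \<open>Fullness of \<Sigma> provides \<open>u''\<close>; the sign is the one that
    rotation puts on the suspended first map.\<close>
  have "neg T (u0 \<cdot> j) \<in> Hom T (SigmaO T F) (SigmaO T G)" by (simp add: Hom_iff)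
  then obtain u'' where u'': "u'' \<in> Hom T F G" "SigmaA T u'' = neg T (u0 \<cdot> j)"
    using Sigma_full by (metis exact_Ob(3)[OF Kf] exact_Ob(3)[OF Kg])
  note [simp] = u''(1)[unfolded Hom_iff]
  have "exact_triangle T G H (SigmaO T F) (v'', i \<cdot> w0, u0 \<cdot> j)"
    by (rule exact_iso[OF R, where f = "Ident T G" and g = "Ident T H" and h = i])
      (use i(2) j(2) in \<open>simp_all add: Hom_iff\<close>)
  then have K: "exact_triangle T F G H (u'', v'', i \<cdot> w0)"
    by (subst exact_rotate_iff) (simp_all add: Hom_iff u''(2))
  show ?thesis
    unfolding middling_good_iff[OF f g h]
  proof (intro exI conjI)
    show "exact_triangle T X X' F (f, f', f'')" "exact_triangle T Y Y' G (g, g', g'')"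
      "exact_triangle T Z Z' H (h, h', h'')" "exact_triangle T F G H (u'', v'', i \<cdot> w0)"
      using Kf Kg Kh K .
    show "h' \<cdot> v' = v'' \<cdot> g'" "h'' \<cdot> v'' = SigmaA T v \<cdot> g''" using sq by blast+
    have "SigmaA T (g' \<cdot> u') = SigmaA T (u'' \<cdot> f')"
      using sq(3) by (simp add: u''(2) jk flip: sq(3))
    then show "g' \<cdot> u' = u'' \<cdot> f'" by - (rule Sigma_faithful[of _ X' G], simp_all add: Hom_iff)
    show "SigmaA T f' \<cdot> w' = (i \<cdot> w0) \<cdot> h'"
      using comp_eq[OF i(3), of w'] sq(2) by simp
    \<comment> \<open>The sign of the anticommuting square cancels against that of
      \<open>-\<Sigma>u\<close>; below, those of \<open>u''\<close> and \<open>kj\<close> cancel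
      each other.\<close>
    have "SigmaA T g'' \<cdot> u0 \<cdot> j = SigmaA T (SigmaA T u) \<cdot> k'' \<cdot> j"
      using sq(6) by (intro comp_eq_comp) simp_all
    then have "SigmaA T (g'' \<cdot> u'') = SigmaA T (SigmaA T u \<cdot> f'')"
      by (simp add: u''(2) kj)
    then show "g'' \<cdot> u'' = SigmaA T u \<cdot> f''"
      by - (rule Sigma_faithful[of _ F "SigmaO T Y"], simp_all add: Hom_iff)
    have "neg T (neg T (SigmaA T f'') \<cdot> i \<cdot> w0) = neg T (SigmaA T w \<cdot> h'')"
      using comp_eq[OF i(4), of w0] sq(5) by (simp del: neg_comp)
    then show "SigmaA T f'' \<cdot> i \<cdot> w0 = neg T (SigmaA T w \<cdot> h'')" by simp
  qed
qed

lemma flash_rotated_iff: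
  assumes f: "f \<in> Hom T X X'"
  shows "flash (neg T (SigmaA T u')) (neg T (SigmaA T u)) (SigmaA T f) \<longleftrightarrow> flash u' u f"
  using flash_Sigma[OF exact_Hom(1)[OF E'] exact_Hom(1)[OF E] f] by (simp add: flash_neg_left flash_neg_right)

text \<open>Rotation sends \<open>(f, 0, 0)\<close> to \<open>(0, 0, \<Sigma>f)\<close>, the shape
  settled by an octahedron.\<close>

lemma middling_good_f_if_flash:
  assumes f: "f \<in> Hom T X X'" and fl: "flash u' u f"
  shows "middling_good T (u, v, w) (u', v', w') (f, O2, O3)"
proof (rule middling_good_if_rotated[OF f Zero_Homs(2,3)])
  show "middling_good T (v, w, neg T (SigmaA T u)) (v', w', neg T (SigmaA T u')) (O2, O3, SigmaA T f)"
    using triangle_pair.middling_good_h_if_flash[OF rotated_pair Sigma_Hom[OF f]]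
      flash_rotated_iff[OF f] fl by blast
qed

text \<open>Rotation sends \<open>(0, g, 0)\<close> to \<open>(g, 0, 0)\<close>, so the preceding
  shape applies to the rotated pair.\<close>

lemma middling_good_g_if_flash:
  assumes g: "g \<in> Hom T Y Y'" and fl: "flash v' v g"
  shows "middling_good T (u, v, w) (u', v', w') (O1, g, O3)"
proof (rule middling_good_if_rotated[OF Zero_Homs(1) g Zero_Homs(3)])
  show "middling_good T (v, w, neg T (SigmaA T u)) (v', w', neg T (SigmaA T u')) (g, O3, SigmaA T O1)"
    using triangle_pair.middling_good_f_if_flash[OF rotated_pair g fl] by simp
qed

end

section \<open>The equivalences\<close>

lemma all_equivalentI:
  assumes "P1 \<longleftrightarrow> R" "P2 \<longleftrightarrow> R" "P3 \<longleftrightarrow> R" "P4 \<longleftrightarrow> R" "P5 \<longleftrightarrow> R"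
  shows "all_equivalent [P1, P2, P3, P4, P5]"
  using assms by (simp add: all_equivalent_def)

context triangle_pair
begin

lemma triangle_map_iff:
  "triangle_map T (u, v, w) (u', v', w') (f, g, h) \<longleftrightarrow>
     f \<in> Hom T X X' \<and> g \<in> Hom T Y Y' \<and> h \<in> Hom T Z Z' \<and>
     g \<cdot> u = u' \<cdot> f \<and> h \<cdot> v = v' \<cdot> g \<and> SigmaA T f \<cdot> w = w' \<cdot> h"
  by (simp add: triangle_map_def)

lemma verdier_good_cones_h:
  assumes h: "h \<in> Hom T Z Z'"
    and k: "k_f \<in> cones T O1" "k_g \<in> cones T O2" "k_gu \<in> cones T (O2 \<cdot> u)"
  shows "verdier_good T k_f k_g k_gu (u, v, w) (u', v', w') (O1, O2, h) \<longleftrightarrow> flash w' w h"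
proof -
  obtain F f' f'' where f_eq: "k_f = (f', f'')" and Kf: "exact_triangle T X X' F (O1, f', f'')"
    using conesE[OF k(1) Zero_Homs(1)] .
  obtain G g' g'' where g_eq: "k_g = (g', g'')" and Kg: "exact_triangle T Y Y' G (O2, g', g'')"
    using conesE[OF k(2) Zero_Homs(2)] .
  obtain C c' c'' where c_eq: "k_gu = (c', c'')" and Kc: "exact_triangle T X Y' C (O2 \<cdot> u, c', c'')"
    using conesE[OF k(3) Comp_Hom[OF exact_Hom(1)[OF E] Zero_Homs(2)]] .
  show ?thesis unfolding f_eq g_eq c_eq by (rule verdier_good_h_iff[OF E E' Kf Kg Kc h])
qed

lemma verdier_good_cones_f:
  assumes f: "f \<in> Hom T X X'" and uf: "O2 \<cdot> u = u' \<cdot> f"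
    and k: "k_f \<in> cones T f" "k_g \<in> cones T O2" "k_gu \<in> cones T (O2 \<cdot> u)"
  shows "verdier_good T k_f k_g k_gu (u, v, w) (u', v', w') (f, O2, O3) \<longleftrightarrow> flash u' u f"
proof -
  obtain F f' f'' where f_eq: "k_f = (f', f'')" and Kf: "exact_triangle T X X' F (f, f', f'')"
    using conesE[OF k(1) f] .
  obtain G g' g'' where g_eq: "k_g = (g', g'')" and Kg: "exact_triangle T Y Y' G (O2, g', g'')"
    using conesE[OF k(2) Zero_Homs(2)] .
  obtain C c' c'' where c_eq: "k_gu = (c', c'')" and Kc: "exact_triangle T X Y' C (O2 \<cdot> u, c', c'')"
    using conesE[OF k(3) Comp_Hom[OF exact_Hom(1)[OF E] Zero_Homs(2)]] .
  have "u' \<cdot> f = Zero T X Y'" by (simp flip: uf)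
  then show ?thesis unfolding f_eq g_eq c_eq by (rule verdier_good_f_iff[OF E E' Kf Kg Kc])
qed

lemma verdier_good_cones_g:
  assumes g: "g \<in> Hom T Y Y'" and gu: "g \<cdot> u = u' \<cdot> O1"
    and k: "k_f \<in> cones T O1" "k_g \<in> cones T g" "k_gu \<in> cones T (g \<cdot> u)"
  shows "verdier_good T k_f k_g k_gu (u, v, w) (u', v', w') (O1, g, O3) \<longleftrightarrow> flash v' v g"
proof -
  obtain F f' f'' where f_eq: "k_f = (f', f'')" and Kf: "exact_triangle T X X' F (O1, f', f'')"
    using conesE[OF k(1) Zero_Homs(1)] .
  obtain G g' g'' where g_eq: "k_g = (g', g'')" and Kg: "exact_triangle T Y Y' G (g, g', g'')"
    using conesE[OF k(2) g] .
  obtain C c' c'' where c_eq: "k_gu = (c', c'')" and Kc: "exact_triangle T X Y' C (g \<cdot> u, c', c'')"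
    using conesE[OF k(3) Comp_Hom[OF exact_Hom(1)[OF E] g]] .
  have "g \<cdot> u = Zero T X Y'" by (simp add: gu)
  then show ?thesis unfolding f_eq g_eq c_eq by (rule verdier_good_g_iff[OF E E' Kf Kg Kc])
qed

text \<open>The bracket starts at \<open>v\<close>, so it is read off from the rotated first
  triangle; (5) comes from the rotated second one.\<close>

lemma equivalent_h:
  assumes m: "triangle_map T (u, v, w) (u', v', w') (O1, O2, h)"
    and k: "k_f \<in> cones T O1" "k_g \<in> cones T O2" "k_gu \<in> cones T (O2 \<cdot> u)" "k \<in> cones T v"
  shows "all_equivalent
    [good T (u, v, w) (u', v', w') (O1, O2, h),
     verdier_good T k_f k_g k_gu (u, v, w) (u', v', w') (O1, O2, h),
     middling_good T (u, v, w) (u', v', w') (O1, O2, h),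
     Zero T (SigmaO T Y) (SigmaO T X') \<in> toda_bracket T k w' h v,
     \<exists>\<theta> \<in> Hom T (SigmaO T X) Y'. h = v' \<cdot> \<theta> \<cdot> w]"
proof -
  have h: "h \<in> Hom T Z Z'" using m by (simp add: triangle_map_iff)
  show ?thesis
    using good_h_iff_flash[OF h] verdier_good_cones_h[OF h k(1-3)]
      flash_if_middling_good_h[OF h] middling_good_h_if_flash[OF h]
      toda_bracket_Zero_iff[OF exact_rotate[OF E] k(4) h exact_Hom(3)[OF E']]
      lightning_iff_flash[OF exact_rotate[OF E'] exact_Hom(3)[OF E], of h]
    by (intro all_equivalentI[where R = "flash w' w h"]) blast+
qed

text \<open>Desuspending \<open>E\<close> handles the bracket, and desuspending \<open>E'\<close>
  the factorisation in (5).\<close>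

lemma equivalent_f:
  assumes m: "triangle_map T (u, v, w) (u', v', w') (f, O2, O3)"
    and k: "k_f \<in> cones T f" "k_g \<in> cones T O2" "k_gu \<in> cones T (O2 \<cdot> u)"
      "k \<in> cones T (desuspend T X w)"
  shows "all_equivalent
    [good T (u, v, w) (u', v', w') (f, O2, O3),
     verdier_good T k_f k_g k_gu (u, v, w) (u', v', w') (f, O2, O3),
     middling_good T (u, v, w) (u', v', w') (f, O2, O3),
     Zero T Z Y' \<in> toda_bracket_desuspended T Z k u' f (desuspend T X w),
     \<exists>\<theta> \<in> Hom T Y (InvSigmaO T Z'). f = desuspend T X' w' \<cdot> \<theta> \<cdot> u]"
proof -
  have f: "f \<in> Hom T X X'" "O2 \<cdot> u = u' \<cdot> f" using m by (simp_all only: triangle_map_iff)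
  show ?thesis
    using good_f_iff_flash[OF f(1)] verdier_good_cones_f[OF f k(1-3)]
      flash_if_middling_good_f[OF f(1)] middling_good_f_if_flash[OF f(1)]
      toda_bracket_desuspended_Zero_iff[OF E k(4) f(1) exact_Hom(1)[OF E']]
      lightning_iff_flash[OF exact_desuspend[OF E'] exact_Hom(1)[OF E], of f]
    by (intro all_equivalentI[where R = "flash u' u f"]) blast+
qed

lemma equivalent_g:
  assumes m: "triangle_map T (u, v, w) (u', v', w') (O1, g, O3)"
    and k: "k_f \<in> cones T O1" "k_g \<in> cones T g" "k_gu \<in> cones T (g \<cdot> u)" "k \<in> cones T u"
  shows "all_equivalent
    [good T (u, v, w) (u', v', w') (O1, g, O3),
     verdier_good T k_f k_g k_gu (u, v, w) (u', v', w') (O1, g, O3),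
     middling_good T (u, v, w) (u', v', w') (O1, g, O3),
     Zero T (SigmaO T X) Z' \<in> toda_bracket T k v' g u,
     \<exists>\<theta> \<in> Hom T Z X'. g = u' \<cdot> \<theta> \<cdot> v]"
proof -
  have g: "g \<in> Hom T Y Y'" "g \<cdot> u = u' \<cdot> O1" using m by (simp_all only: triangle_map_iff)
  show ?thesis
    using good_g_iff_flash[OF g(1)] verdier_good_cones_g[OF g k(1-3)]
      flash_if_middling_good_g[OF g(1)] middling_good_g_if_flash[OF g(1)]
      toda_bracket_Zero_iff[OF E k(4) g(1) exact_Hom(2)[OF E']]
      lightning_iff_flash[OF E' exact_Hom(2)[OF E], of g]
    by (intro all_equivalentI[where R = "flash v' v g"]) blast+
qed

text \<open>Rotation moves the non-zero component one place to the left, or from the first place to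
  the third with a suspension, and \<open>n\<close> and \<open>a\<close> move with it. Both sides
  thus reduce to one instance of \<open>flash\<close>, up to signs and \<Sigma> in the last
  case.\<close>

lemma verdier_good_rotate_iff:
  assumes m: "triangle_map T (u, v, w) (u', v', w') (f, g, h)"
    and zero: "f = O1 \<and> g = O2 \<or> f = O1 \<and> h = O3 \<or> g = O2 \<and> h = O3"
    and k: "k_f \<in> cones T f" "k_g \<in> cones T g" "k_gu \<in> cones T (g \<cdot> u)"
    and l: "l_g \<in> cones T g" "l_h \<in> cones T h" "l_hv \<in> cones T (h \<cdot> v)"
  shows "verdier_good T k_f k_g k_gu (u, v, w) (u', v', w') (f, g, h) \<longleftrightarrow>
    verdier_good T l_g l_h l_hv
      (rotate_triangle T (u, v, w)) (rotate_triangle T (u', v', w')) (rotate_map T (f, g, h))"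
proof -
  have fgh: "f \<in> Hom T X X'" "g \<in> Hom T Y Y'" "h \<in> Hom T Z Z'" "g \<cdot> u = u' \<cdot> f" "h \<cdot> v = v' \<cdot> g"
    using m by (simp_all only: triangle_map_iff)
  \<comment> \<open>The last component of the rotated map has to be recognised as a zero map before
    the lemmas for the rotated pair match.\<close>
  have S: "SigmaA T O1 = Zero T (SigmaO T X) (SigmaO T X')" by simp
  note rot = rotate_triangle_def rotate_map_def prod.case
  from zero consider "f = O1" "g = O2" | "f = O1" "h = O3" | "g = O2" "h = O3" by blast
  then show ?thesis
  proof cases
    case 1
    show ?thesis
      using verdier_good_cones_h[OF fgh(3), of k_f k_g k_gu] k
        triangle_pair.verdier_good_cones_g[OF rotated_pair fgh(3), of l_g l_h l_hv] fgh(5) l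
      unfolding rot 1 S by blast
  next
    case 2
    show ?thesis
      using verdier_good_cones_g[OF fgh(2), of k_f k_g k_gu] k fgh(4)
        triangle_pair.verdier_good_cones_f[OF rotated_pair fgh(2), of l_g l_h l_hv] fgh(5) l
      unfolding rot 2 S by blast
  next
    case 3
    show ?thesis
      using verdier_good_cones_f[OF fgh(1), of k_f k_g k_gu] k fgh(4)
        triangle_pair.verdier_good_cones_h[OF rotated_pair Sigma_Hom[OF fgh(1)], of l_g l_h l_hv] l
        flash_rotated_iff[OF fgh(1)]
      unfolding rot 3 by blast
  qed
qed

end

theorem proposition7p13:
  fixes T :: "('o, 'm) triang_cat" (structure)
    and X Y Z X' Y' Z' :: 'o and u v w u' v' w' :: 'm
  assumes "triangulated_category T"
    and "exact_triangle T X Y Z (u, v, w)"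
    and "exact_triangle T X' Y' Z' (u', v', w')"
  shows
    "(\<forall>h. triangle_map T (u, v, w) (u', v', w') (Zero T X X', Zero T Y Y', h) \<longrightarrow>
        (\<forall>k_f \<in> cones T (Zero T X X'). \<forall>k_g \<in> cones T (Zero T Y Y').
         \<forall>k_gu \<in> cones T (Zero T Y Y' \<cdot> u). \<forall>k \<in> cones T v.
           all_equivalent
             [good T (u, v, w) (u', v', w') (Zero T X X', Zero T Y Y', h),
              verdier_good T k_f k_g k_gu (u, v, w) (u', v', w') (Zero T X X', Zero T Y Y', h),
              middling_good T (u, v, w) (u', v', w') (Zero T X X', Zero T Y Y', h),
              Zero T (SigmaO T Y) (SigmaO T X') \<in> toda_bracket T k w' h v,
              \<exists>\<theta> \<in> Hom T (SigmaO T X) Y'. h = v' \<cdot> \<theta> \<cdot> w])) \<and>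
     (\<forall>f. triangle_map T (u, v, w) (u', v', w') (f, Zero T Y Y', Zero T Z Z') \<longrightarrow>
        (\<forall>k_f \<in> cones T f. \<forall>k_g \<in> cones T (Zero T Y Y').
         \<forall>k_gu \<in> cones T (Zero T Y Y' \<cdot> u). \<forall>k \<in> cones T (desuspend T X w).
           all_equivalent
             [good T (u, v, w) (u', v', w') (f, Zero T Y Y', Zero T Z Z'),
              verdier_good T k_f k_g k_gu (u, v, w) (u', v', w') (f, Zero T Y Y', Zero T Z Z'),
              middling_good T (u, v, w) (u', v', w') (f, Zero T Y Y', Zero T Z Z'),
              Zero T Z Y' \<in> toda_bracket_desuspended T Z k u' f (desuspend T X w),
              \<exists>\<theta> \<in> Hom T Y (InvSigmaO T Z'). f = desuspend T X' w' \<cdot> \<theta> \<cdot> u])) \<and>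
     (\<forall>g. triangle_map T (u, v, w) (u', v', w') (Zero T X X', g, Zero T Z Z') \<longrightarrow>
        (\<forall>k_f \<in> cones T (Zero T X X'). \<forall>k_g \<in> cones T g.
         \<forall>k_gu \<in> cones T (g \<cdot> u). \<forall>k \<in> cones T u.
           all_equivalent
             [good T (u, v, w) (u', v', w') (Zero T X X', g, Zero T Z Z'),
              verdier_good T k_f k_g k_gu (u, v, w) (u', v', w') (Zero T X X', g, Zero T Z Z'),
              middling_good T (u, v, w) (u', v', w') (Zero T X X', g, Zero T Z Z'),
              Zero T (SigmaO T X) Z' \<in> toda_bracket T k v' g u,
              \<exists>\<theta> \<in> Hom T Z X'. g = u' \<cdot> \<theta> \<cdot> v])) \<and>
     (\<forall>f g h. triangle_map T (u, v, w) (u', v', w') (f, g, h) \<and>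
        (f = Zero T X X' \<and> g = Zero T Y Y' \<or>
         f = Zero T X X' \<and> h = Zero T Z Z' \<or>
         g = Zero T Y Y' \<and> h = Zero T Z Z') \<longrightarrow>
        (\<forall>k_f \<in> cones T f. \<forall>k_g \<in> cones T g. \<forall>k_gu \<in> cones T (g \<cdot> u).
         \<forall>l_g \<in> cones T g. \<forall>l_h \<in> cones T h. \<forall>l_hv \<in> cones T (h \<cdot> v).
           verdier_good T k_f k_g k_gu (u, v, w) (u', v', w') (f, g, h) \<longleftrightarrow>
           verdier_good T l_g l_h l_hv
             (rotate_triangle T (u, v, w)) (rotate_triangle T (u', v', w'))
             (rotate_map T (f, g, h))))"
proof -
  interpret triangle_pair T X Y Z X' Y' Z' u v w u' v' w'
    using assms by (simp add: triangle_pair_def triangle_pair_axioms_def)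
  show ?thesis
    by (intro conjI allI impI ballI; (elim conjE)?;
        rule equivalent_h equivalent_f equivalent_g verdier_good_rotate_iff; assumption)
qed

end
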